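(* Let $\Gamma$ be a finitely generated group which is hyperbolic relative to a family of subgroups $\mathcal G$. Then $\Gamma$ is exact provided that each element of $\mathcal G$ is exact.
   Context: Relative hyperbolicity (in the sense of Bowditch): $\Gamma$ is hyperbolic relative to $\mathcal G$ if $\Gamma$ admits an action by graph automorphisms on a connected fine hyperbolic graph $K$ with finite quotient (finitely many orbits of vertices and of edges) such that all edge stabilizers are finite, the set of infinite vertex stabilizers is precisely $\mathcal G$, and each element of $\mathcal G$ is finitely generated. Graphs: graphs have no loops or multiple edges; $d$ is the path metric on the vertex set $V(K)$. A finite path of length $n$ is a sequence $x_0x_1\cdots x_n$ of vertices with each $x_i$ equal or adjacent to $x_{i+1}$. A circuit is a closed path ($x_0=x_n$) with $x_0,\dots,x_{n-1}$ distinct. A path $\alpha$ is geodesic if $d(\alpha(m),\alpha(n))=|m-n|$ for all $m,n$. The Gromov product is $\langle x,y\rangle_z=\frac12(d(x,z)+d(y,z)-d(x,y))$. $K$ is hyperbolic if there is $\delta>0$ such that for any finite geodesic paths $\alpha$ and $\beta$ starting at a common vertex $z$ and ending at $\alpha_+$ and $\beta_+$, and any $k\le\langle\alpha_+,\beta_+\rangle_z$, one has $d(\alpha(k),\beta(k))<\delta$. $K$ is fine if for every $n$ and every edge $e$, the set of circuits of length at most $n$ containing $e$ is finite. Exactness: for a discrete group $G$, $\mathrm{Prob}(G)=\{\mu\in\ell_1(G):\mu\ge0,\ \sum_{s}\mu(s)=1\}$ with the pointwise convergence topology (which coincides with the $\ell_1$-norm topology), and $(s\cdot\mu)(t)=\mu(s^{-1}t)$.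 An action of $G$ by homeomorphisms on a compact Hausdorff space $\Omega$ is amenable if for every finite $E\subset G$ and $\varepsilon>0$ there is a continuous map $\mu\colon\Omega\to\mathrm{Prob}(G)$, $\omega\mapsto\mu_\omega$, with $\max_{s\in E}\sup_{\omega\in\Omega}\|s\cdot\mu_\omega-\mu_{s\omega}\|_1\le\varepsilon$. The group $G$ is exact if it acts amenably on some (nonempty) compact Hausdorff space. *)

theory Defs
  imports
    "HOL-Analysis.Analysis"
    "HOL-Algebra.Group_Action"
    "HOL-Algebra.Generated_Groups"
begin

section \<open>Graphs\<close>

text \<open>
  A graph consists of a vertex set \<open>V\<close> and a set \<open>E\<close> of two-element subsets of \<open>V\<close>, so there are
  neither loops nor multiple edges. A path of length \<open>n\<close> is a list of \<open>n + 1\<close> vertices;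
  consecutive vertices may coincide.
\<close>

definition simple_graph :: "'v set \<Rightarrow> 'v set set \<Rightarrow> bool" where
  "simple_graph V E \<longleftrightarrow> (\<forall>e\<in>E. e \<subseteq> V \<and> card e = 2)"

definition graph_path :: "'v set \<Rightarrow> 'v set set \<Rightarrow> 'v list \<Rightarrow> bool" where
  "graph_path V E p \<longleftrightarrow> p \<noteq> [] \<and> set p \<subseteq> V \<and>
     (\<forall>i. Suc i < length p \<longrightarrow> p ! i = p ! Suc i \<or> {p ! i, p ! Suc i} \<in> E)"

definition path_length :: "'v list \<Rightarrow> nat" where
  "path_length p = length p - 1"

text \<open>
  Connected graphs are required to be nonempty: every group acts on the empty graph, so otherwise
  every group would be hyperbolic relative to the empty family.
\<close>

definition connected_graph :: "'v set \<Rightarrow> 'v set set \<Rightarrow> bool" where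
  "connected_graph V E \<longleftrightarrow> V \<noteq> {} \<and>
     (\<forall>x\<in>V. \<forall>y\<in>V. \<exists>p. graph_path V E p \<and> hd p = x \<and> last p = y)"

text \<open>The path metric; only meaningful for vertices joined by a path.\<close>

definition graph_dist :: "'v set \<Rightarrow> 'v set set \<Rightarrow> 'v \<Rightarrow> 'v \<Rightarrow> nat" where
  "graph_dist V E x y =
     (LEAST n. \<exists>p. graph_path V E p \<and> hd p = x \<and> last p = y \<and> path_length p = n)"

definition geodesic_path :: "'v set \<Rightarrow> 'v set set \<Rightarrow> 'v list \<Rightarrow> bool" where
  "geodesic_path V E p \<longleftrightarrow> graph_path V E p \<and>
     (\<forall>m<length p. \<forall>n<length p. int (graph_dist V E (p ! m) (p ! n)) = \<bar>int m - int n\<bar>)"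

definition gromov_product :: "'v set \<Rightarrow> 'v set set \<Rightarrow> 'v \<Rightarrow> 'v \<Rightarrow> 'v \<Rightarrow> real" where
  "gromov_product V E x y z =
     (real (graph_dist V E x z) + real (graph_dist V E y z) - real (graph_dist V E x y)) / 2"

text \<open>
  In a connected graph, the bound on \<open>k\<close> below guarantees that \<open>k\<close> is a valid position in both lists,
  because the Gromov product is at most the length of either geodesic.
\<close>

definition hyperbolic_graph :: "'v set \<Rightarrow> 'v set set \<Rightarrow> bool" where
  "hyperbolic_graph V E \<longleftrightarrow>
     (\<exists>\<delta>::real. \<delta> > 0 \<and>
       (\<forall>\<alpha> \<beta>. geodesic_path V E \<alpha> \<and> geodesic_path V E \<beta> \<and> hd \<alpha> = hd \<beta> \<longrightarrow>
         (\<forall>k::nat. real k \<le> gromov_product V E (last \<alpha>) (last \<beta>) (hd \<alpha>) \<longrightarrow>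
           real (graph_dist V E (\<alpha> ! k) (\<beta> ! k)) < \<delta>)))"

definition circuit :: "'v set \<Rightarrow> 'v set set \<Rightarrow> 'v list \<Rightarrow> bool" where
  "circuit V E p \<longleftrightarrow> graph_path V E p \<and> hd p = last p \<and> distinct (butlast p)"

definition path_edges :: "'v list \<Rightarrow> 'v set set" where
  "path_edges p = {{p ! i, p ! Suc i} | i. Suc i < length p}"

definition fine_graph :: "'v set \<Rightarrow> 'v set set \<Rightarrow> bool" where
  "fine_graph V E \<longleftrightarrow>
     (\<forall>n. \<forall>e\<in>E. finite {p. circuit V E p \<and> path_length p \<le> n \<and> e \<in> path_edges p})"

section \<open>Relatively hyperbolic groups\<close>

definition finitely_generated :: "('a, 'm) monoid_scheme \<Rightarrow> bool" where
  "finitely_generated G \<longleftrightarrow> (\<exists>A. finite A \<and> A \<subseteq> carrier G \<and> generate G A = carrier G)"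

definition graph_action ::
  "('a, 'm) monoid_scheme \<Rightarrow> 'v set \<Rightarrow> 'v set set \<Rightarrow> ('a \<Rightarrow> 'v \<Rightarrow> 'v) \<Rightarrow> bool" where
  "graph_action G V E \<phi> \<longleftrightarrow> group_action G V \<phi> \<and>
     (\<forall>g\<in>carrier G. \<forall>x\<in>V. \<forall>y\<in>V. {\<phi> g x, \<phi> g y} \<in> E \<longleftrightarrow> {x, y} \<in> E)"

text \<open>
  Edges are acted upon by taking images, so edge stabilizers are setwise. The first
  argument is the type of the vertices of the graph.
\<close>

definition rel_hyperbolic ::
  "'v itself \<Rightarrow> ('a, 'm) monoid_scheme \<Rightarrow> 'a set set \<Rightarrow> bool" where
  "rel_hyperbolic _ G \<G> \<longleftrightarrow>
     (\<exists>(V :: 'v set) E \<phi>.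
        simple_graph V E \<and> connected_graph V E \<and> fine_graph V E \<and> hyperbolic_graph V E \<and>
        graph_action G V E \<phi> \<and>
        finite (orbits G V \<phi>) \<and> finite (orbits G E (\<lambda>g e. \<phi> g ` e)) \<and>
        (\<forall>e\<in>E. finite (stabilizer G (\<lambda>g e. \<phi> g ` e) e)) \<and>
        \<G> = {stabilizer G \<phi> x | x. x \<in> V \<and> infinite (stabilizer G \<phi> x)} \<and>
        (\<forall>H\<in>\<G>. finitely_generated (G\<lparr>carrier := H\<rparr>)))"

section \<open>Exact groups\<close>

text \<open>
  Functions on a group are extensional, to match \<^const>\<open>product_topology\<close>. A nonnegative function
  with sum 1 is automatically in $\ell_1$.
\<close>

definition Prob :: "('a, 'm) monoid_scheme \<Rightarrow> ('a \<Rightarrow> real) set" where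
  "Prob G = {\<mu> \<in> extensional (carrier G). (\<forall>s\<in>carrier G. 0 \<le> \<mu> s) \<and> (\<mu> has_sum 1) (carrier G)}"

definition Prob_topology :: "('a, 'm) monoid_scheme \<Rightarrow> ('a \<Rightarrow> real) topology" where
  "Prob_topology G =
     subtopology (product_topology (\<lambda>_. euclideanreal) (carrier G)) (Prob G)"

definition translate :: "('a, 'm) monoid_scheme \<Rightarrow> 'a \<Rightarrow> ('a \<Rightarrow> real) \<Rightarrow> 'a \<Rightarrow> real" where
  "translate G s \<mu> = (\<lambda>t\<in>carrier G. \<mu> (inv\<^bsub>G\<^esub> s \<otimes>\<^bsub>G\<^esub> t))"

text \<open>
  The $\ell_1$-distance; only meaningful for functions that are summable over the group, as are
  the elements of \<^term>\<open>Prob G\<close> and their translates.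
\<close>

definition l1_dist :: "('a, 'm) monoid_scheme \<Rightarrow> ('a \<Rightarrow> real) \<Rightarrow> ('a \<Rightarrow> real) \<Rightarrow> real" where
  "l1_dist G \<mu> \<nu> = (\<Sum>\<^sub>\<infinity>t\<in>carrier G. \<bar>\<mu> t - \<nu> t\<bar>)"

definition homeomorphism_action ::
  "('a, 'm) monoid_scheme \<Rightarrow> 'x topology \<Rightarrow> ('a \<Rightarrow> 'x \<Rightarrow> 'x) \<Rightarrow> bool" where
  "homeomorphism_action G \<Omega> \<psi> \<longleftrightarrow>
     group_action G (topspace \<Omega>) \<psi> \<and> (\<forall>g\<in>carrier G. homeomorphic_map \<Omega> \<Omega> (\<psi> g))"

definition amenable_action ::
  "('a, 'm) monoid_scheme \<Rightarrow> 'x topology \<Rightarrow> ('a \<Rightarrow> 'x \<Rightarrow> 'x) \<Rightarrow> bool" where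
  "amenable_action G \<Omega> \<psi> \<longleftrightarrow>
     homeomorphism_action G \<Omega> \<psi> \<and>
     (\<forall>E \<epsilon>. finite E \<and> E \<subseteq> carrier G \<and> \<epsilon> > 0 \<longrightarrow>
       (\<exists>\<mu>. continuous_map \<Omega> (Prob_topology G) \<mu> \<and>
         (\<forall>s\<in>E. \<forall>\<omega>\<in>topspace \<Omega>. l1_dist G (translate G s (\<mu> \<omega>)) (\<mu> (\<psi> s \<omega>)) \<le> \<epsilon>)))"

text \<open>
  The first argument is the type of the points of the compact space. For a group with elements of
  type \<open>'a\<close>, the type \<open>'a set set\<close> loses no generality: if the group acts amenably on some nonempty
  compact Hausdorff space, then it acts amenably on its Stone--Cech compactification, the space of
  ultrafilters on the group, by pulling back along the extension of an orbit map.
\<close>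

definition exact_group :: "'x itself \<Rightarrow> ('a, 'm) monoid_scheme \<Rightarrow> bool" where
  "exact_group _ G \<longleftrightarrow>
     (\<exists>(\<Omega> :: 'x topology) \<psi>. topspace \<Omega> \<noteq> {} \<and> compact_space \<Omega> \<and> Hausdorff_space \<Omega> \<and>
        amenable_action G \<Omega> \<psi>)"

end

theory Submission
  imports Defs "HOL-Real_Asymp.Real_Asymp"
begin

text \<open>
  Exactness is equivalent to property A: for finite \<open>S\<close> and \<open>e > 0\<close> there are probability
  functions \<open>\<mu> z\<close>, all supported in one finite set, such that the left translate of \<open>\<mu> z\<close> by
  \<open>s \<in> S\<close> is \<open>e\<close>-close to \<open>\<mu> (s z)\<close>. This makes sense for \<open>z\<close> in any subset of the group.

  Fineness alone shows that each set \<open>{z. d (z v) w < n}\<close> has property A, by induction on \<open>n\<close>: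
  outside finitely many smaller sets of this kind, elements of the sphere that differ by some
  \<open>s \<in> S\<close> lie in one coset of the stabilizer of \<open>w\<close>.

  Hyperbolicity provides probability functions \<open>\<eta> x\<close> on the vertices, supported at bounded distance
  from \<open>x\<close> and varying slowly with \<open>x\<close>: average over \<open>k\<close> the uniform measures on the points at
  distance \<open>l\<close> from the start of geodesics from the ball of radius \<open>k\<close> around \<open>x\<close> to a fixed target.
  By uniform fineness there are only \<open>O(k)\<close> such points. Mixing the functions \<open>\<mu>\<close> of the sets above with
  weights \<open>\<eta> (z\<inverse> w)\<close> gives property A of the whole group.
\<close>

section \<open>Finitely supported probability functions\<close>

text \<open>Vertices may have infinite valence and infinite stabilizers, so balls in the graph
  cannot be counted, and the set of group elements moving a vertex into a ball may be infinite.
  There are two remedies. Property A of a subset tests \<open>s\<close> only if \<open>z\<close> and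
  \<open>s \<otimes> z\<close> both lie in the subset, so removing a piece deletes comparisons,
  until only those inside cosets of one stabilizer survive. And points are counted far from the ends
  of geodesics: well before their ends, geodesics from the target to nearby vertices fellow-travel,
  and a point of one lies on a short circuit through an edge of the other.

  The functions \<eta> are not equivariant; their target is an arbitrary vertex. The argument
  \<open>z\<inverse> w\<close> makes this harmless: replacing \<open>z\<close> by \<open>s z\<close>
  moves it by the distance from \<open>w\<close> to \<open>s w\<close>, whatever \<open>z\<close>
  is, while left translation falls entirely on the functions \<mu>. A vertex \<open>v = g o\<close>
  of positive weight satisfies \<open>d (z v) w \<le> R\<close>, so \<open>z g\<close> lies in the
  set attached to one of finitely many orbit representatives \<open>o\<close>.\<close>

definition fprob :: "'i set \<Rightarrow> ('i \<Rightarrow> real) \<Rightarrow> bool" where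
  "fprob F p \<longleftrightarrow> finite F \<and> (\<forall>i. 0 \<le> p i) \<and> (\<forall>i. i \<notin> F \<longrightarrow> p i = 0) \<and> sum p F = 1"

text \<open>Summing over the points of disagreement frees the distance from a choice of supports. It
  is the l1 norm of the difference as long as that set is finite, as it is for finitely supported
  functions.\<close>

definition l1d :: "('i \<Rightarrow> real) \<Rightarrow> ('i \<Rightarrow> real) \<Rightarrow> real" where
  "l1d p q = (\<Sum>i | p i \<noteq> q i. \<bar>p i - q i\<bar>)"

text \<open>Indices of weight zero are left out of the sum, so that nothing has to be known about
  \<open>P i\<close> there.\<close>

definition mixture :: "('i \<Rightarrow> real) \<Rightarrow> ('i \<Rightarrow> 'b \<Rightarrow> real) \<Rightarrow> 'b \<Rightarrow> real" where
  "mixture p P t = (\<Sum>i | p i \<noteq> 0. p i * P i t)"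

definition unif :: "'i set \<Rightarrow> 'i \<Rightarrow> real" where
  "unif A i = (if i \<in> A then 1 / card A else 0)"

lemma l1d_eq:
  assumes "finite F" "\<And>i. i \<notin> F \<Longrightarrow> p i = q i"
  shows "l1d p q = (\<Sum>i\<in>F. \<bar>p i - q i\<bar>)"
  unfolding l1d_def by (rule sum.mono_neutral_left) (use assms in auto)

lemma l1d_nonneg: "0 \<le> l1d p q"
  unfolding l1d_def by (rule sum_nonneg) auto

lemma l1d_refl [simp]: "l1d p p = 0"
  unfolding l1d_def by simp

lemma l1d_commute: "l1d p q = l1d q p"
  unfolding l1d_def by (rule sum.cong) (auto simp: abs_minus_commute)

lemma l1d_triangle:
  assumes "fprob F p" "fprob G q" "fprob H r"
  shows "l1d p r \<le> l1d p q + l1d q r"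
proof -
  let ?S = "F \<union> G \<union> H"
  have "l1d p r = (\<Sum>i\<in>?S. \<bar>p i - r i\<bar>)" "l1d p q = (\<Sum>i\<in>?S. \<bar>p i - q i\<bar>)"
    "l1d q r = (\<Sum>i\<in>?S. \<bar>q i - r i\<bar>)"
    using assms by (auto simp: fprob_def intro!: l1d_eq)
  moreover have "(\<Sum>i\<in>?S. \<bar>p i - r i\<bar>) \<le> (\<Sum>i\<in>?S. \<bar>p i - q i\<bar> + \<bar>q i - r i\<bar>)"
    by (rule sum_mono) linarith
  ultimately show ?thesis by (simp add: sum.distrib)
qed

lemma fprob_mono: "fprob F p \<Longrightarrow> F \<subseteq> F' \<Longrightarrow> finite F' \<Longrightarrow> fprob F' p"
  unfolding fprob_def using sum.mono_neutral_left[of F' F p] by auto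

lemma fprob_unif: "finite A \<Longrightarrow> A \<noteq> {} \<Longrightarrow> fprob A (unif A)"
  unfolding fprob_def unif_def by auto

text \<open>Both functions have mass one, so the loss on \<open>A\<close> equals the gain on
  \<open>B - A\<close>, which is \<open>1 - card A / card B\<close>.\<close>

lemma l1d_unif_subset:
  assumes "finite B" "A \<subseteq> B" "A \<noteq> {}"
  shows "l1d (unif A) (unif B) = 2 * (1 - card A / card B)"
proof -
  have fA: "finite A" using assms finite_subset by blast
  have cA: "card A > 0" and cB: "card B > 0" and le: "card A \<le> card B"
    using assms fA by (auto simp: card_gt_0_iff card_mono)
  have "l1d (unif A) (unif B) = (\<Sum>i\<in>B. \<bar>unif A i - unif B i\<bar>)"
    using assms by (intro l1d_eq) (auto simp: unif_def)
  also have "\<dots> = (\<Sum>i\<in>B - A. \<bar>unif A i - unif B i\<bar>) + (\<Sum>i\<in>A. \<bar>unif A i - unif B i\<bar>)"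
    using assms by (intro sum.subset_diff) auto
  also have "(\<Sum>i\<in>A. \<bar>unif A i - unif B i\<bar>) = (\<Sum>i\<in>A. 1 / card A - 1 / card B)"
    using assms le cA by (intro sum.cong) (auto simp: unif_def field_simps)
  also have "(\<Sum>i\<in>B - A. \<bar>unif A i - unif B i\<bar>) = (\<Sum>i\<in>B - A. 1 / card B)"
    using assms by (intro sum.cong) (auto simp: unif_def)
  finally have "l1d (unif A) (unif B) =
      (real (card B) - card A) * (1 / card B) + card A * (1 / card A - 1 / card B)"
    using le assms fA by (simp add: card_Diff_subset of_nat_diff)
  also have "\<dots> = 2 * (1 - card A / card B)"
    using cA cB by (simp add: diff_divide_distrib right_diff_distrib)
  finally show ?thesis .
qed

lemma mixture_eq:
  assumes "finite I" "\<And>i. i \<notin> I \<Longrightarrow> p i = 0"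
  shows "mixture p P t = (\<Sum>i\<in>I. p i * P i t)"
  unfolding mixture_def by (rule sum.mono_neutral_left) (use assms in auto)

lemma fprob_mixture:
  assumes p: "fprob I p" and F: "finite F" and P: "\<And>i. p i > 0 \<Longrightarrow> fprob F (P i)"
  shows "fprob F (mixture p P)"
proof -
  have m: "mixture p P t = (\<Sum>i\<in>I. p i * P i t)" for t
    using p by (intro mixture_eq) (auto simp: fprob_def)
  have pos: "p i = 0 \<or> p i > 0" for i using p by (auto simp: fprob_def le_less)
  have nn: "0 \<le> p i * P i t" for i t
    using pos[of i] P[of i] by (auto simp: fprob_def)
  have z: "p i * P i t = 0" if "t \<notin> F" for i t
    using pos[of i] P[of i] that by (auto simp: fprob_def)
  have "(\<Sum>t\<in>F. mixture p P t) = (\<Sum>i\<in>I. p i * (\<Sum>t\<in>F. P i t))"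
    unfolding m by (subst sum.swap) (simp add: sum_distrib_left)
  also have "\<dots> = (\<Sum>i\<in>I. p i)"
    using pos P by (intro sum.cong) (force simp: fprob_def)+
  also have "\<dots> = 1" using p by (auto simp: fprob_def)
  finally show ?thesis
    using nn z F unfolding fprob_def by (auto simp: m intro!: sum_nonneg sum.neutral)
qed

text \<open>At each index \<open>p P - q Q = (p - q) P + q (P - Q)\<close>, which is why the errors
  \<open>e i\<close> carry the weights of \<open>q\<close>. They matter only at indices that both
  \<open>p\<close> and \<open>q\<close> charge: elsewhere the difference of the weights pays for the
  whole term.\<close>

lemma l1d_mixture:
  assumes p: "fprob I p" and q: "fprob J q" and F: "finite F"
    and P: "\<And>i. p i > 0 \<Longrightarrow> fprob F (P i)" and Q: "\<And>i. q i > 0 \<Longrightarrow> fprob F (Q i)"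
    and e: "\<And>i. p i > 0 \<Longrightarrow> q i > 0 \<Longrightarrow> l1d (P i) (Q i) \<le> e i"
    and e0: "\<And>i. 0 \<le> e i"
  shows "l1d (mixture p P) (mixture q Q) \<le> l1d p q + (\<Sum>i\<in>J. q i * e i)"
proof -
  let ?K = "I \<union> J"
  have K: "finite ?K" using p q by (auto simp: fprob_def)
  have mp: "mixture p P t = (\<Sum>i\<in>?K. p i * P i t)" for t
    using p K by (intro mixture_eq) (auto simp: fprob_def)
  have mq: "mixture q Q t = (\<Sum>i\<in>?K. q i * Q i t)" for t
    using q K by (intro mixture_eq) (auto simp: fprob_def)
  have p0: "p i = 0 \<or> p i > 0" for i using p by (auto simp: fprob_def le_less)
  have q0: "q i = 0 \<or> q i > 0" for i using q by (auto simp: fprob_def le_less)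
  have one: "(\<Sum>t\<in>F. \<bar>p i * P i t - q i * Q i t\<bar>) \<le> \<bar>p i - q i\<bar> + q i * e i" for i
  proof -
    consider "p i = 0" | "p i > 0" "q i = 0" | "p i > 0" "q i > 0" using p0[of i] q0[of i] by blast
    then show ?thesis
    proof cases
      case 1
      show ?thesis
      proof (cases "q i > 0")
        case True
        have "(\<Sum>t\<in>F. \<bar>p i * P i t - q i * Q i t\<bar>) = (\<Sum>t\<in>F. q i * Q i t)"
          using True Q[OF True] 1 by (intro sum.cong) (auto simp: fprob_def)
        also have "\<dots> = q i" using Q[OF True] by (simp add: fprob_def flip: sum_distrib_left)
        finally show ?thesis using True 1 e0[of i] by (simp add: mult_nonneg_nonneg)
      next
        case False then show ?thesis using 1 q0[of i] by auto
      qed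
    next
      case 2
      have "(\<Sum>t\<in>F. \<bar>p i * P i t - q i * Q i t\<bar>) = (\<Sum>t\<in>F. p i * P i t)"
        using 2 P[OF 2(1)] by (intro sum.cong) (auto simp: fprob_def)
      also have "\<dots> = p i" using P[OF 2(1)] by (simp add: fprob_def flip: sum_distrib_left)
      finally show ?thesis using 2 by simp
    next
      case 3
      note P = P[OF 3(1)] and Q = Q[OF 3(2)]
      have "(\<Sum>t\<in>F. \<bar>p i * P i t - q i * Q i t\<bar>)
          \<le> (\<Sum>t\<in>F. \<bar>p i - q i\<bar> * P i t + q i * \<bar>P i t - Q i t\<bar>)"
      proof (rule sum_mono)
        fix t
        have "p i * P i t - q i * Q i t = (p i - q i) * P i t + q i * (P i t - Q i t)"
          by (simp add: algebra_simps)
        also have "\<bar>\<dots>\<bar> \<le> \<bar>(p i - q i) * P i t\<bar> + \<bar>q i * (P i t - Q i t)\<bar>" by (rule abs_triangle_ineq)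
        finally show "\<bar>p i * P i t - q i * Q i t\<bar> \<le> \<bar>p i - q i\<bar> * P i t + q i * \<bar>P i t - Q i t\<bar>"
          using P 3 by (simp add: abs_mult fprob_def)
      qed
      also have "\<dots> = \<bar>p i - q i\<bar> + q i * l1d (P i) (Q i)"
        using P Q F by (subst l1d_eq[of F]) (auto simp: fprob_def sum.distrib simp flip: sum_distrib_left)
      also have "\<dots> \<le> \<bar>p i - q i\<bar> + q i * e i" using e 3 by (simp add: mult_left_mono)
      finally show ?thesis .
    qed
  qed
  have "l1d (mixture p P) (mixture q Q) = (\<Sum>t\<in>F. \<bar>mixture p P t - mixture q Q t\<bar>)"
    using fprob_mixture[OF p F P] fprob_mixture[OF q F Q] F by (intro l1d_eq) (auto simp: fprob_def)
  also have "\<dots> \<le> (\<Sum>t\<in>F. \<Sum>i\<in>?K. \<bar>p i * P i t - q i * Q i t\<bar>)"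
    unfolding mp mq sum_subtractf[symmetric] by (intro sum_mono sum_abs)
  also have "\<dots> = (\<Sum>i\<in>?K. \<Sum>t\<in>F. \<bar>p i * P i t - q i * Q i t\<bar>)" by (rule sum.swap)
  also have "\<dots> \<le> (\<Sum>i\<in>?K. \<bar>p i - q i\<bar> + q i * e i)" by (intro sum_mono one)
  also have "\<dots> = l1d p q + (\<Sum>i\<in>?K. q i * e i)"
    using p q K by (subst l1d_eq[of ?K]) (auto simp: fprob_def sum.distrib)
  also have "(\<Sum>i\<in>?K. q i * e i) = (\<Sum>i\<in>J. q i * e i)"
    using K q by (intro sum.mono_neutral_right) (auto simp: fprob_def)
  finally show ?thesis .
qed

lemma l1d_mixture_const:
  assumes p: "fprob I p" and q: "fprob J q" and F: "finite F"
    and P: "\<And>i. p i > 0 \<Longrightarrow> fprob F (P i)" and Q: "\<And>i. q i > 0 \<Longrightarrow> fprob F (Q i)"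
    and e: "\<And>i. p i > 0 \<Longrightarrow> q i > 0 \<Longrightarrow> l1d (P i) (Q i) \<le> e"
    and e0: "0 \<le> e"
  shows "l1d (mixture p P) (mixture q Q) \<le> l1d p q + e"
proof -
  have "(\<Sum>i\<in>J. q i * e) = e" using q by (simp add: fprob_def flip: sum_distrib_right)
  then show ?thesis using l1d_mixture[OF p q F P Q e e0] by simp
qed

text \<open>
  Kaimanovich's trick: since \<open>1 - card (T k x) / card (T (Suc k) x)\<close> is at most the increment of
  \<open>\<lambda>k. ln (card (T k x))\<close>, most consecutive sets are almost equal when cardinalities grow
  subexponentially.
\<close>

lemma card_ratio_le_ln:
  assumes "finite B" "A \<subseteq> B" "A \<noteq> {}"
  shows "1 - card A / card B \<le> ln (card B) - ln (card A)"
proof -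
  have fA: "finite A" using assms finite_subset by blast
  have cA: "card A > 0" and cB: "card B > 0"
    using assms fA by (auto simp: card_gt_0_iff)
  have "ln (card A / card B) \<le> card A / card B - 1"
    using cA cB by (intro ln_le_minus_one) auto
  then show ?thesis using cA cB by (simp add: ln_div)
qed

lemma l1d_average_le:
  fixes T :: "nat \<Rightarrow> 'x \<Rightarrow> 'i set" and n :: nat and B :: real
  assumes n: "n > 0"
    and fin: "\<And>k z. z \<in> {x, y} \<Longrightarrow> k \<le> Suc n \<Longrightarrow> finite (T k z) \<and> T k z \<noteq> {} \<and> card (T k z) \<le> B"
    and sub: "\<And>k z z'. z \<in> {x, y} \<Longrightarrow> z' \<in> {x, y} \<Longrightarrow> T k z \<subseteq> T (Suc k) z'"
  shows "l1d (mixture (unif {..<n}) (\<lambda>k. unif (T k x))) (mixture (unif {..<n}) (\<lambda>k. unif (T k y))) \<le> 6 * ln B / n"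
proof -
  let ?F = "T (Suc n) x \<union> T (Suc n) y"
  have mono: "T j z \<subseteq> T k z" if "j \<le> k" "z \<in> {x, y}" for j k z
    using that(1) by (rule lift_Suc_mono_le[of "\<lambda>k. T k z", rotated]) (use sub that in blast)
  define c where "c z k = ln (card (T k z))" for z k
  have c: "c z k \<le> ln B" "0 \<le> c z k" if "z \<in> {x, y}" "k \<le> Suc n" for z k
  proof -
    have "card (T k z) \<ge> 1" using fin[OF that] by (simp add: Suc_leI card_gt_0_iff)
    then show "0 \<le> c z k" "c z k \<le> ln B" using fin[OF that] unfolding c_def by auto
  qed
  have fp: "fprob ?F (unif (T k z))" if "z \<in> {x, y}" "k < n" for z k
  proof (rule fprob_mono[OF fprob_unif])
    show "T k z \<subseteq> ?F" using mono[of k "Suc n" z] that by auto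
  qed (use fin[of z k] fin[of _ "Suc n"] that in auto)
  \<comment> \<open>\<open>T k x\<close> and \<open>T k y\<close> need not be nested. The detour
    through \<open>T (Suc k) y\<close> uses only inclusions: it contains both of them and lies in
    \<open>T (k+2) x\<close>.\<close>
  have step: "l1d (unif (T k x)) (unif (T k y)) \<le> 2 * (c x (k+2) - c x k) + 2 * (c y (Suc k) - c y k)"
    if k: "k < n" for k
  proof -
    have f: "finite (T (Suc k) z)" "finite (T (k+2) z)" "finite (T k z)" "T k z \<noteq> {}" "T (Suc k) z \<noteq> {}"
      if "z \<in> {x,y}" for z
      using fin[of z k] fin[of z "Suc k"] fin[of z "k+2"] k that by auto
    have a: "l1d (unif (T k x)) (unif (T (Suc k) y)) \<le> 2 * (c x (k+2) - c x k)"
    proof -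
      have s1: "T k x \<subseteq> T (Suc k) y" and s2: "T (Suc k) y \<subseteq> T (k + 2) x"
        using sub[of x y k] sub[of y x "Suc k"] by auto
      have "l1d (unif (T k x)) (unif (T (Suc k) y)) = 2 * (1 - card (T k x) / card (T (Suc k) y))"
        by (rule l1d_unif_subset) (use f s1 in auto)
      also have "\<dots> \<le> 2 * (1 - card (T k x) / card (T (k+2) x))"
      proof -
        have "card (T (Suc k) y) \<le> card (T (k+2) x)" "0 < card (T (Suc k) y)"
          using card_mono[OF _ s2] f[of x] f[of y] by (auto simp: card_gt_0_iff)
        then show ?thesis by (simp add: frac_le)
      qed
      also have "1 - card (T k x) / card (T (k+2) x) \<le> c x (k+2) - c x k"
        unfolding c_def by (rule card_ratio_le_ln) (use f[of x] s1 s2 in auto)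
      finally show ?thesis by simp
    qed
    have b: "l1d (unif (T (Suc k) y)) (unif (T k y)) \<le> 2 * (c y (Suc k) - c y k)"
      unfolding l1d_commute[of "unif (T (Suc k) y)"]
      using l1d_unif_subset[of "T (Suc k) y" "T k y"] card_ratio_le_ln[of "T (Suc k) y" "T k y"]
        sub[of y y k] f[of y] by (auto simp: c_def)
    show ?thesis
      using l1d_triangle[OF fprob_unif[OF f(3,4)] fprob_unif[OF f(1,5)] fprob_unif[OF f(3,4)], of x y y] a b by auto
  qed
  have un: "fprob {..<n} (unif {..<n})" by (rule fprob_unif) (use n in auto)
  have "l1d (mixture (unif {..<n}) (\<lambda>k. unif (T k x))) (mixture (unif {..<n}) (\<lambda>k. unif (T k y)))
     \<le> l1d (unif {..<n}) (unif {..<n}) + (\<Sum>k<n. unif {..<n} k * l1d (unif (T k x)) (unif (T k y)))"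
    by (rule l1d_mixture[OF un un, where F="?F"])
       (use fin[of _ "Suc n"] fp in \<open>auto simp: unif_def l1d_nonneg split: if_splits\<close>)
  also have "\<dots> = (\<Sum>k<n. l1d (unif (T k x)) (unif (T k y))) / n"
    by (simp add: unif_def sum_divide_distrib)
  also have "\<dots> \<le> (\<Sum>k<n. 2 * (c x (k+2) - c x k) + 2 * (c y (Suc k) - c y k)) / n"
    using step by (intro divide_right_mono sum_mono) auto
  \<comment> \<open>The sum telescopes. Two terms survive at the top for \<open>x\<close>, where the
    step is two, and one for \<open>y\<close>; each is at most \<open>ln B\<close> and has the
    factor 2, which gives 6.\<close>
  also have "(\<Sum>k<n. 2 * (c x (k+2) - c x k) + 2 * (c y (Suc k) - c y k))
     = 2 * (c x n + c x (Suc n) - c x 0 - c x 1) + 2 * (c y n - c y 0)"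
    by (induction n) (auto simp: algebra_simps)
  also have "\<dots> \<le> 6 * ln B"
    using c[of x n] c[of x "Suc n"] c[of x 0] c[of x 1] c[of y n] c[of y 0] n by auto
  finally show ?thesis by (simp add: divide_right_mono)
qed

section \<open>Property A of subsets of a group\<close>

context group
begin

text \<open>Unlike \<open>translate\<close>, this is 0 off the carrier, so that the translate of a
  finitely supported probability function is again one.\<close>

definition left_shift :: "'a \<Rightarrow> ('a \<Rightarrow> real) \<Rightarrow> 'a \<Rightarrow> real" where
  "left_shift s p t = (if t \<in> carrier G then p (inv s \<otimes> t) else 0)"

text \<open>The content lies in the single finite \<open>F\<close> for all \<open>z\<close>: point
  masses at \<open>z\<close> would be translated exactly onto each other.\<close>

definition almost_inv :: "'a set \<Rightarrow> 'a set \<Rightarrow> real \<Rightarrow> bool" where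
  "almost_inv X S e \<longleftrightarrow> (\<exists>F \<mu>. F \<subseteq> carrier G \<and> finite F \<and> (\<forall>z\<in>X. fprob F (\<mu> z)) \<and>
     (\<forall>s\<in>S. \<forall>z\<in>X. s \<otimes> z \<in> X \<longrightarrow> l1d (left_shift s (\<mu> z)) (\<mu> (s \<otimes> z)) \<le> e))"

definition property_A :: "'a set \<Rightarrow> bool" where
  "property_A X \<longleftrightarrow> (\<forall>S e. finite S \<and> S \<subseteq> carrier G \<and> e > 0 \<longrightarrow> almost_inv X S e)"

lemma inv_mult_cancel [simp]: "s \<in> carrier G \<Longrightarrow> t \<in> carrier G \<Longrightarrow> inv s \<otimes> (s \<otimes> t) = t"
  by (simp add: m_assoc[symmetric])

lemma mult_inv_cancel [simp]: "s \<in> carrier G \<Longrightarrow> t \<in> carrier G \<Longrightarrow> s \<otimes> (inv s \<otimes> t) = t"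
  by (simp add: m_assoc[symmetric])

lemma inj_on_mult: "s \<in> carrier G \<Longrightarrow> F \<subseteq> carrier G \<Longrightarrow> inj_on ((\<otimes>) s) F"
  by (rule inj_onI) (metis inv_mult_cancel subsetD)

lemma fprob_left_shift:
  assumes s: "s \<in> carrier G" and F: "F \<subseteq> carrier G" and p: "fprob F p"
  shows "fprob ((\<otimes>) s ` F) (left_shift s p)"
proof -
  have inj: "inj_on ((\<otimes>) s) F" using s F by (rule inj_on_mult)
  have "sum (left_shift s p) ((\<otimes>) s ` F) = (\<Sum>t\<in>F. left_shift s p (s \<otimes> t))"
    using sum.reindex[OF inj, of "left_shift s p"] by simp
  also have "\<dots> = sum p F"
    using s F by (intro sum.cong) (auto simp: left_shift_def)
  finally have "sum (left_shift s p) ((\<otimes>) s ` F) = 1" using p by (simp add: fprob_def)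
  moreover have "left_shift s p t = 0" if "t \<notin> (\<otimes>) s ` F" for t
  proof (cases "t \<in> carrier G")
    case True
    then have "t = s \<otimes> (inv s \<otimes> t)" using s by simp
    then have "inv s \<otimes> t \<notin> F" using that by blast
    then show ?thesis using p by (auto simp: left_shift_def fprob_def)
  qed (auto simp: left_shift_def)
  ultimately show ?thesis using p by (auto simp: fprob_def left_shift_def)
qed

lemma left_shift_left_shift: "s \<in> carrier G \<Longrightarrow> t \<in> carrier G \<Longrightarrow> left_shift s (left_shift t p) = left_shift (s \<otimes> t) p"
  by (auto simp: left_shift_def fun_eq_iff inv_mult_group m_assoc)

lemma l1d_left_shift:
  assumes s: "s \<in> carrier G" and F: "F \<subseteq> carrier G" and p: "fprob F p" and q: "fprob F q"
  shows "l1d (left_shift s p) (left_shift s q) = l1d p q"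
proof -
  have inj: "inj_on ((\<otimes>) s) F" using s F by (rule inj_on_mult)
  note P = fprob_left_shift[OF s F p] and Q = fprob_left_shift[OF s F q]
  have "l1d (left_shift s p) (left_shift s q) = (\<Sum>t\<in>(\<otimes>) s ` F. \<bar>left_shift s p t - left_shift s q t\<bar>)"
    using P Q by (intro l1d_eq) (auto simp: fprob_def)
  also have "\<dots> = (\<Sum>t\<in>F. \<bar>left_shift s p (s \<otimes> t) - left_shift s q (s \<otimes> t)\<bar>)"
    using sum.reindex[OF inj, of "\<lambda>t. \<bar>left_shift s p t - left_shift s q t\<bar>"] by simp
  also have "\<dots> = (\<Sum>t\<in>F. \<bar>p t - q t\<bar>)"
    using s F by (intro sum.cong) (auto simp: left_shift_def)
  also have "\<dots> = l1d p q" using p q by (intro l1d_eq[symmetric]) (auto simp: fprob_def)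
  finally show ?thesis .
qed

lemma left_shift_mixture: "left_shift s (mixture p P) = mixture p (\<lambda>i. left_shift s (P i))"
  by (auto simp: left_shift_def mixture_def fun_eq_iff)

section \<open>Gluing and permanence of property A\<close>

lemma almost_invE:
  assumes "almost_inv X S e"
  obtains F \<mu> where "F \<subseteq> carrier G" "finite F" "\<forall>z\<in>X. fprob F (\<mu> z)"
    "\<forall>s\<in>S. \<forall>z\<in>X. s \<otimes> z \<in> X \<longrightarrow> l1d (left_shift s (\<mu> z)) (\<mu> (s \<otimes> z)) \<le> e"
  using assms unfolding almost_inv_def by (elim exE conjE) (rule that)

lemma property_AD: "property_A X \<Longrightarrow> finite S \<Longrightarrow> S \<subseteq> carrier G \<Longrightarrow> e > 0 \<Longrightarrow> almost_inv X S e"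
  unfolding property_A_def by blast

lemma almost_inv_mono:
  assumes "almost_inv Y S e" "X \<subseteq> Y"
  shows "almost_inv X S e"
proof -
  obtain F \<mu> where F: "F \<subseteq> carrier G" "finite F" "\<forall>z\<in>Y. fprob F (\<mu> z)"
    and e: "\<forall>s\<in>S. \<forall>z\<in>Y. s \<otimes> z \<in> Y \<longrightarrow> l1d (left_shift s (\<mu> z)) (\<mu> (s \<otimes> z)) \<le> e"
    by (rule almost_invE[OF assms(1)])
  show ?thesis
    unfolding almost_inv_def
  proof (intro exI[of _ F] exI[of _ \<mu>] conjI ballI impI)
    fix s z assume "s \<in> S" "z \<in> X" "s \<otimes> z \<in> X"
    then show "l1d (left_shift s (\<mu> z)) (\<mu> (s \<otimes> z)) \<le> e"
      using e[rule_format, of s z] assms(2) by auto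
  qed (use F assms(2) in auto)
qed

text \<open>The indices stay fixed and the shift acts on the \<nu> only, so the errors of the
  weights and of the glued functions add up. The index type is \<open>bool\<close> when two partial
  solutions are interpolated, and the type of vertices when the whole group is treated.\<close>

lemma almost_inv_glue:
  fixes \<phi> :: "'a \<Rightarrow> 'i \<Rightarrow> real"
  assumes S: "finite S" "S \<subseteq> carrier G" and F: "finite F" "F \<subseteq> carrier G"
    and \<phi>: "\<And>z. z \<in> X \<Longrightarrow> fprob (I z) (\<phi> z)"
    and \<nu>: "\<And>z i. z \<in> X \<Longrightarrow> \<phi> z i > 0 \<Longrightarrow> fprob F (\<nu> i z)"
    and e1: "\<And>s z. s \<in> S \<Longrightarrow> z \<in> X \<Longrightarrow> s \<otimes> z \<in> X \<Longrightarrow> l1d (\<phi> z) (\<phi> (s \<otimes> z)) \<le> e1"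
    and e2: "\<And>s z i. s \<in> S \<Longrightarrow> z \<in> X \<Longrightarrow> s \<otimes> z \<in> X \<Longrightarrow> \<phi> z i > 0 \<Longrightarrow> \<phi> (s \<otimes> z) i > 0 \<Longrightarrow>
       l1d (left_shift s (\<nu> i z)) (\<nu> i (s \<otimes> z)) \<le> e2"
    and "0 \<le> e2"
  shows "almost_inv X S (e1 + e2)"
  unfolding almost_inv_def
proof (intro exI[of _ F] exI[of _ "\<lambda>z. mixture (\<phi> z) (\<lambda>i. \<nu> i z)"] conjI ballI impI)
  fix s z assume s: "s \<in> S" and z: "z \<in> X" and sz: "s \<otimes> z \<in> X"
  have sG: "s \<in> carrier G" using s S by auto
  let ?F = "F \<union> (\<otimes>) s ` F"
  have "l1d (mixture (\<phi> z) (\<lambda>i. left_shift s (\<nu> i z))) (mixture (\<phi> (s \<otimes> z)) (\<lambda>i. \<nu> i (s \<otimes> z)))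
      \<le> l1d (\<phi> z) (\<phi> (s \<otimes> z)) + e2"
  proof (rule l1d_mixture_const[OF \<phi>[OF z] \<phi>[OF sz], where F = ?F])
    fix i assume "0 < \<phi> z i"
    from fprob_left_shift[OF sG F(2) \<nu>[OF z this]] show "fprob ?F (left_shift s (\<nu> i z))"
      by (rule fprob_mono) (use F in auto)
  next
    fix i assume "0 < \<phi> (s \<otimes> z) i"
    from \<nu>[OF sz this] show "fprob ?F (\<nu> i (s \<otimes> z))"
      by (rule fprob_mono) (use F in auto)
  qed (use F e2 s z sz \<open>0 \<le> e2\<close> in auto)
  then show "l1d (left_shift s (mixture (\<phi> z) (\<lambda>i. \<nu> i z))) (mixture (\<phi> (s \<otimes> z)) (\<lambda>i. \<nu> i (s \<otimes> z))) \<le> e1 + e2"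
    using e1[OF s z sz] by (simp add: left_shift_mixture)
next
  fix z assume z: "z \<in> X"
  show "fprob F (mixture (\<phi> z) (\<lambda>i. \<nu> i z))" by (rule fprob_mixture[OF \<phi>[OF z] F(1) \<nu>[OF z]])
qed (use F in auto)

text \<open>A point is pushed into \<open>A\<close> by a chosen \<open>t z\<close>, and the function
  found there is pulled back. A step by \<open>s\<close> becomes the step
  \<open>t (s z) s (t z)\<inverse>\<close> between points of \<open>A\<close>, and these elements
  lie in the finite set \<open>?S\<close>.\<close>

lemma property_A_nbhd:
  assumes A: "property_A A" and T: "finite T" "T \<subseteq> carrier G"
  shows "property_A {z \<in> carrier G. \<exists>t\<in>T. t \<otimes> z \<in> A}" (is "property_A ?X")
  unfolding property_A_def
proof (intro allI impI)
  fix S and e :: real assume S: "finite S \<and> S \<subseteq> carrier G \<and> e > 0"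
  let ?S = "(\<lambda>(t', s, t). t' \<otimes> s \<otimes> inv t) ` (T \<times> S \<times> T)"
  have "almost_inv A ?S e" by (rule property_AD[OF A]) (use T S in auto)
  then obtain F \<mu> where F: "F \<subseteq> carrier G" "finite F" and \<mu>: "\<forall>z\<in>A. fprob F (\<mu> z)"
    and e: "\<forall>s\<in>?S. \<forall>z\<in>A. s \<otimes> z \<in> A \<longrightarrow> l1d (left_shift s (\<mu> z)) (\<mu> (s \<otimes> z)) \<le> e"
    by (rule almost_invE)
  note \<mu> = \<mu>[rule_format] and e = e[rule_format]
  define t where "t z = (SOME t. t \<in> T \<and> t \<otimes> z \<in> A)" for z
  have t: "t z \<in> T \<and> t z \<otimes> z \<in> A" if "z \<in> ?X" for z
    unfolding t_def by (rule someI_ex) (use that in \<open>simp add: Bex_def\<close>)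
  have tG: "t z \<in> carrier G" if "z \<in> ?X" for z using t[OF that] T by auto
  let ?F = "\<Union>r\<in>T. (\<otimes>) (inv r) ` F"
  show "almost_inv ?X S e"
    unfolding almost_inv_def
  proof (intro exI[of _ ?F] exI[of _ "\<lambda>z. left_shift (inv (t z)) (\<mu> (t z \<otimes> z))"] conjI ballI impI)
    show "?F \<subseteq> carrier G" "finite ?F" using T F by auto
    fix z assume z: "z \<in> ?X"
    have "fprob ((\<otimes>) (inv (t z)) ` F) (left_shift (inv (t z)) (\<mu> (t z \<otimes> z)))"
      using fprob_left_shift[OF inv_closed[OF tG[OF z]] F(1)] \<mu> t[OF z] by blast
    then show "fprob ?F (left_shift (inv (t z)) (\<mu> (t z \<otimes> z)))"
      by (rule fprob_mono) (use t[OF z] T F in auto)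
    fix s assume s: "s \<in> S" and sz: "s \<otimes> z \<in> ?X"
    have sG: "s \<in> carrier G" and zG: "z \<in> carrier G" using s S z by auto
    let ?t = "t z" and ?t' = "t (s \<otimes> z)"
    note G = tG[OF z] tG[OF sz] sG zG
    let ?w = "?t' \<otimes> s \<otimes> inv ?t"
    have w: "?w \<in> ?S" using t[OF z] t[OF sz] s by force
    have wG: "?w \<in> carrier G" using G by simp
    have weq: "?w \<otimes> (?t \<otimes> z) = ?t' \<otimes> (s \<otimes> z)"
      using G by (simp add: m_assoc)
    have "left_shift s (left_shift (inv ?t) (\<mu> (?t \<otimes> z))) = left_shift (inv ?t') (left_shift ?w (\<mu> (?t \<otimes> z)))"
      using G by (simp add: left_shift_left_shift m_assoc)
    moreover have "l1d (left_shift (inv ?t') (left_shift ?w (\<mu> (?t \<otimes> z)))) (left_shift (inv ?t') (\<mu> (?t' \<otimes> (s \<otimes> z))))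
       = l1d (left_shift ?w (\<mu> (?t \<otimes> z))) (\<mu> (?t' \<otimes> (s \<otimes> z)))"
    proof (rule l1d_left_shift[where F = "F \<union> (\<otimes>) ?w ` F"])
      show "fprob (F \<union> (\<otimes>) ?w ` F) (left_shift ?w (\<mu> (?t \<otimes> z)))"
        by (rule fprob_mono[OF fprob_left_shift[OF wG F(1) \<mu>]]) (use t[OF z] F in auto)
      show "fprob (F \<union> (\<otimes>) ?w ` F) (\<mu> (?t' \<otimes> (s \<otimes> z)))"
        by (rule fprob_mono[OF \<mu>]) (use t[OF sz] F in auto)
    qed (use G F wG in auto)
    moreover have "l1d (left_shift ?w (\<mu> (?t \<otimes> z))) (\<mu> (?t' \<otimes> (s \<otimes> z))) \<le> e"
      using e[OF w, of "?t \<otimes> z"] weq t[OF z] t[OF sz] by auto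
    ultimately show "l1d (left_shift s (left_shift (inv ?t) (\<mu> (?t \<otimes> z)))) (left_shift (inv ?t') (\<mu> (?t' \<otimes> (s \<otimes> z)))) \<le> e"
      by simp
  qed
qed

text \<open>
  The two functions are interpolated along the word-distance to \<open>A\<close>, measured in steps from \<open>S\<close>.
\<close>

lemma property_A_union:
  assumes X: "X \<subseteq> carrier G"
    and ex: "\<And>S e. finite S \<Longrightarrow> S \<subseteq> carrier G \<Longrightarrow> e > 0 \<Longrightarrow> \<exists>A\<subseteq>carrier G. property_A A \<and> almost_inv (X - A) S e"
  shows "property_A X"
  unfolding property_A_def
proof (intro allI impI)
  fix S and e :: real assume S: "finite S \<and> S \<subseteq> carrier G \<and> e > 0"
  from ex[of S "e/2"] S obtain A where A: "A \<subseteq> carrier G" "property_A A" "almost_inv (X - A) S (e/2)" by auto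
  \<comment> \<open>Closed under inverses of \<open>S\<close>, so that \<open>m\<close> below
    changes by at most one in both directions, and containing \<one>, so that the neighbourhoods
    \<open>N i\<close> increase.\<close>
  define S' where "S' = insert \<one> (S \<union> m_inv G ` S)"
  define N where "N = rec_nat A (\<lambda>_ B. {z \<in> carrier G. \<exists>t\<in>S'. t \<otimes> z \<in> B})"
  have N0: "N 0 = A" and NS: "N (Suc i) = {z \<in> carrier G. \<exists>t\<in>S'. t \<otimes> z \<in> N i}" for i
    by (simp_all add: N_def)
  have S': "finite S'" "S' \<subseteq> carrier G" using S by (auto simp: S'_def)
  have NG: "N i \<subseteq> carrier G" for i by (cases i) (use A in \<open>auto simp: N0 NS\<close>)
  have Nsub: "N i \<subseteq> N (Suc i)" for i using NG[of i] by (auto simp: NS S'_def intro: bexI[of _ \<one>])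
  have NpA: "property_A (N i)" for i
    by (induction i) (use A S' property_A_nbhd in \<open>auto simp: N0 NS\<close>)
  \<comment> \<open>Each of the two weights changes by at most \<open>1/M\<close> under a step from
    \<open>S\<close>.\<close>
  obtain M :: nat where M: "M > 0" "2 / M \<le> e / 2"
  proof -
    obtain M :: nat where M: "4 / e < M" using reals_Archimedean2 by blast
    moreover have "0 < 4 / e" using S by simp
    ultimately have "M > 0" using of_nat_0_less_iff[of M] by linarith
    then show thesis using that[of M] M S by (simp add: field_simps)
  qed
  \<comment> \<open>The alternative \<open>i = M\<close> makes the least element exist also for
    points that never reach \<open>A\<close>.\<close>
  define m where "m z = (LEAST i. z \<in> N i \<or> i = M)" for z
  have m1: "z \<in> N (m z) \<or> m z = M" for z unfolding m_def by (rule LeastI[of _ M]) auto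
  have m2: "m z \<le> i" if "z \<in> N i \<or> i = M" for z i unfolding m_def using that by (rule Least_le)
  have mM: "m z \<le> M" for z using m2 by blast
  have nb: "m z \<le> Suc (m w)" if "z \<in> X" "t \<in> S'" "t \<otimes> z = w" for z w t
  proof (cases "m w = M")
    case True then show ?thesis using mM[of z] by linarith
  next
    case False
    then have "w \<in> N (m w)" using m1 by blast
    then have "z \<in> N (Suc (m w))" using that X by (auto simp: NS)
    then show ?thesis using m2 by blast
  qed
  have "almost_inv (N M) S (e/2)" by (rule property_AD[OF NpA]) (use S in auto)
  then obtain F1 \<mu>1 where F1: "F1 \<subseteq> carrier G" "finite F1" "\<forall>z\<in>N M. fprob F1 (\<mu>1 z)"
    "\<forall>s\<in>S. \<forall>z\<in>N M. s \<otimes> z \<in> N M \<longrightarrow> l1d (left_shift s (\<mu>1 z)) (\<mu>1 (s \<otimes> z)) \<le> e/2"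
    by (rule almost_invE)
  from A(3) obtain F2 \<mu>2 where F2: "F2 \<subseteq> carrier G" "finite F2" "\<forall>z\<in>X - A. fprob F2 (\<mu>2 z)"
    "\<forall>s\<in>S. \<forall>z\<in>X - A. s \<otimes> z \<in> X - A \<longrightarrow> l1d (left_shift s (\<mu>2 z)) (\<mu>2 (s \<otimes> z)) \<le> e/2"
    by (rule almost_invE)
  note F1 = F1[rule_format] and F2 = F2[rule_format]
  define \<phi> where "\<phi> z b = (if b then 1 - m z / M else m z / M)" for z b
  define \<nu> where "\<nu> b = (if b then \<mu>1 else \<mu>2)" for b
  \<comment> \<open>Each function is used only where it is controlled: positive weight of
    \<open>\<mu>1\<close> puts \<open>z\<close> into \<open>N M\<close>, and positive weight of
    \<open>\<mu>2\<close> keeps it off \<open>A\<close>, where \<open>m\<close> vanishes.\<close>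
  have pT: "z \<in> N M" if "\<phi> z True > 0" for z
  proof -
    have "m z < M" using that M by (simp add: \<phi>_def field_simps)
    then have "z \<in> N (m z)" using m1[of z] by auto
    then show ?thesis using lift_Suc_mono_le[of N "m z" M] Nsub mM by blast
  qed
  have pF: "z \<in> X - A" if "z \<in> X" "\<phi> z False > 0" for z
    using that m2[of z 0] by (auto simp: \<phi>_def N0 zero_less_divide_iff)
  have "almost_inv X S (e/2 + e/2)"
  proof (rule almost_inv_glue[where F = "F1 \<union> F2" and I = "\<lambda>_. UNIV" and \<phi> = \<phi> and \<nu> = \<nu>])
    fix z show "fprob UNIV (\<phi> z)" using mM[of z] M by (auto simp: fprob_def UNIV_bool \<phi>_def field_simps)
  next
    fix z b assume "z \<in> X" "\<phi> z b > 0"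
    then show "fprob (F1 \<union> F2) (\<nu> b z)"
      using pT[of z] pF[of z] fprob_mono[OF F1(3)[of z], of "F1 \<union> F2"] fprob_mono[OF F2(3)[of z], of "F1 \<union> F2"] F1 F2
      by (cases b) (auto simp: \<nu>_def)
  next
    fix s z assume s: "s \<in> S" "z \<in> X" "s \<otimes> z \<in> X"
    have G: "s \<in> carrier G" "z \<in> carrier G" using s S X by auto
    have "m z \<le> Suc (m (s \<otimes> z))" using nb[of z s] s by (auto simp: S'_def)
    moreover have "m (s \<otimes> z) \<le> Suc (m z)"
      using nb[of "s \<otimes> z" "inv s" z] s G by (auto simp: S'_def)
    ultimately have "\<bar>real (m z) - real (m (s \<otimes> z))\<bar> \<le> 1" by linarith
    moreover have "l1d (\<phi> z) (\<phi> (s \<otimes> z)) = 2 * \<bar>real (m z) - real (m (s \<otimes> z))\<bar> / M"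
    proof -
      have "l1d (\<phi> z) (\<phi> (s \<otimes> z)) = (\<Sum>b\<in>UNIV. \<bar>\<phi> z b - \<phi> (s \<otimes> z) b\<bar>)" by (rule l1d_eq) auto
      also have "\<dots> = \<bar>(real (m z) - m (s \<otimes> z)) / M\<bar> + \<bar>(real (m z) - m (s \<otimes> z)) / M\<bar>"
        by (simp add: UNIV_bool \<phi>_def diff_divide_distrib abs_minus_commute)
      finally show ?thesis by simp
    qed
    ultimately have "l1d (\<phi> z) (\<phi> (s \<otimes> z)) \<le> 2 / M" using M by (simp add: divide_right_mono)
    then show "l1d (\<phi> z) (\<phi> (s \<otimes> z)) \<le> e / 2" using M by linarith
  next
    fix s z b assume "s \<in> S" "z \<in> X" "s \<otimes> z \<in> X" "\<phi> z b > 0" "\<phi> (s \<otimes> z) b > 0"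
    then show "l1d (left_shift s (\<nu> b z)) (\<nu> b (s \<otimes> z)) \<le> e / 2"
      using pT[of z] pF[of z] pT[of "s \<otimes> z"] pF[of "s \<otimes> z"] F1(4)[of s z] F2(4)[of s z]
      by (cases b) (auto simp: \<nu>_def)
  qed (use S F1 F2 in auto)
  then show "almost_inv X S e" by simp
qed

lemma property_A_empty: "property_A {}"
  unfolding property_A_def almost_inv_def by (intro allI impI exI[of _ "{}"]) auto

lemma property_A_Un: "property_A A \<Longrightarrow> property_A B \<Longrightarrow> A \<subseteq> carrier G \<Longrightarrow> B \<subseteq> carrier G \<Longrightarrow> property_A (A \<union> B)"
  by (rule property_A_union, simp, rule exI[of _ A]) (simp, rule almost_inv_mono[OF property_AD[of B]], auto)

lemma property_A_UN:
  "finite J \<Longrightarrow> (\<And>j. j \<in> J \<Longrightarrow> property_A (X j) \<and> X j \<subseteq> carrier G) \<Longrightarrow> property_A (\<Union>j\<in>J. X j)"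
proof (induction J rule: finite_induct)
  case (insert j J)
  then show ?case using property_A_Un[of "X j" "\<Union>j\<in>J. X j"] by (auto simp: UN_subset_iff)
qed (simp add: property_A_empty)

text \<open>Steps from \<open>S\<close> inside \<open>X\<close> never leave a right coset of
  \<open>H\<close>, so different cosets need no coordination. Within each, dividing by a chosen
  representative gives a map \<open>h\<close> to \<open>H\<close> that commutes with left
  multiplication by \<open>H\<close>; the functions of \<open>H\<close> are pulled back along
  it.\<close>

lemma almost_inv_coset:
  assumes H: "subgroup H G" "property_A H" and X: "X \<subseteq> carrier G" and S: "finite S" "S \<subseteq> carrier G"
    and e: "e > 0"
    and sep: "\<And>s z. s \<in> S \<Longrightarrow> z \<in> X \<Longrightarrow> s \<otimes> z \<in> X \<Longrightarrow> s \<in> H"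
  shows "almost_inv X S e"
proof -
  have "almost_inv H S e" by (rule property_AD[OF H(2) S e])
  then obtain F \<mu> where F: "F \<subseteq> carrier G" "finite F" "\<forall>z\<in>H. fprob F (\<mu> z)"
    "\<forall>s\<in>S. \<forall>z\<in>H. s \<otimes> z \<in> H \<longrightarrow> l1d (left_shift s (\<mu> z)) (\<mu> (s \<otimes> z)) \<le> e"
    by (rule almost_invE)
  note F = F[rule_format]
  define r where "r C = (SOME z. z \<in> C)" for C :: "'a set"
  define h where "h z = z \<otimes> inv (r (H #> z))" for z
  have r: "r (H #> z) \<in> H #> z" if "z \<in> carrier G" for z
    unfolding r_def using rcos_self[OF that H(1)] by (rule someI)
  have hH: "h z \<in> H" if z: "z \<in> carrier G" for z
  proof -
    obtain k where k: "k \<in> H" "r (H #> z) = k \<otimes> z" using r[OF z] by (auto simp: r_coset_def)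
    then have "k \<in> carrier G" using H subgroup.subset by blast
    then have "h z = inv k" using k z by (simp add: h_def inv_mult_group m_assoc[symmetric])
    then show ?thesis using k H subgroup.m_inv_closed by metis
  qed
  have hs: "h (s \<otimes> z) = s \<otimes> h z" if z: "z \<in> carrier G" and s: "s \<in> H" for s z
  proof -
    have sG: "s \<in> carrier G" using s H subgroup.subset by blast
    have "H #> (s \<otimes> z) = H #> z"
      using coset_mult_assoc[of H s z] coset_join2[OF sG H(1) s] H(1) sG z subgroup.subset by metis
    moreover have "r (H #> z) \<in> carrier G"
      using r[OF z] r_coset_subset_G[OF subgroup.subset[OF H(1)] z] by blast
    ultimately show ?thesis using sG z by (simp add: h_def m_assoc)
  qed
  show ?thesis
    unfolding almost_inv_def
  proof (intro exI[of _ F] exI[of _ "\<lambda>z. \<mu> (h z)"] conjI ballI impI)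
    fix s z assume s: "s \<in> S" "z \<in> X" "s \<otimes> z \<in> X"
    then have "s \<in> H" "z \<in> carrier G" using sep X by auto
    then show "l1d (left_shift s (\<mu> (h z))) (\<mu> (h (s \<otimes> z))) \<le> e"
      using F(4)[of s "h z"] s hH[of z] hs[of z s] H(1) by (simp add: subgroup.m_closed)
  qed (use F hH X in auto)
qed

text \<open>\<open>z\<close> and \<open>s \<otimes> z\<close> in \<open>H\<close> force
  \<open>s\<close> into \<open>H\<close>, and the uniform function on \<open>H\<close> is fixed by
  such \<open>s\<close>.\<close>

lemma property_A_finite_subgroup:
  assumes "finite H" "subgroup H G"
  shows "property_A H"
  unfolding property_A_def
proof (intro allI impI)
  fix S and e :: real assume S: "finite S \<and> S \<subseteq> carrier G \<and> e > 0"
  have HG: "H \<subseteq> carrier G" using assms subgroup.subset by blast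
  have ne: "H \<noteq> {}" using assms subgroup.one_closed by blast
  show "almost_inv H S e"
    unfolding almost_inv_def
  proof (intro exI[of _ H] exI[of _ "\<lambda>_. unif H"] conjI ballI impI)
    fix s z assume s: "s \<in> S" "z \<in> H" "s \<otimes> z \<in> H"
    have sG: "s \<in> carrier G" and zG: "z \<in> carrier G" using s S HG by auto
    have "s = (s \<otimes> z) \<otimes> inv z" using sG zG by (simp add: m_assoc)
    then have sH: "s \<in> H" using s assms(2) by (metis subgroup.m_closed subgroup.m_inv_closed)
    have "inv s \<otimes> t \<in> H \<longleftrightarrow> t \<in> H" if "t \<in> carrier G" for t
    proof
      assume a: "inv s \<otimes> t \<in> H"
      have "t = s \<otimes> (inv s \<otimes> t)" using sG that by simp
      then show "t \<in> H" using a sH assms(2) by (metis subgroup.m_closed)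
    qed (use sH assms(2) in \<open>simp add: subgroup.m_closed subgroup.m_inv_closed\<close>)
    then have "left_shift s (unif H) = unif H" using HG by (auto simp: left_shift_def unif_def fun_eq_iff)
    then show "l1d (left_shift s (unif H)) (unif H) \<le> e" using S by simp
  qed (use assms HG ne fprob_unif in auto)
qed

end

section \<open>Exactness and property A\<close>

context group
begin

section \<open>From amenable actions to property A\<close>

lemma ProbD:
  assumes "p \<in> Prob G"
  shows Prob_nonneg: "\<And>t. t \<in> carrier G \<Longrightarrow> 0 \<le> p t" and Prob_has_sum: "(p has_sum 1) (carrier G)"
    and Prob_summable: "p summable_on carrier G"
  using assms by (auto simp: Prob_def has_sum_imp_summable)

lemma summable_abs_diff_Prob:
  assumes "p \<in> Prob G" "q \<in> Prob G"
  shows "(\<lambda>t. \<bar>p t - q t\<bar>) summable_on carrier G"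
proof (rule summable_on_comparison_test)
  show "(\<lambda>t. p t + q t) summable_on carrier G"
    using assms Prob_summable by (intro summable_on_add) auto
  fix t assume "t \<in> carrier G"
  then show "\<bar>p t - q t\<bar> \<le> p t + q t"
    using Prob_nonneg[OF assms(1)] Prob_nonneg[OF assms(2)] by (smt (verit))
qed simp

lemma l1_dist_triangle:
  assumes "p \<in> Prob G" "q \<in> Prob G" "r \<in> Prob G"
  shows "l1_dist G p r \<le> l1_dist G p q + l1_dist G q r"
proof -
  have "l1_dist G p r \<le> (\<Sum>\<^sub>\<infinity>t\<in>carrier G. \<bar>p t - q t\<bar> + \<bar>q t - r t\<bar>)"
    unfolding l1_dist_def using assms
    by (intro infsum_mono summable_on_add summable_abs_diff_Prob) auto
  also have "\<dots> = l1_dist G p q + l1_dist G q r"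
    unfolding l1_dist_def using assms by (intro infsum_add summable_abs_diff_Prob) auto
  finally show ?thesis .
qed

lemma l1_dist_commute: "l1_dist G p q = l1_dist G q p"
  unfolding l1_dist_def by (simp add: abs_minus_commute)

lemma bij_betw_mult: "s \<in> carrier G \<Longrightarrow> bij_betw ((\<otimes>) s) (carrier G) (carrier G)"
  by (rule bij_betw_byWitness[where f' = "(\<otimes>) (inv s)"]) auto

lemma translate_Prob:
  assumes "s \<in> carrier G" "p \<in> Prob G"
  shows "translate G s p \<in> Prob G"
proof -
  have b: "bij_betw ((\<otimes>) (inv s)) (carrier G) (carrier G)" using assms by (intro bij_betw_mult) simp
  have "((\<lambda>t. p (inv s \<otimes> t)) has_sum 1) (carrier G)"
    using Prob_has_sum[OF assms(2)] has_sum_reindex_bij_betw[OF b, of p 1] by simp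
  then have "(translate G s p has_sum 1) (carrier G)"
    by (rule has_sum_cong[THEN iffD1, rotated]) (simp add: translate_def)
  then show ?thesis using assms Prob_nonneg[OF assms(2)] by (simp add: Prob_def translate_def)
qed

lemma l1_dist_translate:
  assumes "s \<in> carrier G"
  shows "l1_dist G (translate G s p) (translate G s q) = l1_dist G p q"
proof -
  have b: "bij_betw ((\<otimes>) (inv s)) (carrier G) (carrier G)" using assms by (intro bij_betw_mult) simp
  have "l1_dist G (translate G s p) (translate G s q) = (\<Sum>\<^sub>\<infinity>t\<in>carrier G. \<bar>p (inv s \<otimes> t) - q (inv s \<otimes> t)\<bar>)"
    unfolding l1_dist_def by (rule infsum_cong) (simp add: translate_def)
  also have "\<dots> = l1_dist G p q"
    unfolding l1_dist_def by (rule infsum_reindex_bij_betw[OF b])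
  finally show ?thesis .
qed

lemma restrict_Prob:
  assumes "fprob F p" "F \<subseteq> carrier G"
  shows "restrict p (carrier G) \<in> Prob G"
proof -
  have "sum (restrict p (carrier G)) F = sum p F" using assms(2) by (intro sum.cong) auto
  then have "(restrict p (carrier G) has_sum 1) (carrier G)"
    using assms by (intro has_sum_finite_neutralI[of F]) (auto simp: fprob_def)
  then show ?thesis using assms(1) by (auto simp: Prob_def fprob_def)
qed

lemma translate_restrict: "s \<in> carrier G \<Longrightarrow> translate G s (restrict p (carrier G)) = restrict (left_shift s p) (carrier G)"
  by (auto simp: translate_def left_shift_def fun_eq_iff restrict_def)

lemma l1_dist_restrict:
  assumes "fprob F p" "F \<subseteq> carrier G" "fprob F' q" "F' \<subseteq> carrier G"
  shows "l1_dist G (restrict p (carrier G)) (restrict q (carrier G)) = l1d p q"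
proof -
  have "l1d p q = (\<Sum>t\<in>F \<union> F'. \<bar>p t - q t\<bar>)" using assms by (intro l1d_eq) (auto simp: fprob_def)
  also have "\<dots> = (\<Sum>t\<in>F \<union> F'. \<bar>restrict p (carrier G) t - restrict q (carrier G) t\<bar>)"
    using assms by (intro sum.cong) auto
  finally have "((\<lambda>t. \<bar>restrict p (carrier G) t - restrict q (carrier G) t\<bar>) has_sum l1d p q) (carrier G)"
    using assms by (intro has_sum_finite_neutralI[of "F \<union> F'"]) (auto simp: fprob_def)
  then show ?thesis unfolding l1_dist_def by (rule infsumI)
qed

text \<open>Pointwise closeness yields closeness in norm: once \<open>F\<close> carries nearly all
  the mass of \<open>p\<close>, any \<open>p'\<close> near \<open>p\<close> on \<open>F\<close> has
  little mass elsewhere. The function \<open>q\<close> is \<open>p\<close> cut down to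
  \<open>F\<close>, with the lost mass moved to one point \<open>t0\<close>. The factor 4 counts two
  errors on \<open>F\<close> and two outside.\<close>

lemma Prob_near_fprob:
  assumes p: "p \<in> Prob G" and e: "e > 0"
  obtains F q where "F \<subseteq> carrier G" "finite F" "fprob F q"
    "\<forall>p'\<in>Prob G. (\<Sum>t\<in>F. \<bar>p' t - p t\<bar>) < e \<longrightarrow> l1_dist G p' (restrict q (carrier G)) \<le> 4 * e"
proof -
  \<comment> \<open>Below 1, so that \<open>F\<close> cannot be empty and \<open>t0\<close>
    exists.\<close>
  define e' where "e' = min e (1/2)"
  have e': "0 < e'" "e' \<le> e" "e' < 1" using e by (auto simp: e'_def)
  have "(sum p \<longlongrightarrow> 1) (finite_subsets_at_top (carrier G))"
    using Prob_has_sum[OF p] by (simp add: has_sum_def)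
  then have "\<forall>\<^sub>F F in finite_subsets_at_top (carrier G). 1 - e' < sum p F"
    using e' by (intro order_tendstoD) auto
  then obtain F where F: "finite F" "F \<subseteq> carrier G" "1 - e' < sum p F"
    unfolding eventually_finite_subsets_at_top by auto
  then have "F \<noteq> {}" using e' by auto
  then obtain t0 where t0: "t0 \<in> F" by blast
  have rest: "(p' has_sum (1 - sum p' F)) (carrier G - F)" if "p' \<in> Prob G" for p'
    using has_sum_Diff[OF Prob_has_sum[OF that] has_sum_finite[OF F(1)] F(2)] .
  have p0: "p t \<ge> 0" if "t \<in> F" for t using Prob_nonneg[OF p] F that by auto
  have le1: "sum p F \<le> 1"
    using has_sum_nonneg[OF rest[OF p]] Prob_nonneg[OF p] by simp
  define q where "q t = (if t \<in> F then p t + (if t = t0 then 1 - sum p F else 0) else 0)" for t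
  have q: "fprob F q"
    unfolding fprob_def q_def using F t0 p0 le1 by (auto simp: sum.distrib)
  show thesis
  proof (rule that[OF F(2,1) q], intro ballI impI)
    fix p' assume p': "p' \<in> Prob G" and close: "(\<Sum>t\<in>F. \<bar>p' t - p t\<bar>) < e"
    let ?g = "\<lambda>t. \<bar>p' t - restrict q (carrier G) t\<bar>"
    have "(?g has_sum (sum ?g F)) F" using F by simp
    moreover have "(?g has_sum (1 - sum p' F)) (carrier G - F)"
      by (rule has_sum_cong[THEN iffD1, OF _ rest[OF p']]) (use Prob_nonneg[OF p'] in \<open>auto simp: q_def\<close>)
    ultimately have "(?g has_sum (sum ?g F + (1 - sum p' F))) (F \<union> (carrier G - F))"
      by (rule has_sum_Un_disjoint) auto
    then have "l1_dist G p' (restrict q (carrier G)) = sum ?g F + (1 - sum p' F)"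
      using F(2) unfolding l1_dist_def by (intro infsumI) (simp add: Un_absorb1)
    also have "sum ?g F \<le> (\<Sum>t\<in>F. \<bar>p' t - p t\<bar> + (if t = t0 then 1 - sum p F else 0))"
      using F le1 by (intro sum_mono) (auto simp: q_def)
    also have "\<dots> = (\<Sum>t\<in>F. \<bar>p' t - p t\<bar>) + (1 - sum p F)" using F t0 by (simp add: sum.distrib)
    also have "sum p F - sum p' F \<le> (\<Sum>t\<in>F. \<bar>p' t - p t\<bar>)"
      unfolding sum_subtractf[symmetric] by (intro sum_mono) auto
    then have "1 - sum p' F \<le> 1 - sum p F + (\<Sum>t\<in>F. \<bar>p' t - p t\<bar>)" by linarith
    finally show "l1_dist G p' (restrict q (carrier G)) \<le> 4 * e" using close F(3) e' by linarith
  qed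
qed

text \<open>The almost invariant map is evaluated along the orbit of a point
  \<open>\<omega>0\<close>. Its values may have infinite support; compactness provides finitely many
  open sets on each of which one finitely supported function approximates all values, and the union
  of these supports is the common finite set.\<close>

lemma exact_group_imp_property_A:
  assumes "exact_group TYPE('x) G"
  shows "property_A (carrier G)"
proof -
  obtain \<Omega> :: "'x topology" and \<psi> where ne: "topspace \<Omega> \<noteq> {}" and cpt: "compact_space \<Omega>"
    and am: "amenable_action G \<Omega> \<psi>"
    using assms unfolding exact_group_def by blast
  interpret \<psi>: group_action G "topspace \<Omega>" \<psi>
    using am unfolding amenable_action_def homeomorphism_action_def by blast
  obtain \<omega>0 where \<omega>0: "\<omega>0 \<in> topspace \<Omega>" using ne by blast
  have in\<Omega>: "\<psi> z \<omega>0 \<in> topspace \<Omega>" if "z \<in> carrier G" for z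
    using \<psi>.element_image[OF that \<omega>0] by blast
  show ?thesis
    unfolding property_A_def
  proof (intro allI impI)
    fix S and e :: real assume S: "finite S \<and> S \<subseteq> carrier G \<and> e > 0"
    then have "finite S \<and> S \<subseteq> carrier G \<and> e/2 > 0" by simp
    from am[unfolded amenable_action_def, THEN conjunct2, rule_format, OF this]
    obtain \<mu> where \<mu>: "continuous_map \<Omega> (Prob_topology G) \<mu>"
      and inv: "\<forall>s\<in>S. \<forall>\<omega>\<in>topspace \<Omega>. l1_dist G (translate G s (\<mu> \<omega>)) (\<mu> (\<psi> s \<omega>)) \<le> e/2"
      by (elim exE conjE)
    have \<mu>P: "\<mu> \<omega> \<in> Prob G" if "\<omega> \<in> topspace \<Omega>" for \<omega>
      using continuous_map_image_subset_topspace[OF \<mu>] that by (auto simp: Prob_topology_def)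
    have "continuous_map \<Omega> (product_topology (\<lambda>_. euclideanreal) (carrier G)) \<mu>"
      using \<mu> unfolding Prob_topology_def by (rule continuous_map_into_fulltopology)
    then have \<mu>c: "continuous_map \<Omega> euclideanreal (\<lambda>\<omega>. \<mu> \<omega> t)" if "t \<in> carrier G" for t
      using that by (simp add: continuous_map_componentwise)
    define near where "near U F q \<longleftrightarrow> F \<subseteq> carrier G \<and> fprob F q \<and>
        (\<forall>\<omega>'\<in>U. l1_dist G (\<mu> \<omega>') (restrict q (carrier G)) \<le> e/4)" for U F q
    have loc: "\<exists>U F q. openin \<Omega> U \<and> \<omega> \<in> U \<and> near U F q" if \<omega>: "\<omega> \<in> topspace \<Omega>" for \<omega>
    proof -
      \<comment> \<open>Multiplied by 4 in the approximation: an error of \<open>e/4\<close> on each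
        side and \<open>e/2\<close> for almost invariance make \<open>e\<close>.\<close>
      have "e/16 > 0" using S by simp
      then obtain F q where F: "F \<subseteq> carrier G" "finite F" "fprob F q"
        and close: "\<forall>p'\<in>Prob G. (\<Sum>t\<in>F. \<bar>p' t - \<mu> \<omega> t\<bar>) < e/16 \<longrightarrow>
          l1_dist G p' (restrict q (carrier G)) \<le> 4 * (e/16)"
        by (rule Prob_near_fprob[OF \<mu>P[OF \<omega>]])
      let ?g = "\<lambda>\<omega>'. \<Sum>t\<in>F. \<bar>\<mu> \<omega>' t - \<mu> \<omega> t\<bar>"
      have cont: "continuous_map \<Omega> euclideanreal ?g"
        using F \<mu>c by (intro continuous_map_sum continuous_map_real_abs continuous_map_diff) auto
      let ?W = "{\<omega>' \<in> topspace \<Omega>. ?g \<omega>' \<in> {..<e/16}}"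
      from cont have "openin \<Omega> ?W"
        by (rule openin_continuous_map_preimage) simp
      moreover have "\<omega> \<in> ?W" using \<omega> S by simp
      moreover have "near ?W F q"
        unfolding near_def
      proof (intro conjI ballI F)
        fix \<omega>' assume "\<omega>' \<in> ?W"
        then have "\<mu> \<omega>' \<in> Prob G" "?g \<omega>' < e/16" using \<mu>P by auto
        then show "l1_dist G (\<mu> \<omega>') (restrict q (carrier G)) \<le> e/4"
          using close[rule_format, of "\<mu> \<omega>'"] by simp
      qed
      ultimately show ?thesis by (intro exI[of _ ?W] exI[of _ F] exI[of _ q] conjI)
    qed
    define \<U> where "\<U> = {U. openin \<Omega> U \<and> (\<exists>F q. near U F q)}"
    have op: "\<forall>U\<in>\<U>. openin \<Omega> U" by (simp add: \<U>_def)
    have cover: "topspace \<Omega> \<subseteq> \<Union>\<U>"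
    proof
      fix \<omega> assume "\<omega> \<in> topspace \<Omega>"
      from loc[OF this] obtain U F q where "openin \<Omega> U" "\<omega> \<in> U" "near U F q" by (elim exE conjE)
      then have "U \<in> \<U>" unfolding \<U>_def by (intro CollectI conjI exI)
      with \<open>\<omega> \<in> U\<close> show "\<omega> \<in> \<Union>\<U>" by (rule UnionI[rotated])
    qed
    from cpt[unfolded compact_space_alt, rule_format, OF conjI[OF op cover]] obtain \<F> where \<F>: "finite \<F>" "\<F> \<subseteq> \<U>" "topspace \<Omega> \<subseteq> \<Union>\<F>"
      by (elim exE conjE)
    have "\<forall>U\<in>\<F>. \<exists>F q. near U F q"
    proof
      fix U assume "U \<in> \<F>"
      then have "U \<in> \<U>" using \<F>(2) by (rule subsetD[rotated])
      then show "\<exists>F q. near U F q" by (simp add: \<U>_def)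
    qed
    then obtain Fs q where near: "\<And>U. U \<in> \<F> \<Longrightarrow> near U (Fs U) (q U)"
      by metis
    have q: "Fs U \<subseteq> carrier G" "fprob (Fs U) (q U)"
      "\<And>\<omega>'. \<omega>' \<in> U \<Longrightarrow> l1_dist G (\<mu> \<omega>') (restrict (q U) (carrier G)) \<le> e/4" if "U \<in> \<F>" for U
      using near[OF that] unfolding near_def by simp_all
    define F where "F = (\<Union>U\<in>\<F>. Fs U)"
    have F: "F \<subseteq> carrier G" "finite F" using q(1,2) \<F>(1) by (auto simp: F_def fprob_def)
    have qF: "fprob F (q U)" if "U \<in> \<F>" for U
      using q(2)[OF that] by (rule fprob_mono) (use that F in \<open>auto simp: F_def\<close>)
    define U where "U \<omega> = (SOME U. U \<in> \<F> \<and> \<omega> \<in> U)" for \<omega>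
    have U: "U \<omega> \<in> \<F> \<and> \<omega> \<in> U \<omega>" if "\<omega> \<in> topspace \<Omega>" for \<omega>
      unfolding U_def by (rule someI_ex) (use \<F>(3) that in auto)
    define \<nu> where "\<nu> z = q (U (\<psi> z \<omega>0))" for z
    have \<nu>: "fprob F (\<nu> z)" "l1_dist G (\<mu> (\<psi> z \<omega>0)) (restrict (\<nu> z) (carrier G)) \<le> e/4"
      if "z \<in> carrier G" for z
      using U[OF in\<Omega>[OF that]] qF[of "U (\<psi> z \<omega>0)"] q(3)[of "U (\<psi> z \<omega>0)" "\<psi> z \<omega>0"]
      unfolding \<nu>_def by simp_all
    show "almost_inv (carrier G) S e"
      unfolding almost_inv_def
    proof (intro exI[of _ F] exI[of _ \<nu>] conjI ballI impI)
      fix s z assume s: "s \<in> S" and z: "z \<in> carrier G" and sz: "s \<otimes> z \<in> carrier G"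
      have sG: "s \<in> carrier G" using s S by auto
      let ?r = "\<lambda>p. restrict p (carrier G)"
      let ?\<omega> = "\<psi> z \<omega>0"
      have \<psi>sz: "\<psi> (s \<otimes> z) \<omega>0 = \<psi> s ?\<omega>" using \<psi>.composition_rule[OF \<omega>0 sG z] .
      have P: "?r (\<nu> z) \<in> Prob G" "?r (\<nu> (s \<otimes> z)) \<in> Prob G"
        using restrict_Prob[OF \<nu>(1) F(1)] z sz by auto
      note M = \<mu>P[OF in\<Omega>[OF z]] \<mu>P[OF in\<Omega>[OF sz]]
      have "l1d (left_shift s (\<nu> z)) (\<nu> (s \<otimes> z)) = l1_dist G (?r (left_shift s (\<nu> z))) (?r (\<nu> (s \<otimes> z)))"
        by (rule l1_dist_restrict[symmetric, OF fprob_left_shift[OF sG F(1) \<nu>(1)[OF z]] _ \<nu>(1)[OF sz] F(1)])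
           (use sG F in auto)
      also have "\<dots> = l1_dist G (translate G s (?r (\<nu> z))) (?r (\<nu> (s \<otimes> z)))"
        using sG by (simp add: translate_restrict)
      also have "\<dots> \<le> l1_dist G (translate G s (?r (\<nu> z))) (translate G s (\<mu> ?\<omega>))
          + l1_dist G (translate G s (\<mu> ?\<omega>)) (?r (\<nu> (s \<otimes> z)))"
        using P M sG by (intro l1_dist_triangle translate_Prob)
      also have "l1_dist G (translate G s (\<mu> ?\<omega>)) (?r (\<nu> (s \<otimes> z)))
         \<le> l1_dist G (translate G s (\<mu> ?\<omega>)) (\<mu> (\<psi> (s \<otimes> z) \<omega>0))
          + l1_dist G (\<mu> (\<psi> (s \<otimes> z) \<omega>0)) (?r (\<nu> (s \<otimes> z)))"
        using P M sG by (intro l1_dist_triangle translate_Prob)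
      also have "l1_dist G (translate G s (?r (\<nu> z))) (translate G s (\<mu> ?\<omega>)) = l1_dist G (\<mu> ?\<omega>) (?r (\<nu> z))"
        using l1_dist_translate[OF sG] l1_dist_commute by simp
      finally show "l1d (left_shift s (\<nu> z)) (\<nu> (s \<otimes> z)) \<le> e"
        using \<nu>(2)[OF z] \<nu>(2)[OF sz] inv[rule_format, OF s in\<Omega>[OF z]]
        unfolding \<psi>sz by linarith
    qed (use F \<nu> in auto)
  qed
qed

text \<open>The same functions work. Only \<open>s\<close> in \<open>H\<close> can relate two points
  of \<open>H\<close>, hence \<open>S \<inter> H\<close>; and a translate by such \<open>s\<close>
  still lives on \<open>H\<close>, so the shifts formed in \<open>G\<close> and in the subgroup
  agree.\<close>

lemma property_A_of_subgroup:
  assumes H: "subgroup H G" and pA: "group.property_A (G\<lparr>carrier := H\<rparr>) H"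
  shows "property_A H"
proof -
  interpret H: group "G\<lparr>carrier := H\<rparr>" by (rule subgroup_imp_group[OF H])
  have HG: "H \<subseteq> carrier G" using H subgroup.subset by blast
  show ?thesis
    unfolding property_A_def
  proof (intro allI impI)
    fix S and e :: real assume S: "finite S \<and> S \<subseteq> carrier G \<and> e > 0"
    have "H.almost_inv H (S \<inter> H) e" by (rule H.property_AD[OF pA]) (use S in auto)
    then obtain F \<mu> where F: "F \<subseteq> carrier (G\<lparr>carrier := H\<rparr>)" "finite F" "\<forall>z\<in>H. fprob F (\<mu> z)"
      and e: "\<forall>s\<in>S \<inter> H. \<forall>z\<in>H. s \<otimes>\<^bsub>G\<lparr>carrier := H\<rparr>\<^esub> z \<in> H \<longrightarrow>
         l1d (H.left_shift s (\<mu> z)) (\<mu> (s \<otimes>\<^bsub>G\<lparr>carrier := H\<rparr>\<^esub> z)) \<le> e"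
      by (rule H.almost_invE)
    show "almost_inv H S e"
      unfolding almost_inv_def
    proof (intro exI[of _ F] exI[of _ \<mu>] conjI ballI impI)
      fix s z assume s: "s \<in> S" "z \<in> H" "s \<otimes> z \<in> H"
      have sG: "s \<in> carrier G" and zG: "z \<in> carrier G" using s S HG by auto
      have "s = (s \<otimes> z) \<otimes> inv z" using sG zG by (simp add: m_assoc)
      then have sH: "s \<in> H" using s H by (metis subgroup.m_closed subgroup.m_inv_closed)
      have "left_shift s (\<mu> z) = H.left_shift s (\<mu> z)"
      proof
        fix t
        have "\<mu> z (inv s \<otimes> t) = 0" if "t \<in> carrier G" "t \<notin> H"
        proof -
          have "inv s \<otimes> t \<notin> H"
          proof
            assume "inv s \<otimes> t \<in> H"
            then have "s \<otimes> (inv s \<otimes> t) \<in> H" using H sH by (simp only: subgroup.m_closed)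
            then show False using that sG by simp
          qed
          then show ?thesis using F s by (auto simp: fprob_def)
        qed
        then show "left_shift s (\<mu> z) t = H.left_shift s (\<mu> z) t"
          using HG m_inv_consistent[OF H sH] unfolding left_shift_def H.left_shift_def by auto
      qed
      then show "l1d (left_shift s (\<mu> z)) (\<mu> (s \<otimes> z)) \<le> e"
        using e[rule_format, of s z] s sH by simp
    qed (use F HG in auto)
  qed
qed

end

text \<open>A map with finitely many values can be extended from the group to its ultrafilters. Off
  a base point \<open>t0\<close> the values are rounded down to multiples of \<open>1/N\<close>, and
  \<open>t0\<close> receives what was cut off, which preserves total mass and positivity.\<close>

lemma fprob_round:
  fixes F :: "'i set" and e :: real
  assumes F: "finite F" and e: "e > 0"
  obtains \<rho> where "finite (\<rho> ` {p. fprob F p})" "\<forall>p. fprob F p \<longrightarrow> fprob F (\<rho> p) \<and> l1d p (\<rho> p) \<le> e"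
proof (cases "F = {}")
  case True
  then have "{p. fprob F p} = {}" by (auto simp: fprob_def)
  then show thesis using that[of id] by auto
next
  case False
  then obtain t0 where t0: "t0 \<in> F" by blast
  \<comment> \<open>Every other point loses at most \<open>1/N\<close> and \<open>t0\<close> gains
    all the losses, hence the factor 2.\<close>
  obtain N :: nat where N: "2 * card F / e < N" using reals_Archimedean2 by blast
  have "0 < 2 * card F / e" using F False e by (simp add: card_gt_0_iff)
  then have N0: "real N > 0" using N by linarith
  \<comment> \<open>\<open>\<kappa>\<close> records the numerators and \<open>\<Phi>\<close> decodes
    them; finiteness holds because the numerators lie in \<open>{0..N}\<close>.\<close>
  define \<Phi> where "\<Phi> k t = (if t = t0 then 1 - (\<Sum>i\<in>F - {t0}. real (k i) / N) else if t \<in> F then real (k t) / N else 0)"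
    for k :: "'i \<Rightarrow> nat" and t
  define \<kappa> where "\<kappa> p = restrict (\<lambda>t. nat \<lfloor>N * p t\<rfloor>) F" for p :: "'i \<Rightarrow> real"
  have fin: "finite ((\<lambda>p. \<Phi> (\<kappa> p)) ` {p. fprob F p})"
  proof (rule finite_subset)
    show "(\<lambda>p. \<Phi> (\<kappa> p)) ` {p. fprob F p} \<subseteq> \<Phi> ` (PiE F (\<lambda>_. {0..N}))"
    proof safe
      fix p assume p: "fprob F p"
      have p1: "p t \<le> 1" if "t \<in> F" for t
        using member_le_sum[of t F p] that p by (auto simp: fprob_def)
      have "\<kappa> p \<in> PiE F (\<lambda>_. {0..N})"
      proof -
        have "nat \<lfloor>N * p t\<rfloor> \<le> N" if "t \<in> F" for t
          using mult_left_le[OF p1[OF that], of "real N"] N0 by linarith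
        then show ?thesis by (simp add: \<kappa>_def)
      qed
      then show "\<Phi> (\<kappa> p) \<in> \<Phi> ` (PiE F (\<lambda>_. {0..N}))" by blast
    qed
    show "finite (\<Phi> ` (PiE F (\<lambda>_. {0..N})))" using F by (intro finite_imageI finite_PiE) auto
  qed
  have "fprob F (\<Phi> (\<kappa> p)) \<and> l1d p (\<Phi> (\<kappa> p)) \<le> e" if p: "fprob F p" for p
  proof -
    define q where "q t = real (\<kappa> p t) / N" for t
    have pn: "0 \<le> p t" for t using p by (simp add: fprob_def)
    have q: "0 \<le> q t" "q t \<le> p t" "p t \<le> q t + 1 / N" if "t \<in> F" for t
    proof -
      have r: "real (\<kappa> p t) = \<lfloor>N * p t\<rfloor>" using that pn[of t] N0 by (simp add: \<kappa>_def)
      show "0 \<le> q t" by (simp add: q_def)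
      show "q t \<le> p t" using N0 by (simp add: q_def r divide_le_eq mult.commute)
      have "N * p t \<le> real (\<kappa> p t) + 1" unfolding r by linarith
      then show "p t \<le> q t + 1 / N" using N0 by (simp add: q_def field_simps)
    qed
    let ?F = "F - {t0}"
    have sp: "p t0 + sum p ?F = 1" using p F t0 sum.remove[of F t0 p] by (simp add: fprob_def)
    have \<Phi>: "\<Phi> (\<kappa> p) t = (if t = t0 then 1 - sum q ?F else if t \<in> F then q t else 0)" for t
      by (simp add: \<Phi>_def q_def)
    have sq: "sum q ?F \<le> sum p ?F" by (intro sum_mono q) auto
    have "sum (\<Phi> (\<kappa> p)) F = \<Phi> (\<kappa> p) t0 + sum (\<Phi> (\<kappa> p)) ?F" using F t0 by (rule sum.remove)
    also have "sum (\<Phi> (\<kappa> p)) ?F = sum q ?F" by (intro sum.cong) (auto simp: \<Phi>)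
    finally have "sum (\<Phi> (\<kappa> p)) F = 1" by (simp add: \<Phi>)
    then have f: "fprob F (\<Phi> (\<kappa> p))"
      unfolding fprob_def using F q t0 sp sq pn[of t0] by (auto simp: \<Phi>)
    have "l1d p (\<Phi> (\<kappa> p)) = (\<Sum>t\<in>F. \<bar>p t - \<Phi> (\<kappa> p) t\<bar>)"
      using f p by (intro l1d_eq F) (auto simp: fprob_def)
    also have "\<dots> = \<bar>p t0 - \<Phi> (\<kappa> p) t0\<bar> + (\<Sum>t\<in>?F. \<bar>p t - \<Phi> (\<kappa> p) t\<bar>)"
      using F t0 by (rule sum.remove)
    also have "(\<Sum>t\<in>?F. \<bar>p t - \<Phi> (\<kappa> p) t\<bar>) = (\<Sum>t\<in>?F. p t - q t)"
      using q by (intro sum.cong) (auto simp: \<Phi>)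
    also have "\<dots> = sum p ?F - sum q ?F" by (simp add: sum_subtractf)
    also have "\<bar>p t0 - \<Phi> (\<kappa> p) t0\<bar> = sum p ?F - sum q ?F" using sp sq by (simp add: \<Phi>)
    also have "sum p ?F - sum q ?F + (sum p ?F - sum q ?F) \<le> 2 * card F / N"
    proof -
      have "sum p ?F \<le> (\<Sum>t\<in>?F. q t + 1 / N)" by (intro sum_mono q) auto
      also have "\<dots> = sum q ?F + card ?F * (1 / N)" by (simp add: sum.distrib)
      also have "card ?F * (1 / N) \<le> card F * (1 / N)"
        using F N0 by (intro mult_right_mono) (auto simp: card_mono)
      finally show ?thesis by simp
    qed
    also have "2 * card F / N \<le> e" using N N0 e by (simp add: field_simps)
    finally show ?thesis using f by simp
  qed
  then show thesis using that[OF fin] by blast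
qed

section \<open>The compact space of ultrafilters on the group\<close>

context group
begin

text \<open>Upward closure is implied: if \<open>A \<in> U\<close> is contained in \<open>B\<close>,
  the complement of \<open>B\<close> cannot be in \<open>U\<close>, as it would meet
  \<open>A\<close> in the empty set.\<close>

definition ultra :: "'a set set set" where
  "ultra = {U. U \<subseteq> Pow (carrier G) \<and> {} \<notin> U \<and> (\<forall>A\<in>U. \<forall>B\<in>U. A \<inter> B \<in> U) \<and>
     (\<forall>A\<in>Pow (carrier G). A \<in> U \<or> carrier G - A \<in> U)}"

definition ultra_basic :: "'a set \<Rightarrow> 'a set set set" where
  "ultra_basic A = {U \<in> ultra. A \<in> U}"

text \<open>The Stone topology, which makes this space the Stone-Cech compactification of the
  discrete group.\<close>

definition ultra_top :: "'a set set topology" where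
  "ultra_top = topology_generated_by (ultra_basic ` Pow (carrier G))"

lemma ultra_carrier: "U \<in> ultra \<Longrightarrow> carrier G \<in> U"
  unfolding ultra_def by force

lemma topspace_ultra [simp]: "topspace ultra_top = ultra"
proof -
  have "ultra = ultra_basic (carrier G)" using ultra_carrier by (auto simp: ultra_basic_def)
  then show ?thesis unfolding ultra_top_def topology_generated_by_topspace
    by (auto simp: ultra_basic_def)
qed

lemma openin_ultra_basic: "A \<subseteq> carrier G \<Longrightarrow> openin ultra_top (ultra_basic A)"
  unfolding ultra_top_def by (rule topology_generated_by_Basis) auto

lemma ultra_compl: "U \<in> ultra \<Longrightarrow> A \<in> U \<Longrightarrow> carrier G - A \<notin> U"
proof
  assume U: "U \<in> ultra" and "A \<in> U" "carrier G - A \<in> U"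
  then have "A \<inter> (carrier G - A) \<in> U" unfolding ultra_def by blast
  then show False using U by (simp add: ultra_def)
qed

lemma Hausdorff_ultra: "Hausdorff_space ultra_top"
  unfolding Hausdorff_space_def topspace_ultra
proof (intro allI impI)
  fix U U' assume *: "U \<in> ultra \<and> U' \<in> ultra \<and> U \<noteq> U'"
  obtain A where A: "A \<subseteq> carrier G" "A \<in> U" "carrier G - A \<in> U'"
  proof -
    have UP: "U \<subseteq> Pow (carrier G)" "U' \<subseteq> Pow (carrier G)" using * by (auto simp: ultra_def)
    consider A where "A \<in> U" "A \<notin> U'" | A where "A \<in> U'" "A \<notin> U" using * by blast
    then show thesis
    proof cases
      case 1
      then have "A \<subseteq> carrier G" using UP by auto
      then show thesis using that[of A] 1 * unfolding ultra_def by blast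
    next
      case (2 A)
      then have AG: "A \<subseteq> carrier G" using UP by auto
      then have "carrier G - A \<in> U" using 2 * unfolding ultra_def by blast
      moreover have "carrier G - (carrier G - A) = A" using AG by blast
      ultimately show thesis using that[of "carrier G - A"] 2 by simp
    qed
  qed
  show "\<exists>V W. openin ultra_top V \<and> openin ultra_top W \<and> U \<in> V \<and> U' \<in> W \<and> disjnt V W"
  proof (intro exI conjI)
    show "openin ultra_top (ultra_basic A)" "openin ultra_top (ultra_basic (carrier G - A))"
      using A by (auto intro: openin_ultra_basic)
    show "disjnt (ultra_basic A) (ultra_basic (carrier G - A))"
      using ultra_compl by (auto simp: disjnt_def ultra_basic_def)
  qed (use A * in \<open>auto simp: ultra_basic_def\<close>)
qed

text \<open>The cube of truth values indexed by the subsets of the group is compact by Tychonoff's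
  theorem, and the indicator functions of ultrafilters form a closed part \<open>C\<close> of it,
  which \<open>h\<close> maps continuously onto the ultrafilters.\<close>

lemma compact_ultra: "compact_space ultra_top"
proof -
  let ?I = "Pow (carrier G)"
  define P where "P = product_topology (\<lambda>_. discrete_topology (UNIV :: bool set)) ?I"
  have tP: "topspace P = extensional ?I" by (auto simp: P_def PiE_def)
  have "compact_space P" unfolding P_def compact_space_product_topology
    by (auto simp: compact_space_discrete_topology)
  define D where "D A = {f \<in> topspace P. f A}" for A
  have cont: "continuous_map P (discrete_topology UNIV) (\<lambda>f. f A)" if "A \<in> ?I" for A
    unfolding P_def using that by (rule continuous_map_product_projection)
  have oD: "openin P (D A)" and cD: "closedin P (D A)" and cD': "closedin P (topspace P - D A)" if "A \<in> ?I" for A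
  proof -
    show oD: "openin P (D A)"
      using openin_continuous_map_preimage[OF cont[OF that], of "{True}"] by (simp add: D_def)
    show "closedin P (D A)"
      using closedin_continuous_map_preimage[OF cont[OF that], of "{True}"] by (simp add: D_def)
    show "closedin P (topspace P - D A)" using oD by (simp add: closedin_diff)
  qed
  \<comment> \<open>Each condition on an ultrafilter concerns at most three coordinates and hence is
    closed; the implication for intersections is written as a union.\<close>
  define C where "C = (topspace P - D {}) \<inter>
    (\<Inter>A\<in>?I. \<Inter>B\<in>?I. (topspace P - D A) \<union> ((topspace P - D B) \<union> D (A \<inter> B))) \<inter>
    (\<Inter>A\<in>?I. D A \<union> D (carrier G - A))"
  have "closedin P C"
    unfolding C_def by (intro closedin_Int closedin_INT closedin_Un cD cD') auto
  then have C: "compactin P C" using \<open>compact_space P\<close> by (simp add: closedin_compact_space)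
  define h where "h f = {A \<in> ?I. f A}" for f :: "'a set \<Rightarrow> bool"
  have hC: "h ` C = ultra"
  proof (intro Set.set_eqI iffI)
    fix U assume "U \<in> h ` C"
    then obtain f where f: "f \<in> C" "U = h f" by blast
    have e: "\<not> f {}" using f(1) by (auto simp: C_def D_def)
    have i: "f (A \<inter> B)" if "A \<in> ?I" "B \<in> ?I" "f A" "f B" for A B
    proof -
      have "f \<in> (topspace P - D A) \<union> ((topspace P - D B) \<union> D (A \<inter> B))"
        using f(1) that(1,2) unfolding C_def by blast
      then show ?thesis using that(3,4) by (auto simp: D_def)
    qed
    have u: "f A \<or> f (carrier G - A)" if "A \<in> ?I" for A
    proof -
      have "f \<in> D A \<union> D (carrier G - A)" using f(1) that unfolding C_def by blast
      then show ?thesis by (auto simp: D_def)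
    qed
    show "U \<in> ultra" unfolding f(2) ultra_def h_def using e i u by auto
  next
    fix U assume U: "U \<in> ultra"
    define f where "f = restrict (\<lambda>A. A \<in> U) ?I"
    have fP: "f \<in> topspace P" by (simp add: tP f_def)
    have UP: "U \<subseteq> ?I" using U by (simp add: ultra_def)
    have fA: "f A \<longleftrightarrow> A \<in> U" if "A \<in> ?I" for A using that by (simp add: f_def)
    have "f \<in> topspace P - D {}" using fP U fA[of "{}"] by (simp add: D_def ultra_def)
    moreover have "f \<in> (topspace P - D A) \<union> ((topspace P - D B) \<union> D (A \<inter> B))" if "A \<in> ?I" "B \<in> ?I" for A B
    proof -
      have "A \<inter> B \<in> ?I" using that by auto
      then show ?thesis using fP U fA that by (auto simp: D_def ultra_def)
    qed
    moreover have "f \<in> D A \<union> D (carrier G - A)" if "A \<in> ?I" for A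
    proof -
      have "carrier G - A \<in> ?I" by auto
      then show ?thesis using fP U fA that unfolding D_def ultra_def by auto
    qed
    ultimately have "f \<in> C" unfolding C_def by blast
    moreover have "h f = U" using UP fA by (auto simp: h_def)
    ultimately show "U \<in> h ` C" by blast
  qed
  have "continuous_map (subtopology P C) ultra_top h"
    unfolding ultra_top_def
  proof (rule continuous_on_generated_topo)
    have tC: "topspace (subtopology P C) = C"
      by (rule topspace_subtopology_subset[OF compactin_subset_topspace[OF C]])
    fix W assume "W \<in> ultra_basic ` Pow (carrier G)"
    then obtain A where A: "A \<in> ?I" "W = ultra_basic A" by blast
    have "h -` W \<inter> topspace (subtopology P C) = D A \<inter> C"
    proof (intro Set.set_eqI)
      fix f show "f \<in> h -` W \<inter> topspace (subtopology P C) \<longleftrightarrow> f \<in> D A \<inter> C"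
      proof (cases "f \<in> C")
        case True
        then have "h f \<in> ultra" "f \<in> topspace P" using hC compactin_subset_topspace[OF C] by auto
        then have "h f \<in> W \<longleftrightarrow> f \<in> D A" using A by (simp add: ultra_basic_def h_def D_def)
        then show ?thesis using True tC by simp
      qed (simp add: tC)
    qed
    then show "openin (subtopology P C) (h -` W \<inter> topspace (subtopology P C))"
      using oD[OF A(1)] by (auto simp: openin_subtopology)
  next
    have "h ` topspace (subtopology P C) \<subseteq> ultra" using hC by auto
    then show "h ` topspace (subtopology P C) \<subseteq> \<Union> (ultra_basic ` Pow (carrier G))"
      using topspace_ultra unfolding ultra_top_def topology_generated_by_topspace by simp
  qed
  moreover have "compactin (subtopology P C) C" using C by (simp add: compactin_subtopology)
  ultimately have "compactin ultra_top (h ` C)" by (rule image_compactin[rotated])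
  then show ?thesis unfolding hC compact_space_def by simp
qed

text \<open>The left translate \<open>s A\<close>, written as a preimage to parallel
  \<open>left_shift\<close>.\<close>

definition shift :: "'a \<Rightarrow> 'a set \<Rightarrow> 'a set" where
  "shift s A = {t \<in> carrier G. inv s \<otimes> t \<in> A}"

text \<open>The pushforward of \<open>U\<close> under left multiplication by \<open>s\<close>, made
  extensional because \<open>BijGroup\<close> consists of extensional bijections.\<close>

definition ultra_act :: "'a \<Rightarrow> 'a set set \<Rightarrow> 'a set set" where
  "ultra_act s = (\<lambda>U\<in>ultra. {A \<in> Pow (carrier G). shift (inv s) A \<in> U})"

lemma shift_subset: "shift s A \<subseteq> carrier G"
  by (auto simp: shift_def)

lemma shift_shift: "s \<in> carrier G \<Longrightarrow> t \<in> carrier G \<Longrightarrow> shift s (shift t A) = shift (s \<otimes> t) A"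
  by (auto simp: shift_def inv_mult_group m_assoc)

lemma shift_one: "A \<subseteq> carrier G \<Longrightarrow> shift \<one> A = A"
  by (auto simp: shift_def)

lemma ultra_act_in:
  assumes s: "s \<in> carrier G" and U: "U \<in> ultra"
  shows "ultra_act s U \<in> ultra"
proof -
  have 1: "shift (inv s) {} = {}" by (simp add: shift_def)
  have 2: "shift (inv s) (A \<inter> B) = shift (inv s) A \<inter> shift (inv s) B" for A B by (auto simp: shift_def)
  have 3: "shift (inv s) (carrier G - A) = carrier G - shift (inv s) A" for A
    using s by (auto simp: shift_def)
  have U': "{} \<notin> U" "\<And>A B. A \<in> U \<Longrightarrow> B \<in> U \<Longrightarrow> A \<inter> B \<in> U"
    "\<And>A. A \<subseteq> carrier G \<Longrightarrow> A \<in> U \<or> carrier G - A \<in> U"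
    using U by (auto simp: ultra_def)
  have "{A \<in> Pow (carrier G). shift (inv s) A \<in> U} \<in> ultra"
    unfolding ultra_def
  proof (intro CollectI conjI ballI)
    fix A assume "A \<in> Pow (carrier G)"
    then show "A \<in> {A \<in> Pow (carrier G). shift (inv s) A \<in> U} \<or>
        carrier G - A \<in> {A \<in> Pow (carrier G). shift (inv s) A \<in> U}"
      using U'(3)[OF shift_subset[of "inv s" A]] by (simp add: 3)
  qed (use U' in \<open>auto simp: 1 2\<close>)
  then show ?thesis using U by (simp add: ultra_act_def)
qed

lemma ultra_act_mult:
  assumes "s \<in> carrier G" "t \<in> carrier G" "U \<in> ultra"
  shows "ultra_act (s \<otimes> t) U = ultra_act s (ultra_act t U)"
  using assms ultra_act_in[OF assms(2,3)]
  by (simp add: ultra_act_def inv_mult_group shift_shift shift_subset)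

lemma ultra_act_one: "U \<in> ultra \<Longrightarrow> ultra_act \<one> U = U"
  unfolding ultra_act_def by (auto simp: shift_one ultra_def)

lemma ultra_act_inv:
  assumes "s \<in> carrier G" "U \<in> ultra"
  shows "ultra_act (inv s) (ultra_act s U) = U"
  using ultra_act_mult[of "inv s" s U] ultra_act_one assms by simp

lemma group_action_ultra: "group_action G ultra ultra_act"
proof -
  have bij: "ultra_act s \<in> Bij ultra" if s: "s \<in> carrier G" for s
  proof -
    have "bij_betw (ultra_act s) ultra ultra"
    proof (rule bij_betw_byWitness[where f' = "ultra_act (inv s)"])
      show "\<forall>U\<in>ultra. ultra_act (inv s) (ultra_act s U) = U" using ultra_act_inv[OF s] by blast
      show "\<forall>U\<in>ultra. ultra_act s (ultra_act (inv s) U) = U" using ultra_act_inv[of "inv s"] s by simp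
    qed (use ultra_act_in s in auto)
    then show ?thesis by (simp add: Bij_def ultra_act_def)
  qed
  have "ultra_act \<in> hom G (BijGroup ultra)"
  proof (rule homI)
    fix s assume "s \<in> carrier G"
    then show "ultra_act s \<in> carrier (BijGroup ultra)" using bij by (simp add: BijGroup_def)
  next
    fix s t assume st: "s \<in> carrier G" "t \<in> carrier G"
    have "ultra_act (s \<otimes> t) = compose ultra (ultra_act s) (ultra_act t)"
    proof (rule extensionalityI[where A = ultra])
      show "ultra_act (s \<otimes> t) \<in> extensional ultra" by (simp add: ultra_act_def)
      fix U assume U: "U \<in> ultra"
      then show "ultra_act (s \<otimes> t) U = compose ultra (ultra_act s) (ultra_act t) U"
        using ultra_act_mult[OF st U] by (simp add: compose_eq)
    qed simp
    then show "ultra_act (s \<otimes> t) = ultra_act s \<otimes>\<^bsub>BijGroup ultra\<^esub> ultra_act t"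
      using bij st by (simp add: BijGroup_def)
  qed
  then show ?thesis
    by (auto simp: group_action_def group_hom_def group_hom_axioms_def group_BijGroup is_group)
qed

lemma continuous_ultra_act:
  assumes s: "s \<in> carrier G"
  shows "continuous_map ultra_top ultra_top (ultra_act s)"
  unfolding ultra_top_def
proof (rule continuous_on_generated_topo, unfold ultra_top_def[symmetric] topspace_ultra)
  fix W assume "W \<in> ultra_basic ` Pow (carrier G)"
  then obtain A where A: "A \<subseteq> carrier G" "W = ultra_basic A" by blast
  have "ultra_act s -` W \<inter> ultra = ultra_basic (shift (inv s) A)"
  proof (intro Set.set_eqI)
    fix U show "U \<in> ultra_act s -` W \<inter> ultra \<longleftrightarrow> U \<in> ultra_basic (shift (inv s) A)"
    proof (cases "U \<in> ultra")
      case True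
      then show ?thesis using ultra_act_in[OF s True] A by (simp add: ultra_basic_def ultra_act_def)
    qed (simp add: ultra_basic_def)
  qed
  then show "openin ultra_top (ultra_act s -` W \<inter> ultra)"
    using openin_ultra_basic[OF shift_subset] by simp
next
  have "ultra_act s ` ultra \<subseteq> ultra" using ultra_act_in[OF s] by blast
  then show "ultra_act s ` ultra \<subseteq> \<Union> (ultra_basic ` Pow (carrier G))"
    using topspace_ultra unfolding ultra_top_def topology_generated_by_topspace by simp
qed

lemma homeomorphism_action_ultra: "homeomorphism_action G ultra_top ultra_act"
  unfolding homeomorphism_action_def topspace_ultra
proof (intro conjI ballI group_action_ultra)
  fix s assume s: "s \<in> carrier G"
  have "homeomorphic_maps ultra_top ultra_top (ultra_act s) (ultra_act (inv s))"
    unfolding homeomorphic_maps_def topspace_ultra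
    using continuous_ultra_act ultra_act_inv[OF s] ultra_act_inv[of "inv s"] s by simp
  then show "homeomorphic_map ultra_top ultra_top (ultra_act s)"
    using homeomorphic_map_maps by blast
qed

text \<open>If no level set belonged to \<open>U\<close>, their complements would, and so would the
  intersection of these finitely many complements, which is empty.\<close>

lemma ultra_partition:
  assumes U: "U \<in> ultra" and Y: "finite (\<nu> ` carrier G)"
  shows "\<exists>y\<in>\<nu> ` carrier G. {z \<in> carrier G. \<nu> z = y} \<in> U"
proof (rule ccontr)
  assume *: "\<not> ?thesis"
  have "{z \<in> carrier G. \<nu> z \<notin> Z} \<in> U" if "finite Z" "Z \<subseteq> \<nu> ` carrier G" for Z
    using that
  proof (induction Z rule: finite_induct)
    case empty
    then show ?case using ultra_carrier[OF U] by simp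
  next
    case (insert y Z)
    have "{z \<in> carrier G. \<nu> z = y} \<notin> U" using * insert.prems by blast
    then have "carrier G - {z \<in> carrier G. \<nu> z = y} \<in> U" using U unfolding ultra_def by blast
    moreover have "{z \<in> carrier G. \<nu> z \<notin> Z} \<in> U" using insert by simp
    ultimately have "(carrier G - {z \<in> carrier G. \<nu> z = y}) \<inter> {z \<in> carrier G. \<nu> z \<notin> Z} \<in> U"
      using U unfolding ultra_def by blast
    moreover have "(carrier G - {z \<in> carrier G. \<nu> z = y}) \<inter> {z \<in> carrier G. \<nu> z \<notin> Z}
       = {z \<in> carrier G. \<nu> z \<notin> insert y Z}" by auto
    ultimately show ?case by simp
  qed
  from this[OF Y order_refl] have "{} \<in> U" by (simp add: Collect_conv_if cong: conj_cong)
  then show False using U by (simp add: ultra_def)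
qed

lemma ultra_nonempty: "ultra \<noteq> {}"
proof -
  have "{A \<in> Pow (carrier G). \<one> \<in> A} \<in> ultra" by (auto simp: ultra_def)
  then show ?thesis by blast
qed

text \<open>After rounding, the almost invariant function takes finitely many values; an ultrafilter
  contains exactly one of its level sets and is assigned that value. This extends the function to
  the Stone-Cech compactification, and the estimate passes over because any two sets of an
  ultrafilter meet.\<close>

lemma property_A_imp_exact_group:
  assumes pA: "property_A (carrier G)"
  shows "exact_group TYPE('a set set) G"
proof -
  have "\<exists>\<mu>. continuous_map ultra_top (Prob_topology G) \<mu> \<and>
      (\<forall>s\<in>S. \<forall>\<omega>\<in>ultra. l1_dist G (translate G s (\<mu> \<omega>)) (\<mu> (ultra_act s \<omega>)) \<le> e)"
    if S: "finite S \<and> S \<subseteq> carrier G \<and> e > 0" for S and e :: real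
  proof -
    \<comment> \<open>The rounding errors at \<open>z\<close> and at \<open>s \<otimes> z\<close>
      take the other two thirds.\<close>
    have "almost_inv (carrier G) S (e/3)" by (rule property_AD[OF pA]) (use S in auto)
    then obtain F \<mu> where F: "F \<subseteq> carrier G" "finite F" and \<mu>: "\<forall>z\<in>carrier G. fprob F (\<mu> z)"
      and e: "\<forall>s\<in>S. \<forall>z\<in>carrier G. s \<otimes> z \<in> carrier G \<longrightarrow> l1d (left_shift s (\<mu> z)) (\<mu> (s \<otimes> z)) \<le> e/3"
      by (rule almost_invE)
    have e3: "e/3 > 0" using S by simp
    obtain \<rho> where \<rho>: "finite (\<rho> ` {p. fprob F p})"
      "\<forall>p. fprob F p \<longrightarrow> fprob F (\<rho> p) \<and> l1d p (\<rho> p) \<le> e/3"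
      by (rule fprob_round[OF F(2) e3])
    define \<nu> where "\<nu> z = \<rho> (\<mu> z)" for z
    have \<nu>F: "fprob F (\<nu> z)" and \<nu>\<mu>: "l1d (\<mu> z) (\<nu> z) \<le> e/3" if "z \<in> carrier G" for z
      using \<rho>(2) \<mu> that unfolding \<nu>_def by simp_all
    have \<nu>fin: "finite (\<nu> ` carrier G)"
      by (rule finite_subset[OF _ \<rho>(1)]) (use \<mu> in \<open>auto simp: \<nu>_def\<close>)
    have \<nu>e: "l1d (left_shift s (\<nu> z)) (\<nu> (s \<otimes> z)) \<le> e" if "s \<in> S" "z \<in> carrier G" for s z
    proof -
      have sG: "s \<in> carrier G" and sz: "s \<otimes> z \<in> carrier G" using that S by auto
      note fs = fprob_left_shift[OF sG F(1)]
      have "l1d (left_shift s (\<nu> z)) (\<nu> (s \<otimes> z)) \<le> l1d (left_shift s (\<nu> z)) (left_shift s (\<mu> z)) + l1d (left_shift s (\<mu> z)) (\<nu> (s \<otimes> z))"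
        using fs[OF \<nu>F[OF that(2)]] fs[OF \<mu>[rule_format, OF that(2)]] \<nu>F[OF sz] by (rule l1d_triangle)
      also have "l1d (left_shift s (\<nu> z)) (left_shift s (\<mu> z)) = l1d (\<mu> z) (\<nu> z)"
        using l1d_left_shift[OF sG F(1) \<nu>F \<mu>[rule_format], OF that(2) that(2)] l1d_commute[of "\<mu> z"] by simp
      also have "l1d (left_shift s (\<mu> z)) (\<nu> (s \<otimes> z)) \<le> l1d (left_shift s (\<mu> z)) (\<mu> (s \<otimes> z)) + l1d (\<mu> (s \<otimes> z)) (\<nu> (s \<otimes> z))"
        using fs[OF \<mu>[rule_format, OF that(2)]] \<mu>[rule_format, OF sz] \<nu>F[OF sz] by (rule l1d_triangle)
      finally show ?thesis
        using \<nu>\<mu>[OF that(2)] \<nu>\<mu>[OF sz] e[rule_format, OF that sz] by linarith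
    qed
    define lv where "lv y = {z \<in> carrier G. \<nu> z = y}" for y
    define y where "y U = (SOME y. y \<in> \<nu> ` carrier G \<and> lv y \<in> U)" for U
    have y: "y U \<in> \<nu> ` carrier G" "lv (y U) \<in> U" if "U \<in> ultra" for U
      using someI_ex[of "\<lambda>y. y \<in> \<nu> ` carrier G \<and> lv y \<in> U"] ultra_partition[OF that \<nu>fin]
      unfolding y_def lv_def by (auto simp: Bex_def)
    have y_unique: "y U = y'" if U: "U \<in> ultra" and y': "lv y' \<in> U" for U y'
    proof (rule ccontr)
      assume "y U \<noteq> y'"
      then have "lv (y U) \<inter> lv y' = {}" by (auto simp: lv_def)
      moreover have "lv (y U) \<inter> lv y' \<in> U" using U y(2)[OF U] y' by (simp add: ultra_def)
      ultimately show False using U by (simp add: ultra_def)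
    qed
    define m where "m U = restrict (y U) (carrier G)" for U
    have yF: "fprob F (y U)" if "U \<in> ultra" for U using y(1)[OF that] \<nu>F by auto
    have "continuous_map ultra_top (Prob_topology G) m"
      unfolding continuous_map_def topspace_ultra
    proof (intro conjI allI impI)
      have "m U \<in> Prob G" if "U \<in> ultra" for U
        unfolding m_def by (rule restrict_Prob[OF yF[OF that] F(1)])
      moreover have "Prob G \<subseteq> topspace (Prob_topology G)"
        by (auto simp: Prob_topology_def Prob_def PiE_def)
      ultimately show "m \<in> ultra \<rightarrow> topspace (Prob_topology G)" by blast
      fix W
      \<comment> \<open>\<open>m\<close> is constant on the basic open set given by the level set of
        a point, so the preimage of any set \<open>W\<close>, open or not, is open.\<close>
      have eq: "{U \<in> ultra. m U \<in> W} = \<Union> ((\<lambda>U. ultra_basic (lv (y U))) ` {U \<in> ultra. m U \<in> W})"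
      proof (intro Set.set_eqI iffI)
        fix U assume "U \<in> {U \<in> ultra. m U \<in> W}"
        moreover from this have "U \<in> ultra_basic (lv (y U))" using y by (simp add: ultra_basic_def)
        ultimately show "U \<in> \<Union> ((\<lambda>U. ultra_basic (lv (y U))) ` {U \<in> ultra. m U \<in> W})" by blast
      next
        fix U assume "U \<in> \<Union> ((\<lambda>U. ultra_basic (lv (y U))) ` {U \<in> ultra. m U \<in> W})"
        then obtain U' where U': "U' \<in> ultra" "m U' \<in> W" "U \<in> ultra_basic (lv (y U'))" by blast
        then have "U \<in> ultra" "y U = y U'" using y_unique by (auto simp: ultra_basic_def)
        then show "U \<in> {U \<in> ultra. m U \<in> W}" using U' by (simp add: m_def)
      qed
      show "openin ultra_top {U \<in> ultra. m U \<in> W}"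
        by (subst eq, rule openin_Union) (auto simp: lv_def intro: openin_ultra_basic)
    qed
    moreover have "l1_dist G (translate G s (m U)) (m (ultra_act s U)) \<le> e" if s: "s \<in> S" and U: "U \<in> ultra" for s U
    proof -
      have sG: "s \<in> carrier G" using s S by auto
      let ?y = "y U" and ?y' = "y (ultra_act s U)"
      note sU = ultra_act_in[OF sG U]
      \<comment> \<open>This set and \<open>lv ?y\<close> both belong to \<open>U\<close>. At a
        common point \<open>z\<close> the function takes the value \<open>?y\<close>, and at
        \<open>s \<otimes> z\<close> the value \<open>?y'\<close>, so the estimate on the group
        applies.\<close>
      have "shift (inv s) (lv ?y') \<in> U" using y(2)[OF sU] U by (simp add: ultra_act_def)
      then have "lv ?y \<inter> shift (inv s) (lv ?y') \<in> U" using y(2)[OF U] U by (simp add: ultra_def)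
      then have "lv ?y \<inter> shift (inv s) (lv ?y') \<noteq> {}" using U by (auto simp: ultra_def)
      then obtain z where "z \<in> lv ?y" "z \<in> shift (inv s) (lv ?y')" by blast
      then have z: "z \<in> carrier G" "\<nu> z = ?y" "\<nu> (s \<otimes> z) = ?y'" using sG by (auto simp: lv_def shift_def)
      have "l1_dist G (translate G s (m U)) (m (ultra_act s U)) = l1d (left_shift s ?y) ?y'"
        unfolding m_def translate_restrict[OF sG]
        by (rule l1_dist_restrict[OF fprob_left_shift[OF sG F(1) yF[OF U]] _ yF[OF sU] F(1)]) (use sG F in auto)
      then show ?thesis using \<nu>e[OF s z(1)] z by simp
    qed
    ultimately show ?thesis by (intro exI[of _ m] conjI ballI)
  qed
  then have "amenable_action G ultra_top ultra_act"
    unfolding amenable_action_def topspace_ultra by (intro conjI allI impI homeomorphism_action_ultra)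
  then show ?thesis
    unfolding exact_group_def
    using ultra_nonempty compact_ultra Hausdorff_ultra
    by (intro exI[of _ ultra_top] exI[of _ ultra_act] conjI) simp_all
qed

end

section \<open>Fine hyperbolic graphs\<close>

text \<open>Standing still is allowed, as in paths, so on \<open>V\<close> the powers of this
  relation increase with the exponent. The edge set is a parameter because paths are later confined
  to part of the edges.\<close>

definition graph_step :: "'v set \<Rightarrow> 'v set set \<Rightarrow> ('v \<times> 'v) set" where
  "graph_step V E = {(x, y). x \<in> V \<and> y \<in> V \<and> (x = y \<or> {x, y} \<in> E)}"

definition circuit_vertices :: "'v set \<Rightarrow> 'v set set \<Rightarrow> nat \<Rightarrow> 'v set \<Rightarrow> 'v set" where
  "circuit_vertices V E n e = \<Union>(set ` {p. circuit V E p \<and> path_length p \<le> n \<and> e \<in> path_edges p})"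

lemma relpow_graph_step_in: "(x, y) \<in> graph_step V E ^^ n \<Longrightarrow> x \<in> V \<Longrightarrow> y \<in> V"
  by (cases n) (auto simp: graph_step_def)

lemma relpow_graph_step_pad:
  assumes "(x, y) \<in> graph_step V E ^^ m" "x \<in> V" "m \<le> n"
  shows "(x, y) \<in> graph_step V E ^^ n"
proof -
  have "(y, y) \<in> graph_step V E ^^ k" for k
  proof (induction k)
    case (Suc k)
    have "(y, y) \<in> graph_step V E" using relpow_graph_step_in[OF assms(1,2)] by (simp add: graph_step_def)
    with Suc show ?case by (rule relpow_Suc_I)
  qed simp
  then have "(x, y) \<in> graph_step V E ^^ (m + (n - m))"
    unfolding relpow_add using assms(1) by blast
  then show ?thesis using assms(3) by simp
qed

lemma relpow_graph_step_sym: "(x, y) \<in> graph_step V E ^^ n \<Longrightarrow> (y, x) \<in> graph_step V E ^^ n"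
proof (induction n arbitrary: y)
  case (Suc n)
  then obtain z where "(x, z) \<in> graph_step V E ^^ n" "(z, y) \<in> graph_step V E" by auto
  then have "(y, z) \<in> graph_step V E" "(z, x) \<in> graph_step V E ^^ n"
    using Suc.IH by (auto simp: graph_step_def insert_commute)
  then show ?case by (rule relpow_Suc_I2)
qed auto

lemma relpow_graph_step_mono: "E \<subseteq> E' \<Longrightarrow> graph_step V E ^^ n \<subseteq> graph_step V E' ^^ n"
proof (induction n)
  case (Suc n)
  moreover have "graph_step V E \<subseteq> graph_step V E'" using Suc.prems by (auto simp: graph_step_def)
  ultimately show ?case by (simp add: relcomp_mono)
qed simp

lemma relpow_trans: "(x, y) \<in> S ^^ m \<Longrightarrow> (y, z) \<in> S ^^ n \<Longrightarrow> (x, z) \<in> S ^^ (m + n)"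
  by (auto simp: relpow_add)

lemma relpow_segment:
  assumes "\<And>i. a \<le> i \<Longrightarrow> i < b \<Longrightarrow> (c i, c (Suc i)) \<in> S" "a \<le> b"
  shows "(c a, c b) \<in> S ^^ (b - a)"
  unfolding relpow_fun_conv
  by (rule exI[of _ "\<lambda>i. c (a + i)"]) (use assms in auto)

lemma graph_path_iff_relpow:
  assumes "x \<in> V"
  shows "(x, y) \<in> graph_step V E ^^ n \<longleftrightarrow>
    (\<exists>p. graph_path V E p \<and> hd p = x \<and> last p = y \<and> path_length p = n)"
proof
  assume "(x, y) \<in> graph_step V E ^^ n"
  then obtain f where f: "f 0 = x" "f n = y" "\<And>i. i < n \<Longrightarrow> (f i, f (Suc i)) \<in> graph_step V E"
    unfolding relpow_fun_conv by blast
  have fV: "f i \<in> V" if "i \<le> n" for i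
    using that by (cases i) (use f(1) f(3)[of "i - 1"] assms in \<open>auto simp: graph_step_def\<close>)
  let ?p = "map f [0..<Suc n]"
  have "graph_path V E ?p"
    unfolding graph_path_def
  proof (intro conjI allI impI)
    fix i assume "Suc i < length ?p"
    then show "?p ! i = ?p ! Suc i \<or> {?p ! i, ?p ! Suc i} \<in> E"
      using f(3)[of i] by (auto simp: graph_step_def simp del: upt_Suc)
  qed (use fV in \<open>auto simp del: upt_Suc\<close>)
  moreover have "hd ?p = x" "last ?p = y" "path_length ?p = n"
    using f by (auto simp: hd_map path_length_def last_map simp del: upt_Suc)
  ultimately show "\<exists>p. graph_path V E p \<and> hd p = x \<and> last p = y \<and> path_length p = n" by blast
next
  assume "\<exists>p. graph_path V E p \<and> hd p = x \<and> last p = y \<and> path_length p = n"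
  then obtain p where p: "graph_path V E p" "hd p = x" "last p = y" "path_length p = n" by blast
  have ne: "p \<noteq> []" and len: "length p = Suc n"
    using p(1,4) by (auto simp: graph_path_def path_length_def)
  show "(x, y) \<in> graph_step V E ^^ n"
    unfolding relpow_fun_conv
  proof (intro exI[of _ "(!) p"] conjI allI impI)
    show "p ! 0 = x" "p ! n = y" using p ne len by (auto simp: hd_conv_nth last_conv_nth)
    fix i assume "i < n"
    then show "(p ! i, p ! Suc i) \<in> graph_step V E"
      using p(1) len nth_mem[of i p] nth_mem[of "Suc i" p] unfolding graph_path_def graph_step_def by auto
  qed
qed

text \<open>A shortest path between the two ends repeats no vertex, as the loop between two
  occurrences could be cut out.\<close>

lemma simple_path_exists:
  assumes "(u, w) \<in> graph_step V E ^^ n" "u \<in> V"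
  obtains P where "graph_path V E P" "hd P = u" "last P = w" "path_length P \<le> n" "distinct P"
proof -
  let ?Q = "\<lambda>P. graph_path V E P \<and> hd P = u \<and> last P = w"
  obtain P0 where P0: "?Q P0" "path_length P0 = n" using assms graph_path_iff_relpow by metis
  obtain P where P: "?Q P" and min: "\<And>Q. ?Q Q \<Longrightarrow> length P \<le> length Q"
    using ex_has_least_nat[of ?Q P0 length] P0 by blast
  have ne: "P \<noteq> []" using P by (auto simp: graph_path_def)
  have "distinct P"
  proof (rule ccontr)
    assume "\<not> distinct P"
    then obtain i j where ij: "i < j" "j < length P" "P ! i = P ! j"
      unfolding distinct_conv_nth by (metis nat_neq_iff)
    let ?R = "take i P @ drop j P"
    have len: "length ?R = i + (length P - j)" using ij by simp
    have nth: "?R ! k = (if k < i then P ! k else P ! (k - i + j))" if "k < length ?R" for k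
      using ij that by (auto simp: nth_append add.commute)
    have "?Q ?R"
    proof (intro conjI)
      show "graph_path V E ?R"
        unfolding graph_path_def
      proof (intro conjI allI impI)
        show "set ?R \<subseteq> V" using P by (auto simp: graph_path_def dest: in_set_takeD in_set_dropD)
        fix k assume k: "Suc k < length ?R"
        have st: "Suc a < length P \<Longrightarrow> P ! a = P ! Suc a \<or> {P ! a, P ! Suc a} \<in> E" for a
          using P by (auto simp: graph_path_def)
        consider "Suc k < i" | "Suc k = i" | "i \<le> k" by linarith
        then show "?R ! k = ?R ! Suc k \<or> {?R ! k, ?R ! Suc k} \<in> E"
        proof cases
          case 1 then show ?thesis using nth[of k] nth[of "Suc k"] k st[of k] ij by auto
        next
          case 2 then show ?thesis using nth[of k] nth[of "Suc k"] k st[of k] ij by auto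
        next
          case 3 then show ?thesis using nth[of k] nth[of "Suc k"] k st[of "k - i + j"] ij len
            by (auto simp: Suc_diff_le)
        qed
      qed (use ij in auto)
      show "hd ?R = u" using P ij ne by (cases "i = 0") (auto simp: hd_append hd_drop_conv_nth hd_conv_nth)
      show "last ?R = w" using P ij by (auto simp: last_append)
    qed
    from min[OF this] show False using ij len by linarith
  qed
  moreover have "path_length P \<le> n" using min[of P0] P0 by (auto simp: path_length_def)
  ultimately show thesis using that P by blast
qed

text \<open>A simple path in \<open>E'\<close> between the ends of an edge closes up to a circuit
  through that edge. \<open>E'\<close> will be chosen so sparse that the path is forced through a
  prescribed vertex, which fineness then confines to a finite set.\<close>

lemma closing_circuit:
  assumes "{u, w} \<in> E" "u \<in> V" "(u, w) \<in> graph_step V E' ^^ n" "E' \<subseteq> E"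
  obtains P where "graph_path V E' P" "hd P = u" "last P = w" "distinct P"
    "set P \<subseteq> circuit_vertices V E (Suc n) {u, w}"
proof -
  obtain P where P: "graph_path V E' P" "hd P = u" "last P = w" "path_length P \<le> n" "distinct P"
    using simple_path_exists[OF assms(3,2)] .
  have ne: "P \<noteq> []" using P by (auto simp: graph_path_def)
  let ?C = "P @ [u]"
  have l: "P ! (length P - Suc 0) = w" using P(3) ne by (simp add: last_conv_nth)
  have "circuit V E ?C"
    unfolding circuit_def graph_path_def
  proof (intro conjI allI impI)
    show "set ?C \<subseteq> V" using P(1) assms(2) by (auto simp: graph_path_def)
    fix i assume i: "Suc i < length ?C"
    show "?C ! i = ?C ! Suc i \<or> {?C ! i, ?C ! Suc i} \<in> E"
    proof (cases "Suc i < length P")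
      case True then show ?thesis using P(1) assms(4) by (auto simp: graph_path_def nth_append)
    next
      case False
      then have "i = length P - Suc 0" "Suc i = length P" using i by auto
      then show ?thesis using l assms(1) ne by (simp add: nth_append insert_commute)
    qed
  qed (use P ne in auto)
  moreover have "path_length ?C \<le> Suc n" using P(4) by (simp add: path_length_def)
  moreover have "{u, w} \<in> path_edges ?C"
    unfolding path_edges_def using l ne
    by (auto intro!: exI[of _ "length P - Suc 0"] simp: nth_append insert_commute)
  ultimately have "set ?C \<subseteq> circuit_vertices V E (Suc n) {u, w}" unfolding circuit_vertices_def by blast
  then show thesis using that P by simp
qed

section \<open>Path metric and geodesics of a connected graph\<close>

locale conn_graph =
  fixes V :: "'v set" and E :: "'v set set"
  assumes simple: "simple_graph V E" and conn: "connected_graph V E"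
begin

abbreviation d :: "'v \<Rightarrow> 'v \<Rightarrow> nat" where "d \<equiv> graph_dist V E"

lemma edge_in: "{x, y} \<in> E \<Longrightarrow> x \<in> V \<and> y \<in> V \<and> x \<noteq> y"
  using simple by (fastforce simp: simple_graph_def)

text \<open>Stationary steps pad a shortest path to any larger length, so being joined by a path of
  length exactly \<open>n\<close> and having distance at most \<open>n\<close> agree.\<close>

lemma d_le_iff:
  assumes "x \<in> V" "y \<in> V"
  shows "d x y \<le> n \<longleftrightarrow> (x, y) \<in> graph_step V E ^^ n"
proof -
  have eq: "d x y = (LEAST n. (x, y) \<in> graph_step V E ^^ n)"
    unfolding graph_dist_def graph_path_iff_relpow[OF assms(1)] ..
  have "\<exists>n. (x, y) \<in> graph_step V E ^^ n"
    using conn assms unfolding connected_graph_def graph_path_iff_relpow[OF assms(1)] by blast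
  then have "(x, y) \<in> graph_step V E ^^ d x y" unfolding eq by (rule LeastI_ex)
  then show ?thesis using relpow_graph_step_pad[where m = "d x y" and n = n] assms unfolding eq
    by (auto intro: Least_le)
qed

lemma d_relpow: "x \<in> V \<Longrightarrow> y \<in> V \<Longrightarrow> (x, y) \<in> graph_step V E ^^ d x y"
  using d_le_iff by blast

lemma d_triangle:
  assumes "x \<in> V" "y \<in> V" "z \<in> V"
  shows "d x z \<le> d x y + d y z"
  using relpow_trans[OF d_relpow d_relpow, of x y z] assms by (simp add: d_le_iff)

lemma d_commute: "x \<in> V \<Longrightarrow> y \<in> V \<Longrightarrow> d x y = d y x"
  by (rule antisym; rule d_le_iff[THEN iffD2, OF _ _ relpow_graph_step_sym[OF d_relpow]])

lemma d_eq_0: "x \<in> V \<Longrightarrow> y \<in> V \<Longrightarrow> d x y = 0 \<longleftrightarrow> x = y"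
  using d_le_iff[of x y 0] by auto

lemma d_self [simp]: "x \<in> V \<Longrightarrow> d x x = 0"
  by (simp add: d_eq_0)

lemma d_le_1: "x \<in> V \<Longrightarrow> y \<in> V \<Longrightarrow> d x y \<le> 1 \<longleftrightarrow> x = y \<or> {x, y} \<in> E"
  by (auto simp: d_le_iff graph_step_def)

lemma d_eq_1: "x \<in> V \<Longrightarrow> y \<in> V \<Longrightarrow> d x y = 1 \<Longrightarrow> {x, y} \<in> E"
  using d_le_1[of x y] by auto

lemma d_between:
  assumes "x \<in> V" "y \<in> V" "i \<le> d x y"
  obtains z where "z \<in> V" "d x z = i" "d z y = d x y - i"
proof -
  have "(x, y) \<in> graph_step V E ^^ (i + (d x y - i))" using d_relpow assms by simp
  then obtain z where z: "(x, z) \<in> graph_step V E ^^ i" "(z, y) \<in> graph_step V E ^^ (d x y - i)"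
    by (auto simp: relpow_add)
  have zV: "z \<in> V" using relpow_graph_step_in[OF z(1)] assms by simp
  have "d x z \<le> i" "d z y \<le> d x y - i" using z zV assms d_le_iff by auto
  moreover have "d x y \<le> d x z + d z y" using d_triangle zV assms by blast
  ultimately show thesis using that[OF zV] assms by linarith
qed

lemma graph_path_d_le:
  assumes "graph_path V E p" "m \<le> n" "n < length p"
  shows "d (p ! m) (p ! n) \<le> n - m"
proof -
  have V: "p ! i \<in> V" if "i < length p" for i using assms(1) that nth_mem by (fastforce simp: graph_path_def)
  have "(p ! m, p ! n) \<in> graph_step V E ^^ (n - m)"
    by (rule relpow_segment) (use assms V in \<open>auto simp: graph_step_def graph_path_def\<close>)
  then show ?thesis using V assms d_le_iff by auto
qed

text \<open>If an inner stretch were longer than the distance it covers, the triangle inequality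
  would bring the endpoints too close.\<close>

lemma geodesic_pathI:
  assumes p: "graph_path V E p" and len: "path_length p = d (hd p) (last p)"
  shows "geodesic_path V E p"
proof -
  have ne: "p \<noteq> []" using p by (auto simp: graph_path_def)
  have V: "p ! i \<in> V" if "i < length p" for i using p that nth_mem by (fastforce simp: graph_path_def)
  have main: "d (p ! m) (p ! n) = n - m" if "m \<le> n" "n < length p" for m n
  proof (rule antisym)
    let ?l = "length p - 1"
    have "d (p ! 0) (p ! ?l) \<le> d (p ! 0) (p ! m) + d (p ! m) (p ! n) + d (p ! n) (p ! ?l)"
      using d_triangle[of "p ! 0" "p ! m" "p ! ?l"] d_triangle[of "p ! m" "p ! n" "p ! ?l"] V ne that by fastforce
    moreover have "d (p ! 0) (p ! ?l) = ?l"
      using len ne by (simp add: path_length_def hd_conv_nth last_conv_nth)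
    moreover have "d (p ! 0) (p ! m) \<le> m - 0" by (rule graph_path_d_le) (use p that in auto)
    moreover have "d (p ! n) (p ! ?l) \<le> ?l - n" by (rule graph_path_d_le) (use p that in auto)
    ultimately show "n - m \<le> d (p ! m) (p ! n)" using that by linarith
  qed (use graph_path_d_le p that in auto)
  show ?thesis
    unfolding geodesic_path_def
  proof (intro conjI allI impI p)
    fix m n assume mn: "m < length p" "n < length p"
    show "int (d (p ! m) (p ! n)) = \<bar>int m - int n\<bar>"
    proof (cases "m \<le> n")
      case True then show ?thesis using main mn by auto
    next
      case False then show ?thesis using main[of n m] mn d_commute[of "p ! m" "p ! n"] V by auto
    qed
  qed
qed

text \<open>Two geodesics are joined at \<open>p\<close>, of which \<open>tl b\<close> drops the
  second copy; as the distances add up, no shortcut remains.\<close>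

lemma geodesic_through:
  assumes V: "t \<in> V" "p \<in> V" "y \<in> V" and eq: "d t p + d p y = d t y"
  obtains \<alpha> where "geodesic_path V E \<alpha>" "hd \<alpha> = t" "last \<alpha> = y" "length \<alpha> = Suc (d t y)" "\<alpha> ! d t p = p"
proof -
  obtain a where a: "graph_path V E a" "hd a = t" "last a = p" "path_length a = d t p"
    using d_relpow[OF V(1,2)] graph_path_iff_relpow[OF V(1)] by blast
  obtain b where b: "graph_path V E b" "hd b = p" "last b = y" "path_length b = d p y"
    using d_relpow[OF V(2,3)] graph_path_iff_relpow[OF V(2)] by blast
  have ne: "a \<noteq> []" "b \<noteq> []" using a b by (auto simp: graph_path_def)
  then have len: "length a = Suc (d t p)" "length b = Suc (d p y)"
    using a b by (auto simp: path_length_def) (cases a; cases b; auto)+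
  let ?c = "a @ tl b"
  have nthb: "?c ! i = b ! (i - d t p)" if "d t p \<le> i" "i < length ?c" for i
  proof (cases "i = d t p")
    case True
    then show ?thesis using a b ne len by (simp add: nth_append last_conv_nth hd_conv_nth)
  next
    case False
    then show ?thesis using that len ne by (auto simp: nth_append nth_tl Suc_diff_le[symmetric])
  qed
  have ntha: "?c ! i = a ! i" if "i \<le> d t p" for i using that len by (simp add: nth_append)
  have c: "graph_path V E ?c"
    unfolding graph_path_def
  proof (intro conjI allI impI)
    show "set ?c \<subseteq> V" using a b ne by (auto simp: graph_path_def dest: list.set_sel(2))
    fix i assume i: "Suc i < length ?c"
    show "?c ! i = ?c ! Suc i \<or> {?c ! i, ?c ! Suc i} \<in> E"
    proof (cases "Suc i \<le> d t p")
      case True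
      then show ?thesis using ntha[of i] ntha[of "Suc i"] a(1) len by (auto simp: graph_path_def)
    next
      case False
      then have "Suc i - d t p = Suc (i - d t p)" by simp
      then show ?thesis using False nthb[of i] nthb[of "Suc i"] b(1) len i ne by (auto simp: graph_path_def)
    qed
  qed (use ne in auto)
  have h: "hd ?c = t" "last ?c = y" "length ?c = Suc (d t y)" "?c ! d t p = p"
  proof -
    show "hd ?c = t" using a(2) ne by simp
    show "length ?c = Suc (d t y)" using len eq by simp
    show "?c ! d t p = p" using ntha[of "d t p"] a(3) ne len by (simp add: last_conv_nth)
    show "last ?c = y"
    proof (cases "tl b = []")
      case True
      then have "b = [p]" using b(2) ne by (cases b) auto
      then show ?thesis using a(3) b(3) ne by simp
    next
      case False
      then show ?thesis using b(3) by (simp add: last_append last_tl)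
    qed
  qed
  show thesis
    by (rule that[OF geodesic_pathI[OF c] h]) (use h in \<open>simp add: path_length_def\<close>)
qed

lemma geodesic_exists:
  assumes "t \<in> V" "y \<in> V"
  obtains \<alpha> where "geodesic_path V E \<alpha>" "hd \<alpha> = t" "last \<alpha> = y" "length \<alpha> = Suc (d t y)"
  by (rule geodesic_through[of t t y]) (use assms that in auto)

lemma geodesic_nth:
  assumes "geodesic_path V E \<alpha>"
  shows geodesic_nth_in: "i < length \<alpha> \<Longrightarrow> \<alpha> ! i \<in> V"
    and geodesic_height: "i < length \<alpha> \<Longrightarrow> d (hd \<alpha>) (\<alpha> ! i) = i"
    and geodesic_edge: "Suc i < length \<alpha> \<Longrightarrow> {\<alpha> ! i, \<alpha> ! Suc i} \<in> E"
proof -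
  have V: "\<alpha> ! i \<in> V" if "i < length \<alpha>" for i
    using assms that nth_mem by (fastforce simp: graph_path_def geodesic_path_def)
  then show "i < length \<alpha> \<Longrightarrow> \<alpha> ! i \<in> V" .
  have ne: "\<alpha> \<noteq> []" using assms by (auto simp: graph_path_def geodesic_path_def)
  have dd: "int (d (\<alpha> ! m) (\<alpha> ! n)) = \<bar>int m - int n\<bar>" if "m < length \<alpha>" "n < length \<alpha>" for m n
    using assms that by (auto simp: geodesic_path_def)
  show "d (hd \<alpha>) (\<alpha> ! i) = i" if "i < length \<alpha>"
    using dd[of 0 i] that ne by (simp add: hd_conv_nth)
  show "{\<alpha> ! i, \<alpha> ! Suc i} \<in> E" if "Suc i < length \<alpha>"
    using dd[of i "Suc i"] that V by (intro d_eq_1) auto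
qed

text \<open>Along a geodesic from \<open>u\<close> to \<open>w\<close> every later vertex is closer
  to \<open>w\<close> than \<open>u\<close> is, hence closer than \<open>c\<close>, and so differs
  from \<open>c\<close>.\<close>

lemma relpow_avoiding:
  assumes "u \<in> V" "w \<in> V" "c \<in> V" "d u w \<le> d c w" "u \<noteq> c"
  shows "(u, w) \<in> graph_step V {e \<in> E. c \<notin> e} ^^ d u w"
  using assms
proof (induction "d u w" arbitrary: u)
  case 0
  then show ?case using d_eq_0[of u w] by simp
next
  case (Suc k)
  obtain u' where u': "u' \<in> V" "d u u' = 1" "d u' w = d u w - 1"
    using d_between[of u w 1] Suc.prems Suc.hyps by (metis One_nat_def le_add1 plus_1_eq_Suc)
  have ne: "u' \<noteq> c" using u' Suc by auto
  have k: "k = d u' w" using u'(3) Suc.hyps(2) by linarith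
  then have "(u', w) \<in> graph_step V {e \<in> E. c \<notin> e} ^^ d u' w"
    using Suc.hyps(1)[OF k] u' Suc.prems Suc.hyps(2) ne by linarith
  then have "(u', w) \<in> graph_step V {e \<in> E. c \<notin> e} ^^ k" using k by simp
  moreover have "(u, u') \<in> graph_step V {e \<in> E. c \<notin> e}"
    using d_eq_1[of u u'] u' Suc.prems ne by (auto simp: graph_step_def)
  ultimately show ?case unfolding Suc.hyps(2)[symmetric] by (rule relpow_Suc_I2[rotated])
qed

text \<open>Let \<open>u\<close> be the first vertex on a geodesic from \<open>c\<close> to
  \<open>p\<close>. Walking from \<open>c\<close> to \<open>v\<close>, on to \<open>w\<close>, to
  \<open>p\<close> and back to \<open>u\<close> along geodesics, \<open>c\<close> is never met
  again. With the edge from \<open>u\<close> to \<open>c\<close> this yields a circuit of bounded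
  length through the fixed edge \<open>{c, u}\<close> and through \<open>v\<close>. In the
  application \<open>p\<close> is a translate of \<open>c\<close>.\<close>

lemma finite_first_vertices:
  assumes fine: "fine_graph V E" and V: "c \<in> V" "p \<in> V" "c \<noteq> p"
  obtains F where "finite F" "F \<subseteq> V"
    "\<And>v w. v \<in> V \<Longrightarrow> w \<in> V \<Longrightarrow> {c, v} \<in> E \<Longrightarrow> d v w < d c w \<Longrightarrow> d c w = n \<Longrightarrow> d p w = n \<Longrightarrow> v \<in> F"
proof -
  let ?E = "{e \<in> E. c \<notin> e}"
  have "1 \<le> d c p" using d_eq_0[of c p] V by linarith
  then obtain u where u: "u \<in> V" "d c u = 1" "d u p = d c p - 1" using d_between[of c p 1] V by blast
  have cu: "{c, u} \<in> E" using d_eq_1 u V by blast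
  have un: "u \<noteq> c" using edge_in cu by blast
  have up: "(u, p) \<in> graph_step V ?E ^^ d u p" using relpow_avoiding[of u p c] u V un by auto
  let ?n = "Suc (2 * n + d u p)"
  let ?F = "circuit_vertices V E (Suc ?n) {c, u}"
  have sub: "set p \<subseteq> V" if "circuit V E p" for p using that by (auto simp: circuit_def graph_path_def)
  show thesis
  proof (rule that[of ?F])
    show "finite ?F" using fine cu unfolding circuit_vertices_def fine_graph_def by auto
    show "?F \<subseteq> V" using sub unfolding circuit_vertices_def by auto
    fix v w assume v: "v \<in> V" "w \<in> V" "{c, v} \<in> E" "d v w < d c w" "d c w = n" "d p w = n"
    have vc: "v \<noteq> c" using edge_in v(3) by blast
    have 1: "(v, w) \<in> graph_step V ?E ^^ d v w" using relpow_avoiding v V vc by auto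
    have 2: "(w, p) \<in> graph_step V ?E ^^ n"
      using relpow_graph_step_sym[OF relpow_avoiding[of p w c]] v V by auto
    \<comment> \<open>The edge \<open>{c, v}\<close> is the only one at \<open>c\<close>, so every
      path in \<open>?E'\<close> that leaves \<open>c\<close> visits \<open>v\<close> first. If
      \<open>v = u\<close>, the circuit is \<open>c u c\<close>, of length two.\<close>
    let ?E' = "insert {c, v} ?E"
    have mono: "graph_step V ?E ^^ k \<subseteq> graph_step V ?E' ^^ k" for k
      by (rule relpow_graph_step_mono) auto
    have "(v, u) \<in> graph_step V ?E ^^ (d v w + n + d u p)"
      using relpow_trans[OF relpow_trans[OF 1 2] relpow_graph_step_sym[OF up]] .
    then have "(v, u) \<in> graph_step V ?E' ^^ (d v w + n + d u p)" using mono by blast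
    moreover have "(c, v) \<in> graph_step V ?E'" using v V by (auto simp: graph_step_def)
    ultimately have "(c, u) \<in> graph_step V ?E' ^^ Suc (d v w + n + d u p)" by (rule relpow_Suc_I2[rotated])
    then have "(c, u) \<in> graph_step V ?E' ^^ ?n" by (rule relpow_graph_step_pad) (use V v in auto)
    from closing_circuit[OF cu V(1) this] v(3)
    obtain P where P: "graph_path V ?E' P" "hd P = c" "last P = u" "distinct P" "set P \<subseteq> ?F" by auto
    have P0: "P ! 0 = c" and len: "Suc 0 < length P"
      using P(1-3) un by (cases P; cases "tl P"; auto simp: graph_path_def)+
    have "P ! 0 \<noteq> P ! Suc 0" using nth_eq_iff_index_eq[OF P(4), of 0 "Suc 0"] len by force
    then have "{c, P ! Suc 0} \<in> ?E'" using P(1) len P0 by (auto simp: graph_path_def)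
    then have "v = P ! Suc 0" using \<open>P ! 0 \<noteq> P ! Suc 0\<close> P0 by (auto simp: doubleton_eq_iff)
    then show "v \<in> ?F" using P(5) len nth_mem by blast
  qed
qed

text \<open>
  Heights are distances from the common starting point. Among the edges that are used, only
  \<open>{\<beta> ! r, \<beta> ! Suc r}\<close> and \<open>{\<alpha> ! r, \<alpha> ! Suc r}\<close> join heights \<open>r\<close> and \<open>Suc r\<close>, so a circuit
  through the former passes through the latter.
\<close>

lemma fellow_travel_circuit_vertices:
  assumes \<alpha>: "geodesic_path V E \<alpha>" and \<beta>: "geodesic_path V E \<beta>" and hd: "hd \<alpha> = t" "hd \<beta> = t"
    and len: "r + L < length \<alpha>" "r + L < length \<beta>" and L: "m < L"
    and close: "\<And>i. i \<le> r + L \<Longrightarrow> d (\<alpha> ! i) (\<beta> ! i) \<le> m"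
  shows "\<alpha> ! r \<in> circuit_vertices V E (Suc (6 * L)) {\<beta> ! r, \<beta> ! Suc r}"
proof -
  \<comment> \<open>Edges whose ends lie on the same side of the cut between heights
    \<open>r\<close> and \<open>Suc r\<close>.\<close>
  define X where "X = {e \<in> E. \<forall>x y. e = {x, y} \<longrightarrow> (d t x \<le> r \<longleftrightarrow> d t y \<le> r)}"
  let ?f = "{\<alpha> ! r, \<alpha> ! Suc r}"
  let ?E' = "insert ?f X"
  note aV = geodesic_nth_in[OF \<alpha>] and bV = geodesic_nth_in[OF \<beta>]
  have ah: "d t (\<alpha> ! i) = i" if "i < length \<alpha>" for i using geodesic_height[OF \<alpha> that] hd by simp
  have bh: "d t (\<beta> ! i) = i" if "i < length \<beta>" for i using geodesic_height[OF \<beta> that] hd by simp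
  have tV: "t \<in> V" using aV[of 0] hd \<alpha> by (auto simp: hd_conv_nth geodesic_path_def graph_path_def)
  have XI: "{x, y} \<in> ?E'" if "{x, y} \<in> E" "d t x \<le> r \<longleftrightarrow> d t y \<le> r" for x y
    using that by (auto simp: X_def doubleton_eq_iff)
  have low: "(x, y) \<in> graph_step V ?E' ^^ n" if "(x, y) \<in> graph_step V E ^^ n" "x \<in> V" "d t x + n \<le> r" for x y n
    using that
  proof (induction n arbitrary: y)
    case (Suc n)
    then obtain z where z: "(x, z) \<in> graph_step V E ^^ n" "(z, y) \<in> graph_step V E" by auto
    have V: "z \<in> V" "y \<in> V" using z by (auto simp: graph_step_def)
    have "d t z \<le> d t x + n" "d t y \<le> d t x + Suc n"
      using d_triangle[of t x z] d_triangle[of t x y] d_le_iff[of x z n] d_le_iff[of x y "Suc n"] V z Suc.prems tV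
      by auto
    then have "(z, y) \<in> graph_step V ?E'" using z(2) XI[of z y] Suc.prems by (auto simp: graph_step_def)
    then show ?case using Suc z by auto
  qed auto
  have high: "(x, y) \<in> graph_step V ?E' ^^ n" if "(x, y) \<in> graph_step V E ^^ n" "x \<in> V" "r + n < d t x" for x y n
    using that
  proof (induction n arbitrary: y)
    case (Suc n)
    then obtain z where z: "(x, z) \<in> graph_step V E ^^ n" "(z, y) \<in> graph_step V E" by auto
    have V: "z \<in> V" "y \<in> V" using z by (auto simp: graph_step_def)
    have "d t x \<le> d t z + n" "d t x \<le> d t y + Suc n"
      using d_triangle[of t z x] d_triangle[of t y x] d_le_iff[of x z n] d_le_iff[of x y "Suc n"]
        d_commute[of x z] d_commute[of x y] V z Suc.prems tV
      by auto
    then have "(z, y) \<in> graph_step V ?E'" using z(2) XI[of z y] Suc.prems by (auto simp: graph_step_def)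
    then show ?case using Suc z by auto
  qed auto
  have bE: "(\<beta> ! i, \<beta> ! Suc i) \<in> graph_step V ?E'" if "Suc i < length \<beta>" "i \<noteq> r" for i
  proof -
    have "{\<beta> ! i, \<beta> ! Suc i} \<in> ?E'"
      by (rule XI[OF geodesic_edge[OF \<beta> that(1)]]) (use bh[of i] bh[of "Suc i"] that in auto)
    then show ?thesis using bV[of i] bV[of "Suc i"] that by (simp add: graph_step_def)
  qed
  have aE: "(\<alpha> ! i, \<alpha> ! Suc i) \<in> graph_step V ?E'" if "Suc i < length \<alpha>" for i
  proof -
    have "{\<alpha> ! i, \<alpha> ! Suc i} \<in> ?E'"
    proof (cases "i = r")
      case False
      show ?thesis
        by (rule XI[OF geodesic_edge[OF \<alpha> that(1)]]) (use ah[of i] ah[of "Suc i"] that False in auto)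
    qed simp
    then show ?thesis using aV[of i] aV[of "Suc i"] that by (simp add: graph_step_def)
  qed
  \<comment> \<open>Natural subtraction: if \<open>r < L\<close>, the connection is made at height
    0, where both geodesics start.\<close>
  define lo where "lo = r - L"
  have 1: "(\<beta> ! r, \<beta> ! lo) \<in> graph_step V ?E' ^^ (r - lo)"
    by (rule relpow_graph_step_sym, rule relpow_segment) (use bE len lo_def in auto)
  \<comment> \<open>The connecting geodesics have length at most \<open>m < L\<close>, too short to
    reach the cut from height \<open>r - L\<close> or from height \<open>r + L\<close>.\<close>
  have 2: "(\<beta> ! lo, \<alpha> ! lo) \<in> graph_step V ?E' ^^ d (\<alpha> ! lo) (\<beta> ! lo)"
  proof (rule relpow_graph_step_sym, rule low)
    show "d t (\<alpha> ! lo) + d (\<alpha> ! lo) (\<beta> ! lo) \<le> r"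
    proof (cases "r \<le> L")
      case True
      then have "lo = 0" by (simp add: lo_def)
      then have "\<alpha> ! lo = \<beta> ! lo" "\<alpha> ! lo = t"
        using hd \<alpha> \<beta> by (auto simp: hd_conv_nth geodesic_path_def graph_path_def)
      then show ?thesis using tV by simp
    next
      case False
      then have "lo + L = r" by (simp add: lo_def)
      then show ?thesis using close[of lo] ah[of lo] L len by linarith
    qed
  qed (use aV bV len d_relpow lo_def in auto)
  have 3: "(\<alpha> ! lo, \<alpha> ! (r + L)) \<in> graph_step V ?E' ^^ (r + L - lo)"
    by (rule relpow_segment) (use aE len lo_def in auto)
  have 4: "(\<alpha> ! (r + L), \<beta> ! (r + L)) \<in> graph_step V ?E' ^^ d (\<alpha> ! (r + L)) (\<beta> ! (r + L))"
    by (rule high) (use aV bV len d_relpow ah close[of "r + L"] L in auto)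
  have 5: "(\<beta> ! (r + L), \<beta> ! Suc r) \<in> graph_step V ?E' ^^ (r + L - Suc r)"
    by (rule relpow_graph_step_sym, rule relpow_segment) (use bE len L in auto)
  have lo: "r \<le> lo + L" "lo \<le> r" by (auto simp: lo_def)
  then have "d (\<alpha> ! lo) (\<beta> ! lo) \<le> m" "d (\<alpha> ! (r + L)) (\<beta> ! (r + L)) \<le> m" using close by auto
  \<comment> \<open>The five pieces have lengths at most \<open>L\<close>, \<open>m\<close>,
    \<open>2 * L\<close>, \<open>m\<close> and \<open>L - 1\<close>.\<close>
  then have len6: "r - lo + d (\<alpha> ! lo) (\<beta> ! lo) + (r + L - lo) + d (\<alpha> ! (r + L)) (\<beta> ! (r + L)) +
      (r + L - Suc r) \<le> 6 * L"
    using lo L by linarith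
  have "(\<beta> ! r, \<beta> ! Suc r) \<in> graph_step V ?E' ^^ (6 * L)"
    by (rule relpow_graph_step_pad[OF relpow_trans[OF relpow_trans[OF relpow_trans[OF relpow_trans[OF 1 2] 3] 4] 5]])
       (use bV[of r] len len6 in auto)
  moreover have "{\<beta> ! r, \<beta> ! Suc r} \<in> E" by (rule geodesic_edge[OF \<beta>]) (use len L in auto)
  moreover have "\<beta> ! r \<in> V" using bV len by simp
  moreover have "?E' \<subseteq> E"
  proof -
    have "?f \<in> E" by (rule geodesic_edge[OF \<alpha>]) (use len L in auto)
    then show ?thesis by (auto simp: X_def)
  qed
  ultimately obtain P where P: "graph_path V ?E' P" "hd P = \<beta> ! r" "last P = \<beta> ! Suc r"
    "set P \<subseteq> circuit_vertices V E (Suc (6 * L)) {\<beta> ! r, \<beta> ! Suc r}"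
    using closing_circuit[of "\<beta> ! r" "\<beta> ! Suc r" E V "6 * L" ?E'] by metis
  have ne: "P \<noteq> []" using P(1) by (auto simp: graph_path_def)
  have "\<exists>i. Suc i < length P \<and> d t (P ! i) \<le> r \<and> \<not> d t (P ! Suc i) \<le> r"
  proof (rule ccontr)
    assume *: "\<not> ?thesis"
    have "d t (P ! i) \<le> r" if "i < length P" for i
      using that
    proof (induction i)
      case 0 then show ?case using P(2) ne bh[of r] len by (simp add: hd_conv_nth)
    next
      case (Suc i) then show ?case using * by auto
    qed
    from this[of "length P - 1"] show False using P(3) ne bh[of "Suc r"] len L by (simp add: last_conv_nth)
  qed
  then obtain i where i: "Suc i < length P" "d t (P ! i) \<le> r" "\<not> d t (P ! Suc i) \<le> r" by blast
  then have "{P ! i, P ! Suc i} \<in> ?E'" using P(1) by (auto simp: graph_path_def)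
  then have "{P ! i, P ! Suc i} = ?f" using i by (auto simp: X_def)
  then have "\<alpha> ! r \<in> {P ! i, P ! Suc i}" by simp
  moreover have "P ! i \<in> set P" "P ! Suc i \<in> set P" using i by auto
  ultimately show ?thesis using P(4) by auto
qed

text \<open>If \<open>y\<close> is within \<open>l\<close> of the target, the target itself replaces
  the point at distance \<open>l\<close>. This keeps the set nonempty at the price of one extra
  point, the summand 1 in the cardinality bound.\<close>

definition geodesic_points :: "'v \<Rightarrow> nat \<Rightarrow> nat \<Rightarrow> 'v \<Rightarrow> 'v set" where
  "geodesic_points t l k x = {p \<in> V. \<exists>y\<in>V. d x y \<le> k \<and>
     (if d y t \<le> l then p = t else d y p = l \<and> d p t + l = d y t)}"

lemma geodesic_points_nonempty:
  assumes "t \<in> V" "x \<in> V"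
  shows "geodesic_points t l k x \<noteq> {}"
proof (cases "d x t \<le> l")
  case True
  then have "t \<in> geodesic_points t l k x" using assms unfolding geodesic_points_def by (auto intro!: bexI[of _ x])
  then show ?thesis by blast
next
  case False
  then obtain p where "p \<in> V" "d x p = l" "d p t = d x t - l"
    using d_between[of x t l] assms by auto
  then have "p \<in> geodesic_points t l k x" using assms False unfolding geodesic_points_def by (auto intro!: bexI[of _ x])
  then show ?thesis by blast
qed

lemma geodesic_points_mono:
  assumes "x \<in> V" "x' \<in> V" "d x x' \<le> D" "k + D \<le> k'"
  shows "geodesic_points t l k x \<subseteq> geodesic_points t l k' x'"
proof
  fix p assume "p \<in> geodesic_points t l k x"
  then obtain y where y: "y \<in> V" "d x y \<le> k" "p \<in> V"
    "if d y t \<le> l then p = t else d y p = l \<and> d p t + l = d y t"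
    by (auto simp: geodesic_points_def)
  have "d x' y \<le> k'" using d_triangle[of x' x y] d_commute[of x x'] y assms by auto
  then show "p \<in> geodesic_points t l k' x'" using y unfolding geodesic_points_def by blast
qed

lemma geodesic_points_dist:
  assumes "t \<in> V" "x \<in> V" "p \<in> geodesic_points t l k x"
  shows "d x p \<le> k + l"
proof -
  obtain y where y: "y \<in> V" "d x y \<le> k" "p \<in> V"
    "if d y t \<le> l then p = t else d y p = l \<and> d p t + l = d y t"
    using assms by (auto simp: geodesic_points_def)
  then have "d y p \<le> l" by (auto split: if_splits)
  then show ?thesis using d_triangle[of x y p] y assms by auto
qed

text \<open>All geodesics are compared with one geodesic \<beta> from \<open>t\<close> to
  \<open>x\<close>. The point on a geodesic to \<open>y\<close> has height \<open>d t y - l\<close>,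
  and since \<open>l\<close> exceeds \<open>k\<close> by at least \<open>Suc m\<close>, the two
  geodesics still fellow-travel \<open>Suc m\<close> beyond it. So it lies on a short circuit
  through the edge of \<beta> at that height, and \<open>d t y\<close> takes at most
  \<open>2 * k + 1\<close> values.\<close>

lemma card_geodesic_points_le:
  assumes t: "t \<in> V" and x: "x \<in> V"
    and hyp: "\<And>\<alpha> \<beta> k. geodesic_path V E \<alpha> \<Longrightarrow> geodesic_path V E \<beta> \<Longrightarrow> hd \<alpha> = hd \<beta> \<Longrightarrow>
      real k \<le> gromov_product V E (last \<alpha>) (last \<beta>) (hd \<alpha>) \<Longrightarrow> d (\<alpha> ! k) (\<beta> ! k) \<le> m"
    and N: "\<And>e. e \<in> E \<Longrightarrow> finite (circuit_vertices V E (Suc (6 * Suc m)) e) \<and> card (circuit_vertices V E (Suc (6 * Suc m)) e) \<le> N"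
    and l: "k + Suc m \<le> l"
  shows "finite (geodesic_points t l k x) \<and> card (geodesic_points t l k x) \<le> 1 + (2 * k + 1) * N"
proof -
  obtain \<beta> where \<beta>: "geodesic_path V E \<beta>" "hd \<beta> = t" "last \<beta> = x" "length \<beta> = Suc (d t x)"
    using geodesic_exists t x .
  define C where "C r = (if Suc r < length \<beta> then circuit_vertices V E (Suc (6 * Suc m)) {\<beta> ! r, \<beta> ! Suc r} else {})" for r
  have C: "finite (C r)" "card (C r) \<le> N" for r
    using N[OF geodesic_edge[OF \<beta>(1)]] by (auto simp: C_def)
  let ?R = "(\<lambda>j. j - l) ` {d x t - k..d x t + k}"
  have "geodesic_points t l k x \<subseteq> insert t (\<Union>r\<in>?R. C r)"
  proof
    fix p assume "p \<in> geodesic_points t l k x"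
    then obtain y where y: "y \<in> V" "d x y \<le> k" "p \<in> V"
      "if d y t \<le> l then p = t else d y p = l \<and> d p t + l = d y t"
      by (auto simp: geodesic_points_def)
    show "p \<in> insert t (\<Union>r\<in>?R. C r)"
    proof (cases "d y t \<le> l")
      case False
      define r where "r = d t p"
      have p: "d y p = l" "d p t + l = d y t" using y False by auto
      have cm: "d p t = d t p" "d y t = d t y" "d y p = d p y" "d x t = d t x" "d x y = d y x"
        using d_commute y t x by auto
      obtain \<alpha> where \<alpha>: "geodesic_path V E \<alpha>" "hd \<alpha> = t" "last \<alpha> = y" "length \<alpha> = Suc (d t y)" "\<alpha> ! r = p"
        using geodesic_through[OF t y(3,1)] p cm unfolding r_def by metis
      have b1: "d t y \<le> d t x + k" "d t x \<le> d t y + k"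
        using d_triangle[of t x y] d_triangle[of t y x] y x t cm by auto
      have rl: "r + l = d t y" using p cm r_def by simp
      have "\<alpha> ! r \<in> circuit_vertices V E (Suc (6 * Suc m)) {\<beta> ! r, \<beta> ! Suc r}"
      proof (rule fellow_travel_circuit_vertices[where m = m])
        show "r + Suc m < length \<alpha>" "r + Suc m < length \<beta>" using rl b1 l \<alpha> \<beta> by auto
        fix i assume "i \<le> r + Suc m"
        \<comment> \<open>By the triangle inequality the Gromov product is at least
          \<open>d t y - k\<close>.\<close>
        then have "real i \<le> gromov_product V E (last \<alpha>) (last \<beta>) (hd \<alpha>)"
          using rl b1 l y cm unfolding gromov_product_def \<alpha> \<beta> by simp
        then show "d (\<alpha> ! i) (\<beta> ! i) \<le> m" using hyp \<alpha> \<beta> by simp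
      qed (use \<alpha> \<beta> in auto)
      moreover have "Suc r < length \<beta>" using rl b1 l \<beta> by auto
      ultimately have "p \<in> C r" using \<alpha> by (simp add: C_def)
      moreover have "r \<in> ?R" by (rule image_eqI[of _ _ "d t y"]) (use rl b1 cm in auto)
      ultimately show ?thesis by blast
    qed (use y in auto)
  qed
  moreover have "finite (insert t (\<Union>r\<in>?R. C r))" using C by auto
  moreover have "card (insert t (\<Union>r\<in>?R. C r)) \<le> 1 + (2 * k + 1) * N"
  proof -
    have "card (\<Union>r\<in>?R. C r) \<le> (\<Sum>r\<in>?R. card (C r))" by (rule card_UN_le) simp
    also have "\<dots> \<le> card ?R * N" using C sum_bounded_above[of ?R "\<lambda>r. card (C r)" N] by simp
    also have "card ?R \<le> 2 * k + 1"
      by (rule order_trans[OF card_image_le]) auto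
    finally have "card (\<Union>r\<in>?R. C r) \<le> (2 * k + 1) * N" by simp
    moreover have "finite (\<Union>r\<in>?R. C r)" using C by auto
    ultimately show ?thesis by (simp add: card_insert_if)
  qed
  ultimately show ?thesis using finite_subset card_mono order_trans by meson
qed

text \<open>The averaging estimate is \<open>6 * ln B / n\<close> with \<open>B\<close> linear in
  \<open>n\<close>, hence small for large \<open>n\<close>. The bound on cardinalities does not
  depend on \<open>l\<close>, so \<open>l\<close> may be chosen after \<open>n\<close>.\<close>

lemma hyperbolic_almost_invariant:
  assumes hyp: "hyperbolic_graph V E"
    and unif: "\<And>n. \<exists>N. \<forall>e\<in>E. finite (circuit_vertices V E n e) \<and> card (circuit_vertices V E n e) \<le> N"
    and e: "(e::real) > 0"
  obtains I \<eta> R where "\<forall>x\<in>V. I x \<subseteq> {p \<in> V. d x p \<le> R} \<and> fprob (I x) (\<eta> x)"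
    "\<forall>x\<in>V. \<forall>y\<in>V. d x y \<le> D \<longrightarrow> l1d (\<eta> x) (\<eta> y) \<le> e"
proof -
  obtain t where t: "t \<in> V" using conn by (auto simp: connected_graph_def)
  obtain \<delta> :: real where \<delta>: "\<And>\<alpha> \<beta> k. geodesic_path V E \<alpha> \<Longrightarrow> geodesic_path V E \<beta> \<Longrightarrow> hd \<alpha> = hd \<beta> \<Longrightarrow>
      real k \<le> gromov_product V E (last \<alpha>) (last \<beta>) (hd \<alpha>) \<Longrightarrow> d (\<alpha> ! k) (\<beta> ! k) < \<delta>"
    using hyp unfolding hyperbolic_graph_def by blast
  define m where "m = nat \<lceil>\<delta>\<rceil>"
  have m: "d (\<alpha> ! k) (\<beta> ! k) \<le> m"
    if "geodesic_path V E \<alpha>" "geodesic_path V E \<beta>" "hd \<alpha> = hd \<beta>"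
      "real k \<le> gromov_product V E (last \<alpha>) (last \<beta>) (hd \<alpha>)" for \<alpha> \<beta> k
    using \<delta>[OF that] unfolding m_def by linarith
  obtain N where N: "\<And>e. e \<in> E \<Longrightarrow>
      finite (circuit_vertices V E (Suc (6 * Suc m)) e) \<and> card (circuit_vertices V E (Suc (6 * Suc m)) e) \<le> N"
    using unif by meson
  \<comment> \<open>\<open>C * (n + 2)\<close> bounds the cardinality for all radii up to
    \<open>Suc n * D\<close>, the largest one that the averaging estimate looks at.\<close>
  define C where "C = 1 + (2 * D + 1) * N"
  define B where "B n = C * (n + 2)" for n
  define c where "c = ln (real C)"
  have "(\<lambda>n. 6 * (c + ln (real n + 2)) / real n) \<longlonglongrightarrow> 0"
    by real_asymp
  then have "\<forall>\<^sub>F n in sequentially. 6 * (c + ln (real n + 2)) / real n < e"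
    using e by (rule order_tendstoD)
  then have "\<forall>\<^sub>F n in sequentially. 6 * (c + ln (real n + 2)) / real n < e \<and> n > 0"
    using eventually_gt_at_top by (rule eventually_conj)
  then obtain n where ne: "6 * (c + ln (real n + 2)) / real n < e" and n: "n > 0"
    using eventually_happens'[OF sequentially_bot] by blast
  have "C > 0" by (simp add: C_def)
  have "real (B n) = real C * (real n + 2)" by (simp add: B_def algebra_simps)
  then have "ln (B n) = c + ln (real n + 2)" using \<open>C > 0\<close> by (simp only: c_def) (subst ln_mult; simp)
  with ne have Be: "6 * ln (B n) / n < e" by simp
  define l where "l = Suc n * D + Suc m"
  define T where "T k x = geodesic_points t l (k * D) x" for k x
  have T: "finite (T k x) \<and> T k x \<noteq> {} \<and> card (T k x) \<le> B n" if "x \<in> V" "k \<le> Suc n" for x k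
  proof -
    have kD: "k * D \<le> Suc n * D" using that by (intro mult_le_mono1)
    have "finite (T k x) \<and> card (T k x) \<le> 1 + (2 * (k * D) + 1) * N"
      unfolding T_def by (rule card_geodesic_points_le[OF t that(1) m N]) (use kD l_def in auto)
    moreover have "1 + (2 * (k * D) + 1) * N \<le> B n"
    proof -
      have "1 + (2 * (k * D) + 1) * N \<le> 1 + (2 * (Suc n * D) + 1) * N"
        by (intro add_left_mono mult_le_mono1 add_right_mono mult_le_mono2 kD)
      also have "\<dots> \<le> B n" by (simp add: B_def C_def algebra_simps)
      finally show ?thesis .
    qed
    ultimately show ?thesis using geodesic_points_nonempty[OF t that(1)] by (auto simp: T_def)
  qed
  have sub: "T k x \<subseteq> T (Suc k) y" if "x \<in> V" "y \<in> V" "d x y \<le> D" for k x y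
    unfolding T_def by (rule geodesic_points_mono[OF that]) simp
  have mono: "T k x \<subseteq> T n x" if "x \<in> V" "k \<le> n" for k x
    by (rule lift_Suc_mono_le[of "\<lambda>k. T k x", OF _ that(2)]) (use sub that in auto)
  define \<eta> where "\<eta> x = mixture (unif {..<n}) (\<lambda>k. unif (T k x))" for x
  show thesis
  proof (rule that[where I = "T n" and R = "n * D + l" and \<eta> = \<eta>]; intro ballI impI)
    fix x assume x: "x \<in> V"
    have "fprob (T n x) (\<eta> x)"
      unfolding \<eta>_def
    proof (rule fprob_mixture[OF fprob_unif])
      fix k assume "0 < unif {..<n} k"
      then have k: "k < n" by (simp add: unif_def split: if_splits)
      show "fprob (T n x) (unif (T k x))"
        by (rule fprob_mono[OF fprob_unif]) (use T[OF x, of k] T[OF x, of n] mono[OF x, of k] k in auto)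
    qed (use T[OF x, of n] n in auto)
    moreover have "T n x \<subseteq> {p \<in> V. d x p \<le> n * D + l}"
    proof
      fix p assume p: "p \<in> T n x"
      then have "p \<in> V" by (simp add: T_def geodesic_points_def)
      then show "p \<in> {p \<in> V. d x p \<le> n * D + l}" using geodesic_points_dist[OF t x p[unfolded T_def]] by simp
    qed
    ultimately show "T n x \<subseteq> {p \<in> V. d x p \<le> n * D + l} \<and> fprob (T n x) (\<eta> x)" by blast
  next
    fix x y assume xy: "x \<in> V" "y \<in> V" "d x y \<le> D"
    have "l1d (\<eta> x) (\<eta> y) \<le> 6 * ln (B n) / n"
      unfolding \<eta>_def
    proof (rule l1d_average_le[OF n])
      fix k z z' assume "z \<in> {x, y}" "z' \<in> {x, y}"
      then show "T k z \<subseteq> T (Suc k) z'" using xy d_commute[of x y] by (intro sub) auto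
    qed (use T xy in auto)
    then show "l1d (\<eta> x) (\<eta> y) \<le> e" using Be by linarith
  qed
qed

end

section \<open>Groups acting on fine hyperbolic graphs\<close>

locale graph_action_on = group G + conn_graph V E
  for G (structure) and V :: "'v set" and E +
  fixes \<phi>
  assumes action: "graph_action G V E \<phi>"
begin

sublocale act: group_action G V \<phi>
  using action by (simp add: graph_action_def)

lemma act_in: "g \<in> carrier G \<Longrightarrow> x \<in> V \<Longrightarrow> \<phi> g x \<in> V"
  using act.element_image by blast

lemma act_inv: "g \<in> carrier G \<Longrightarrow> x \<in> V \<Longrightarrow> \<phi> (inv g) (\<phi> g x) = x"
  using act.orbit_sym_aux by blast

lemma act_inv': "g \<in> carrier G \<Longrightarrow> x \<in> V \<Longrightarrow> \<phi> g (\<phi> (inv g) x) = x"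
  using act_inv[of "inv g" x] by simp

lemma act_edge:
  "g \<in> carrier G \<Longrightarrow> x \<in> V \<Longrightarrow> y \<in> V \<Longrightarrow> {\<phi> g x, \<phi> g y} \<in> E \<longleftrightarrow> {x, y} \<in> E"
  using action unfolding graph_action_def by blast

lemma d_act_le:
  assumes g: "g \<in> carrier G" and V: "x \<in> V" "y \<in> V"
  shows "d (\<phi> g x) (\<phi> g y) \<le> d x y"
proof -
  have "(\<phi> g x, \<phi> g y) \<in> graph_step V E ^^ n" if "(x, y) \<in> graph_step V E ^^ n" for n
    using that
  proof (induction n arbitrary: y)
    case (Suc n)
    then obtain z where z: "(x, z) \<in> graph_step V E ^^ n" "(z, y) \<in> graph_step V E" by auto
    then have "(\<phi> g z, \<phi> g y) \<in> graph_step V E" using act_edge[OF g] act_in[OF g] by (auto simp: graph_step_def)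
    then show ?case using Suc.IH[OF z(1)] by (rule relpow_Suc_I[rotated])
  qed simp
  then show ?thesis using d_le_iff d_relpow V act_in[OF g] by simp
qed

lemma d_act:
  assumes g: "g \<in> carrier G" and V: "x \<in> V" "y \<in> V"
  shows "d (\<phi> g x) (\<phi> g y) = d x y"
proof (rule antisym[OF d_act_le[OF assms]])
  show "d x y \<le> d (\<phi> g x) (\<phi> g y)"
    using d_act_le[of "inv g" "\<phi> g x" "\<phi> g y"] g V act_in[OF g] by (simp add: act_inv)
qed

section \<open>Circuits under the action and uniform fineness\<close>

lemma circuit_map:
  assumes g: "g \<in> carrier G" and p: "circuit V E p"
  shows "circuit V E (map (\<phi> g) p)"
proof -
  have pV: "p \<noteq> []" "set p \<subseteq> V" using p by (auto simp: circuit_def graph_path_def)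
  have "graph_path V E (map (\<phi> g) p)"
    unfolding graph_path_def
  proof (intro conjI allI impI)
    show "set (map (\<phi> g) p) \<subseteq> V" using pV act_in[OF g] by auto
    fix i assume i: "Suc i < length (map (\<phi> g) p)"
    then have "p ! i \<in> V" "p ! Suc i \<in> V" using pV nth_mem by auto
    moreover have "p ! i = p ! Suc i \<or> {p ! i, p ! Suc i} \<in> E"
      using p i by (auto simp: circuit_def graph_path_def)
    ultimately show "map (\<phi> g) p ! i = map (\<phi> g) p ! Suc i \<or> {map (\<phi> g) p ! i, map (\<phi> g) p ! Suc i} \<in> E"
      using act_edge[OF g] i by auto
  qed (use pV in simp)
  moreover have "distinct (butlast (map (\<phi> g) p))"
  proof -
    have "set (butlast p) \<subseteq> V" using pV in_set_butlastD by fastforce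
    then have "inj_on (\<phi> g) (set (butlast p))" using act.inj_prop[OF g] inj_on_subset by blast
    then show ?thesis using p by (simp add: map_butlast[symmetric] distinct_map circuit_def)
  qed
  ultimately show ?thesis using p pV by (simp add: circuit_def hd_map last_map)
qed

lemma path_edges_map: "path_edges (map f p) = (`) f ` path_edges p"
  unfolding path_edges_def setcompr_eq_image image_image by (rule image_cong) auto

lemma circuit_vertices_image:
  assumes g: "g \<in> carrier G" and e: "e \<subseteq> V"
  shows "circuit_vertices V E n (\<phi> g ` e) \<subseteq> \<phi> g ` circuit_vertices V E n e"
proof
  fix v assume "v \<in> circuit_vertices V E n (\<phi> g ` e)"
  then obtain p where p: "circuit V E p" "path_length p \<le> n" "\<phi> g ` e \<in> path_edges p" "v \<in> set p"
    by (auto simp: circuit_vertices_def)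
  let ?q = "map (\<phi> (inv g)) p"
  have vV: "v \<in> V" using p(1,4) by (auto simp: circuit_def graph_path_def)
  have "\<phi> (inv g) ` (\<phi> g ` e) = e"
    unfolding image_image using e act_inv[OF g] by force
  then have "e \<in> path_edges ?q" using p(3) unfolding path_edges_map by (metis image_eqI)
  moreover have "circuit V E ?q" using circuit_map p(1) g by simp
  moreover have "path_length ?q \<le> n" using p(2) by (simp add: path_length_def)
  ultimately have "set ?q \<subseteq> circuit_vertices V E n e" unfolding circuit_vertices_def by blast
  then have "\<phi> (inv g) v \<in> circuit_vertices V E n e" using p(4) by auto
  then show "v \<in> \<phi> g ` circuit_vertices V E n e" using act_inv'[OF g vV] by (metis image_eqI)
qed

text \<open>A group element carries the circuits through an edge to those through its image, so a
  bound at one edge holds on its whole orbit; the sum over finitely many representatives bounds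
  all.\<close>

lemma uniformly_fine:
  assumes fine: "fine_graph V E" and fin: "finite (orbits G E (\<lambda>g e. \<phi> g ` e))"
  shows "\<exists>N. \<forall>e\<in>E. finite (circuit_vertices V E n e) \<and> card (circuit_vertices V E n e) \<le> N"
proof -
  have finite: "finite (circuit_vertices V E n e)" if "e \<in> E" for e
    using fine that unfolding circuit_vertices_def fine_graph_def by blast
  let ?orb = "\<lambda>e. orbit G (\<lambda>g e. \<phi> g ` e) e"
  obtain R where R: "finite R" "R \<subseteq> E" "?orb ` E = ?orb ` R"
  proof -
    have "finite (?orb ` E)" using fin by (simp add: orbits_def Setcompr_eq_image)
    then show thesis using finite_subset_image[of "?orb ` E" ?orb E] that by blast
  qed
  have "card (circuit_vertices V E n e) \<le> (\<Sum>r\<in>R. card (circuit_vertices V E n r))" if e: "e \<in> E" for e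
  proof -
    obtain r where r: "r \<in> R" "?orb e = ?orb r" using R(3) e by blast
    have "\<phi> \<one> ` e = e"
    proof -
      have "e \<subseteq> V" using e simple by (simp add: simple_graph_def)
      then have "\<phi> \<one> x = x" if "x \<in> e" for x using act.id_eq_one[symmetric] that by auto
      then show ?thesis by simp
    qed
    then have "e \<in> ?orb e" unfolding orbit_def by (metis (mono_tags, lifting) mem_Collect_eq one_closed)
    then have "\<exists>g. e = \<phi> g ` r \<and> g \<in> carrier G" unfolding r(2) unfolding orbit_def mem_Collect_eq .
    then obtain g where g: "g \<in> carrier G" "e = \<phi> g ` r" by (elim exE conjE)
    have rV: "r \<subseteq> V" "r \<in> E" using r R simple by (auto simp: simple_graph_def)
    have "card (circuit_vertices V E n e) \<le> card (\<phi> g ` circuit_vertices V E n r)"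
      unfolding g(2) by (rule card_mono[OF _ circuit_vertices_image[OF g(1) rV(1)]]) (use finite[OF rV(2)] in simp)
    also have "\<dots> \<le> card (circuit_vertices V E n r)" using finite[OF rV(2)] by (rule card_image_le)
    also have "\<dots> \<le> (\<Sum>r\<in>R. card (circuit_vertices V E n r))" using r R(1) by (intro member_le_sum) auto
    finally show ?thesis .
  qed
  then show ?thesis using finite by blast
qed

text \<open>The strict inequality makes radius 0 give the empty set, from which the induction
  starts. The set is invariant under left multiplication by the stabilizer of
  \<open>w\<close>.\<close>

definition orbit_ball :: "'v \<Rightarrow> 'v \<Rightarrow> nat \<Rightarrow> 'a set" where
  "orbit_ball v w n = {z \<in> carrier G. d (\<phi> z v) w < n}"

text \<open>
  Two elements of the sphere of radius \<open>n\<close> that differ by \<open>s\<close> lie in one coset of the stabilizer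
  of \<open>w\<close>, unless the first vertex of a geodesic from \<open>w\<close> belongs to a finite set depending on \<open>s\<close>;
  in that case the elements lie in one of finitely many smaller balls around other vertices.
\<close>

lemma property_A_orbit_ball:
  assumes fine: "fine_graph V E" and stab: "\<And>w. w \<in> V \<Longrightarrow> property_A (stabilizer G \<phi> w)"
    and v: "v \<in> V" and "w \<in> V"
  shows "property_A (orbit_ball v w n)"
  using \<open>w \<in> V\<close>
proof (induction n arbitrary: w)
  case 0
  then show ?case using property_A_empty by (simp add: orbit_ball_def)
next
  case (Suc n)
  have orbit_ballG: "orbit_ball v u k \<subseteq> carrier G" for u k by (auto simp: orbit_ball_def)
  show ?case
  proof (rule property_A_union[OF orbit_ballG])
    fix S and e :: real assume S: "finite S" "S \<subseteq> carrier G" and e: "e > 0"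
    \<comment> \<open>\<open>F\<close> has to contain the neighbours of \<open>w\<close> that begin
      a geodesic from \<open>w\<close> to a vertex at distance \<open>n\<close> from both
      \<open>w\<close> and \<open>s\<inverse> w\<close>; no neighbour is required if
      \<open>s\<close> fixes \<open>w\<close>.\<close>
    let ?P = "\<lambda>s F. finite F \<and> F \<subseteq> V \<and> (\<forall>u x. u \<in> V \<longrightarrow> x \<in> V \<longrightarrow> {w, u} \<in> E \<longrightarrow>
        d u x < d w x \<longrightarrow> d w x = n \<longrightarrow> d (\<phi> (inv s) w) x = n \<longrightarrow> w \<noteq> \<phi> (inv s) w \<longrightarrow> u \<in> F)"
    have "\<exists>F. ?P s F" if "s \<in> S" for s
    proof (cases "w = \<phi> (inv s) w")
      case True
      then show ?thesis by (intro exI[of _ "{}"]) simp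
    next
      case False
      have "\<phi> (inv s) w \<in> V" using act_in Suc.prems S that by auto
      from finite_first_vertices[OF fine Suc.prems this False, of n]
      show ?thesis by (metis (no_types, lifting))
    qed
    then obtain F where F: "\<And>s. s \<in> S \<Longrightarrow> ?P s (F s)" by metis
    let ?U = "\<Union>s\<in>S. F s"
    \<comment> \<open>The discarded balls are also centred at the exceptional first vertices, which
      is why the induction runs over all centres.\<close>
    let ?A = "orbit_ball v w n \<union> (\<Union>u\<in>?U. orbit_ball v u n)"
    have U: "finite ?U" "?U \<subseteq> V" using F S(1) by blast+
    have pA: "property_A ?A"
      using U Suc by (intro property_A_Un property_A_UN) (auto simp: orbit_ball_def)
    have sep: "s \<in> stabilizer G \<phi> w"
      if s: "s \<in> S" and z: "z \<in> orbit_ball v w (Suc n) - ?A" and sz: "s \<otimes> z \<in> orbit_ball v w (Suc n) - ?A" for s z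
    proof (rule ccontr)
      assume ns: "s \<notin> stabilizer G \<phi> w"
      have G: "s \<in> carrier G" "z \<in> carrier G" using s S z by (auto simp: orbit_ball_def)
      let ?x = "\<phi> z v" and ?w' = "\<phi> (inv s) w"
      have V: "?x \<in> V" "?w' \<in> V" using act_in G v Suc.prems by auto
      have "w \<noteq> ?w'"
      proof
        assume "w = ?w'"
        then have "\<phi> s w = w" using act_inv'[OF G(1) Suc.prems] by simp
        then show False using ns G by (simp add: stabilizer_def)
      qed
      moreover have dn: "d w ?x = n"
        using z d_commute[OF V(1) Suc.prems] by (auto simp: orbit_ball_def)
      \<comment> \<open>\<open>s \<otimes> z\<close> moves \<open>v\<close> to distance
        \<open>n\<close> from \<open>w\<close>, so \<open>z\<close> moves it to distance
        \<open>n\<close> from \<open>s\<inverse> w\<close>.\<close>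
      moreover have "d ?w' ?x = n"
      proof -
        have "d ?w' ?x = d (\<phi> s ?w') (\<phi> s ?x)" using d_act G V by simp
        also have "\<dots> = d w (\<phi> (s \<otimes> z) v)"
          using act_inv'[OF G(1) Suc.prems] act.composition_rule[OF v G] by simp
        also have "\<dots> = n"
          using sz d_commute[OF act_in[OF m_closed[OF G] v] Suc.prems] by (auto simp: orbit_ball_def)
        finally show ?thesis .
      qed
      moreover have "n > 0"
        using calculation d_eq_0[OF Suc.prems V(1)] d_eq_0[OF V(2,1)] by (cases n) auto
      moreover obtain u where u: "u \<in> V" "d w u = 1" "d u ?x = n - 1"
      proof -
        have "1 \<le> d w ?x" using dn \<open>n > 0\<close> by simp
        then show thesis using d_between[OF Suc.prems V(1)] dn that by metis
      qed
      moreover have "{w, u} \<in> E" using d_eq_1[OF Suc.prems u(1,2)] .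
      ultimately have "u \<in> F s" using F[OF s] V by simp
      then have "u \<in> ?U" using s by blast
      moreover have "z \<in> orbit_ball v u n"
        using G u d_commute[OF u(1) V(1)] \<open>n > 0\<close> by (simp add: orbit_ball_def)
      ultimately show False using z by blast
    qed
    have "almost_inv (orbit_ball v w (Suc n) - ?A) S e"
      by (rule almost_inv_coset[OF act.stabilizer_subgroup[OF Suc.prems] stab[OF Suc.prems] _ S e sep])
         (auto simp: orbit_ball_def)
    then show "\<exists>A\<subseteq>carrier G. property_A A \<and> almost_inv (orbit_ball v w (Suc n) - A) S e"
      using pA by (intro exI[of _ ?A] conjI) (auto simp: orbit_ball_def)
  qed
qed

lemma property_A_group:
  assumes fine: "fine_graph V E" and hyp: "hyperbolic_graph V E"
    and finV: "finite (orbits G V \<phi>)" and finE: "finite (orbits G E (\<lambda>g e. \<phi> g ` e))"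
    and stab: "\<And>w. w \<in> V \<Longrightarrow> property_A (stabilizer G \<phi> w)"
  shows "property_A (carrier G)"
  unfolding property_A_def
proof (intro allI impI)
  fix S and e :: real assume S: "finite S \<and> S \<subseteq> carrier G \<and> e > 0"
  obtain w where w: "w \<in> V" using conn by (auto simp: connected_graph_def)
  \<comment> \<open>The distance between arguments that \<eta> has to tolerate; the inserted 0 keeps
    the maximum defined for empty \<open>S\<close>.\<close>
  define D where "D = Max (insert 0 ((\<lambda>s. d (\<phi> s w) w) ` S))"
  have D: "d (\<phi> s w) w \<le> D" if "s \<in> S" for s unfolding D_def using S that by (intro Max_ge) auto
  have "e/2 > 0" using S by simp
  obtain I \<eta> R where I: "\<forall>x\<in>V. I x \<subseteq> {p \<in> V. d x p \<le> R} \<and> fprob (I x) (\<eta> x)"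
    and \<eta>D: "\<forall>x\<in>V. \<forall>y\<in>V. d x y \<le> D \<longrightarrow> l1d (\<eta> x) (\<eta> y) \<le> e/2"
    by (rule hyperbolic_almost_invariant[OF hyp uniformly_fine[OF fine finE] \<open>e/2 > 0\<close>])
  note I = I[rule_format] and \<eta>D = \<eta>D[rule_format]
  have \<eta>R: "p \<in> V \<and> d x p \<le> R" if "x \<in> V" "\<eta> x p > 0" for x p
  proof -
    have "p \<in> I x"
    proof (rule ccontr)
      assume "p \<notin> I x"
      then have "\<eta> x p = 0" using I[OF that(1)] by (simp add: fprob_def)
      then show False using that(2) by simp
    qed
    then show ?thesis using I[OF that(1)] by blast
  qed
  obtain Q where Q: "finite Q" "Q \<subseteq> V" "orbit G \<phi> ` V = orbit G \<phi> ` Q"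
  proof -
    have "finite (orbit G \<phi> ` V)" using finV by (simp add: orbits_def Setcompr_eq_image)
    then show thesis using finite_subset_image[of "orbit G \<phi> ` V" "orbit G \<phi>" V] that by blast
  qed
  have "\<forall>v\<in>V. \<exists>rg. fst rg \<in> Q \<and> snd rg \<in> carrier G \<and> \<phi> (snd rg) (fst rg) = v"
  proof
    fix v assume v: "v \<in> V"
    then obtain r where r: "r \<in> Q" "orbit G \<phi> v = orbit G \<phi> r" using Q(3) by blast
    have "v \<in> orbit G \<phi> r" unfolding r(2)[symmetric] by (rule act.orbit_refl[OF v])
    then obtain g where "v = \<phi> g r" "g \<in> carrier G"
      unfolding orbit_def mem_Collect_eq by (elim exE conjE)
    with r(1) show "\<exists>rg. fst rg \<in> Q \<and> snd rg \<in> carrier G \<and> \<phi> (snd rg) (fst rg) = v"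
      by (intro exI[of _ "(r, g)"]) simp
  qed
  from bchoice[OF this] obtain rg where
    rg: "\<forall>v\<in>V. fst (rg v) \<in> Q \<and> snd (rg v) \<in> carrier G \<and> \<phi> (snd (rg v)) (fst (rg v)) = v" ..
  \<comment> \<open>A vertex \<open>v\<close> is \<open>g v\<close> applied to its orbit
    representative \<open>r v\<close>, so that only finitely many families of functions are needed
    and their supports have a finite union.\<close>
  define r g where "r v = fst (rg v)" and "g v = snd (rg v)" for v
  have rg: "r v \<in> Q \<and> g v \<in> carrier G \<and> \<phi> (g v) (r v) = v" if "v \<in> V" for v
    using rg that by (simp add: r_def g_def)
  have "almost_inv (orbit_ball o' w (Suc R)) S (e/2)" if "o' \<in> Q" for o'
    by (rule property_AD[OF property_A_orbit_ball[OF fine stab]]) (use that Q(2) w S in auto)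
  then have "\<forall>o'\<in>Q. \<exists>F \<mu>. F \<subseteq> carrier G \<and> finite F \<and> (\<forall>z\<in>orbit_ball o' w (Suc R). fprob F (\<mu> z)) \<and>
     (\<forall>s\<in>S. \<forall>z\<in>orbit_ball o' w (Suc R). s \<otimes> z \<in> orbit_ball o' w (Suc R) \<longrightarrow> l1d (left_shift s (\<mu> z)) (\<mu> (s \<otimes> z)) \<le> e/2)"
    unfolding almost_inv_def by (intro ballI)
  from this[unfolded bchoice_iff] obtain F \<mu> where \<mu>:
    "\<forall>o'\<in>Q. F o' \<subseteq> carrier G \<and> finite (F o') \<and> (\<forall>z\<in>orbit_ball o' w (Suc R). fprob (F o') (\<mu> o' z)) \<and>
     (\<forall>s\<in>S. \<forall>z\<in>orbit_ball o' w (Suc R). s \<otimes> z \<in> orbit_ball o' w (Suc R) \<longrightarrow>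
        l1d (left_shift s (\<mu> o' z)) (\<mu> o' (s \<otimes> z)) \<le> e/2)"
    by (elim exE)
  let ?F = "\<Union>o'\<in>Q. F o'"
  have F: "finite ?F" "?F \<subseteq> carrier G" using \<mu> Q(1) by (simp, intro UN_least, simp)
  define x where "x z = \<phi> (inv z) w" for z
  have xV: "x z \<in> V" if "z \<in> carrier G" for z using act_in w that by (simp add: x_def)
  \<comment> \<open>A vertex of positive weight is within \<open>R\<close> of
    \<open>z\<inverse> w\<close>, so \<open>z\<close> moves it to within \<open>R\<close> of
    \<open>w\<close>. The ball is open, hence \<open>Suc R\<close>.\<close>
  have mem: "z \<otimes> g v \<in> orbit_ball (r v) w (Suc R)" "r v \<in> Q" "g v \<in> carrier G"
    if z: "z \<in> carrier G" and pos: "\<eta> (x z) v > 0" for z v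
  proof -
    have v: "v \<in> V" "d (x z) v \<le> R" using \<eta>R[OF xV[OF z] pos] by auto
    note rg = rg[OF v(1)]
    show "r v \<in> Q" "g v \<in> carrier G" using rg by auto
    have "\<phi> (z \<otimes> g v) (r v) = \<phi> z v" using act.composition_rule[of "r v" z "g v"] rg Q(2) z by auto
    moreover have "d (\<phi> z v) w = d (x z) v"
      using d_act[OF z xV[OF z] v(1)] act_inv'[OF z w] d_commute[OF w act_in[OF z v(1)]] by (simp add: x_def)
    ultimately show "z \<otimes> g v \<in> orbit_ball (r v) w (Suc R)" using v rg z by (simp add: orbit_ball_def)
  qed
  have "almost_inv (carrier G) S (e/2 + e/2)"
  proof (rule almost_inv_glue[where \<phi> = "\<lambda>z. \<eta> (x z)" and I = "\<lambda>z. I (x z)" and F = ?F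
        and \<nu> = "\<lambda>v z. \<mu> (r v) (z \<otimes> g v)"])
    fix z assume "z \<in> carrier G"
    then show "fprob (I (x z)) (\<eta> (x z))" using I xV by blast
  next
    fix z v assume z: "z \<in> carrier G" "\<eta> (x z) v > 0"
    have "fprob (F (r v)) (\<mu> (r v) (z \<otimes> g v))" using \<mu> mem[OF z] by simp
    then show "fprob ?F (\<mu> (r v) (z \<otimes> g v))" by (rule fprob_mono) (use mem[OF z] F in auto)
  next
    fix s z assume s: "s \<in> S" and z: "z \<in> carrier G"
    have sG: "s \<in> carrier G" using s S by auto
    have "d (x z) (x (s \<otimes> z)) \<le> D"
    proof -
      have "x (s \<otimes> z) = \<phi> (inv z) (\<phi> (inv s) w)"
        using act.composition_rule[OF w, of "inv z" "inv s"] sG z by (simp add: x_def inv_mult_group)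
      then have "d (x z) (x (s \<otimes> z)) = d w (\<phi> (inv s) w)"
        using d_act[of "inv z" w "\<phi> (inv s) w"] act_in sG z w by (simp add: x_def)
      also have "\<dots> = d (\<phi> s w) (\<phi> s (\<phi> (inv s) w))" using d_act[OF sG w] act_in sG w by simp
      also have "\<dots> = d (\<phi> s w) w" using act_inv'[OF sG w] by simp
      finally show ?thesis using D[OF s] by simp
    qed
    then show "l1d (\<eta> (x z)) (\<eta> (x (s \<otimes> z))) \<le> e/2" using \<eta>D xV z sG by simp
  next
    fix s z v assume s: "s \<in> S" and z: "z \<in> carrier G" and p: "\<eta> (x z) v > 0" "\<eta> (x (s \<otimes> z)) v > 0"
    have sG: "s \<in> carrier G" and sz: "s \<otimes> z \<in> carrier G" using s S z by auto
    note m = mem[OF z p(1)] mem[OF sz p(2)]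
    \<comment> \<open>Right multiplication by \<open>g v\<close> commutes with the step
      \<open>s\<close>, so for fixed \<open>v\<close> two points of the same ball are compared that
      differ by \<open>s\<close>.\<close>
    have eq: "s \<otimes> z \<otimes> g v = s \<otimes> (z \<otimes> g v)" using m_assoc[OF sG z m(3)] .
    show "l1d (left_shift s (\<mu> (r v) (z \<otimes> g v))) (\<mu> (r v) (s \<otimes> z \<otimes> g v)) \<le> e/2"
      using \<mu>[rule_format, OF m(2), THEN conjunct2, THEN conjunct2, THEN conjunct2, rule_format, OF s m(1)] m(4)
      unfolding eq by blast
  qed (use S F in auto)
  then show "almost_inv (carrier G) S e" by simp
qed

end

theorem corollary3:
  fixes \<Gamma> :: "('a, 'm) monoid_scheme" and \<G> :: "'a set set"
  assumes "group \<Gamma>"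
    and "finitely_generated \<Gamma>"
    and "rel_hyperbolic TYPE('v) \<Gamma> \<G>"
    and "\<forall>H\<in>\<G>. exact_group TYPE('x) (\<Gamma>\<lparr>carrier := H\<rparr>)"
  shows "exact_group TYPE('a set set) \<Gamma>"
proof -
  interpret group \<Gamma> by fact
  obtain V :: "'v set" and E \<phi> where
    graph: "simple_graph V E" "connected_graph V E" "fine_graph V E" "hyperbolic_graph V E"
    and act: "graph_action \<Gamma> V E \<phi>"
    and fin: "finite (orbits \<Gamma> V \<phi>)" "finite (orbits \<Gamma> E (\<lambda>g e. \<phi> g ` e))"
    and \<G>: "\<G> = {stabilizer \<Gamma> \<phi> x | x. x \<in> V \<and> infinite (stabilizer \<Gamma> \<phi> x)}"
    using assms(3) unfolding rel_hyperbolic_def by blast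
  interpret graph_action_on \<Gamma> V E \<phi>
    by unfold_locales (use graph act in auto)
  \<comment> \<open>The family contains only infinite stabilizers; finite ones are covered by
    uniform functions.\<close>
  have "property_A (stabilizer \<Gamma> \<phi> w)" if w: "w \<in> V" for w
  proof (cases "finite (stabilizer \<Gamma> \<phi> w)")
    case True
    then show ?thesis by (rule property_A_finite_subgroup[OF _ act.stabilizer_subgroup[OF w]])
  next
    case False
    let ?H = "\<Gamma>\<lparr>carrier := stabilizer \<Gamma> \<phi> w\<rparr>"
    note sub = act.stabilizer_subgroup[OF w]
    interpret H: group ?H by (rule subgroup_imp_group[OF sub])
    have "stabilizer \<Gamma> \<phi> w \<in> \<G>" using \<G> w False by blast
    then have "exact_group TYPE('x) ?H" using assms(4) by blast
    then have "H.property_A (stabilizer \<Gamma> \<phi> w)" using H.exact_group_imp_property_A by force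
    then show ?thesis by (rule property_A_of_subgroup[OF sub])
  qed
  then have "property_A (carrier \<Gamma>)" by (rule property_A_group[OF graph(3,4) fin])
  then show ?thesis by (rule property_A_imp_exact_group)
qed

end
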